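(* Let $\sigma\ge0$, let $N\in\{0,1,2,\dots\}\cup\{\infty\}$, let $\alpha_j\in\mathbb{R}\setminus\{0\}$ ($1\le j\le N$) with $\sum_{j=1}^N\alpha_j^{-2}<\infty$, and let $$g(z)=e^{-\sigma^2z}\prod_{j=1}^N\Big(1-\frac{z}{\alpha_j^2}\Big).$$ Let $n=n_d>-1$ be real with $\frac{d}{n+d}\to\lambda\in(0,1]$ as $d\to\infty$, let $M_n=zD^2+(n+1)D$ with $D=\frac{d}{dz}$, and let $$\hat L_d(z)=g\Big(\frac{M_n}{d(n+d)}\Big)^dz^d.$$ Then, as $d\to\infty$, $\sqrt{\mu_{\hat L_d}}$ converges weakly to the $\boxplus_\lambda$-infinitely divisible distribution $\tilde\mu_g$ with rectangular $R$-transform with ratio $\lambda$ $$C^\lambda_{\tilde\mu_g}(z)=z\int_{\mathbb{R}}\frac{t^2+1}{1-zt^2}\,dG_g(t),\qquad G_g=\sigma^2\delta_0+\sum_{j=1}^N\frac{1}{\alpha_j^2+1}\cdot\frac12\big[\delta_{1/\alpha_j}+\delta_{-1/\alpha_j}\big].$$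
   Context: For a degree $d$ polynomial $p$ with real roots $y_1,\dots,y_d$, $\mu_p=\frac1d\sum_j\delta_{y_j}$. For a measure $\mu$ on $[0,\infty)$, $\sqrt\mu$ is the symmetrization of the push-forward of $\mu$ by $t\mapsto\sqrt t$ (if $p$ has roots $\beta_1^2,\dots,\beta_d^2$, then $\sqrt{\mu_p}=\frac1{2d}\sum_j(\delta_{\beta_j}+\delta_{-\beta_j})$). A power series in a constant multiple of $M_n$ acts on polynomials termwise (a finite sum, since $M_n$ lowers the degree); the $d$-th power is $d$-fold composition. The polynomials $\hat L_d$ have only non-negative roots. Rectangular $R$-transform with ratio $\lambda\in(0,1]$ of a symmetric probability measure $\mu$ on $\mathbb{R}$: let $M_{\mu^2}(z)=\int\frac{zt^2}{1-t^2z}d\mu(t)$, $H_\mu(z)=z(\lambda M_{\mu^2}(z)+1)(M_{\mu^2}(z)+1)$, which is invertible on $(-\beta,0)$ for some small $\beta>0$, and $U(z)=\frac{-\lambda-1+\sqrt{(\lambda+1)^2+4\lambda z}}{2\lambda}$ near $0$; then $C^\lambda_\mu(z)=U\big(\frac{z}{H_\mu^{-1}(z)}-1\big)$. The rectangular free convolution $\mu\boxplus_\lambda\nu$ of symmetric probability measures is the unique symmetric probability measure with $C^\lambda_{\mu\boxplus_\lambda\nu}=C^\lambda_\mu+C^\lambda_\nu$. A symmetric probability measure $\nu$ is $\boxplus_\lambda$-infinitely divisible if for every $k\in\mathbb{N}$ there is a symmetric probability measure $\nu_k$ whose $k$-fold $\boxplus_\lambda$-convolution is $\nu$. *)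

theory Defs
  imports "HOL-Probability.Probability" "HOL-Computational_Algebra.Polynomial"
    "HOL-Library.Extended_Nat"
begin

subsection \<open>Symmetric measures and root distributions\<close>

definition symmetric_distribution :: "real measure \<Rightarrow> bool" where
  "symmetric_distribution \<mu> \<longleftrightarrow> real_distribution \<mu> \<and> distr \<mu> borel uminus = \<mu>"

definition symmetrization :: "real measure \<Rightarrow> real measure" where
  "symmetrization \<nu> = measure_of UNIV (sets borel)
     (\<lambda>A. (emeasure \<nu> A + emeasure (distr \<nu> borel uminus) A) / 2)"

lemma sets_symmetrization [simp]: "sets (symmetrization \<nu>) = sets borel"
  using sets.sets_measure_of_eq[of "borel :: real measure"] by (simp add: symmetrization_def)

lemma emeasure_symmetrization:
  assumes "sets \<nu> = sets borel" "A \<in> sets borel"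
  shows "emeasure (symmetrization \<nu>) A = (emeasure \<nu> A + emeasure (distr \<nu> borel uminus) A) / 2"
proof (rule emeasure_measure_of[OF symmetrization_def])
  show "countably_additive (sets (symmetrization \<nu>))
          (\<lambda>A. (emeasure \<nu> A + emeasure (distr \<nu> borel uminus) A) / 2)"
  proof (rule countably_additiveI)
    fix B :: "nat \<Rightarrow> real set"
    assume B: "range B \<subseteq> sets (symmetrization \<nu>)" "disjoint_family B"
    have "(\<Sum>i. emeasure \<nu> (B i)) = emeasure \<nu> (\<Union>i. B i)"
      "(\<Sum>i. emeasure (distr \<nu> borel uminus) (B i)) = emeasure (distr \<nu> borel uminus) (\<Union>i. B i)"
      using B assms by (auto intro!: suminf_emeasure)
    then show "(\<Sum>i. (emeasure \<nu> (B i) + emeasure (distr \<nu> borel uminus) (B i)) / 2) =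
       (emeasure \<nu> (\<Union>i. B i) + emeasure (distr \<nu> borel uminus) (\<Union>i. B i)) / 2"
      by (simp add: divide_ennreal_def suminf_add[symmetric])
  qed
qed (use assms in \<open>auto simp: positive_def\<close>)

definition sqrt_measure :: "real measure \<Rightarrow> real measure" where
  "sqrt_measure \<mu> = symmetrization (distr \<mu> borel sqrt)"

text \<open>The library multiset \<^term>\<open>proots p\<close> lists the real roots of \<^term>\<open>p\<close> with multiplicity; for a
  polynomial of degree \<open>d\<close> with only real roots it has size \<open>d\<close>, and the measure below is
  \<open>(1/d) \<Sum>\<^sub>j \<delta>\<^bsub>y j\<^esub>\<close>.\<close>

definition root_measure :: "real poly \<Rightarrow> real measure" where
  "root_measure p = distr (measure_pmf (pmf_of_multiset (proots p))) borel (\<lambda>x. x)"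


subsection \<open>Power series in a degree-lowering operator\<close>

definition laguerre_op :: "real \<Rightarrow> real poly \<Rightarrow> real poly" where
  "laguerre_op n p = [:0, 1:] * pderiv (pderiv p) + smult (n + 1) (pderiv p)"

definition taylor_fps :: "(real \<Rightarrow> real) \<Rightarrow> real fps" where
  "taylor_fps g = Abs_fps (\<lambda>k. (deriv ^^ k) g 0 / fact k)"

lemma taylor_fps_eq:
  assumes "g has_fps_expansion F"
  shows "taylor_fps g = F"
proof -
  have "(deriv ^^ k) g has_fps_expansion (fps_deriv ^^ k) F" for k
    by (induction k) (auto intro: has_fps_expansion_deriv assms)
  then have "(deriv ^^ k) g 0 = eval_fps ((fps_deriv ^^ k) F) 0" for k
    unfolding has_fps_expansion_def by (metis (mono_tags) eventually_nhds_x_imp_x)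
  then show ?thesis
    by (simp add: taylor_fps_def fps_eq_iff eval_fps_at_0 fps_0th_higher_deriv)
qed

text \<open>The terms with \<open>k > degree p\<close> are omitted: they vanish for the operators in question.\<close>

definition fps_op :: "real fps \<Rightarrow> (real poly \<Rightarrow> real poly) \<Rightarrow> real poly \<Rightarrow> real poly" where
  "fps_op F T p = (\<Sum>k\<le>degree p. smult (fps_nth F k) ((T ^^ k) p))"

lemma laguerre_op_funpow_eq_0:
  assumes "degree p < k"
  shows "((\<lambda>q. smult c (laguerre_op n q)) ^^ k) p = 0"
proof -
  let ?T = "\<lambda>q. smult c (laguerre_op n q)"
  have zero: "(?T ^^ m) 0 = 0" for m
    by (induction m) (auto simp: laguerre_op_def)
  have const: "?T q = 0" if "degree q = 0" for q
    using that by (auto simp: laguerre_op_def pderiv_eq_0_iff elim!: degree_eq_zeroE)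
  have deg: "degree (?T q) \<le> degree q - 1" for q
  proof (cases "pderiv q = 0")
    case False
    have "degree ([:0, 1:] * pderiv (pderiv q)) \<le> degree q - 1"
    proof (cases "pderiv (pderiv q) = 0")
      case nz: False
      then have "degree (pderiv q) \<noteq> 0" by (simp add: pderiv_eq_0_iff)
      then show ?thesis using nz by (simp add: degree_mult_eq degree_pderiv)
    qed simp
    moreover have "degree (smult (n + 1) (pderiv q)) \<le> degree q - 1"
      by (simp add: degree_pderiv)
    ultimately show ?thesis
      unfolding laguerre_op_def by (meson degree_add_le degree_smult_le order_trans)
  qed (simp add: laguerre_op_def)
  show ?thesis using assms
  proof (induction k arbitrary: p)
    case (Suc k)
    have step: "(?T ^^ Suc k) p = (?T ^^ k) (?T p)"
      by (simp only: funpow_Suc_right o_apply)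
    show ?case
    proof (cases "degree p = 0")
      case True
      show ?thesis unfolding step const[OF True] by (rule zero)
    next
      case False
      then have "degree (?T p) < k" using deg[of p] Suc.prems by linarith
      then show ?thesis unfolding step by (rule Suc.IH)
    qed
  qed simp
qed


subsection \<open>The rectangular R-transform\<close>

definition rect_M :: "real measure \<Rightarrow> real \<Rightarrow> real" where
  "rect_M \<mu> z = (\<integral>t. z * t\<^sup>2 / (1 - t\<^sup>2 * z) \<partial>\<mu>)"

definition rect_H :: "real \<Rightarrow> real measure \<Rightarrow> real \<Rightarrow> real" where
  "rect_H lam \<mu> z = z * (lam * rect_M \<mu> z + 1) * (rect_M \<mu> z + 1)"

text \<open>The choice of \<open>\<beta>\<close> does not affect the values of the inverse near \<open>0\<close>. Accordingly,
  \<open>rect_R\<close> below is meaningful only as a germ at \<open>0\<close> from the left, and identities between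
  rectangular R-transforms are stated with the filter \<^term>\<open>at_left (0::real)\<close>.\<close>

definition rect_H_inv :: "real \<Rightarrow> real measure \<Rightarrow> real \<Rightarrow> real" where
  "rect_H_inv lam \<mu> = (let \<beta> = (SOME \<beta>. 0 < \<beta> \<and> inj_on (rect_H lam \<mu>) {-\<beta><..<0})
     in inv_into {-\<beta><..<0} (rect_H lam \<mu>))"

definition rect_U :: "real \<Rightarrow> real \<Rightarrow> real" where
  "rect_U lam z = (- lam - 1 + sqrt ((lam + 1)\<^sup>2 + 4 * lam * z)) / (2 * lam)"

definition rect_R :: "real \<Rightarrow> real measure \<Rightarrow> real \<Rightarrow> real" where
  "rect_R lam \<mu> z = rect_U lam (z / rect_H_inv lam \<mu> z - 1)"

definition rect_conv :: "real \<Rightarrow> real measure \<Rightarrow> real measure \<Rightarrow> real measure" where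
  "rect_conv lam \<mu> \<nu> = (THE \<rho>. symmetric_distribution \<rho> \<and>
     (\<forall>\<^sub>F z in at_left 0. rect_R lam \<rho> z = rect_R lam \<mu> z + rect_R lam \<nu> z))"

text \<open>The \<open>k\<close>-fold convolution of \<open>\<mu>\<close> is \<^term>\<open>(rect_conv lam \<mu> ^^ (k - 1)) \<mu>\<close>.\<close>

definition rect_infinitely_divisible :: "real \<Rightarrow> real measure \<Rightarrow> bool" where
  "rect_infinitely_divisible lam \<nu> \<longleftrightarrow> symmetric_distribution \<nu> \<and>
     (\<forall>k\<ge>1. \<exists>\<mu>. symmetric_distribution \<mu> \<and> (rect_conv lam \<mu> ^^ (k - 1)) \<mu> = \<nu>)"


subsection \<open>The function \<open>g\<close>, its polynomials and its measure\<close>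

definition index_set :: "enat \<Rightarrow> nat set" where
  "index_set N = {j. 1 \<le> j \<and> enat j \<le> N}"

definition LP_fun :: "real \<Rightarrow> enat \<Rightarrow> (nat \<Rightarrow> real) \<Rightarrow> real \<Rightarrow> real" where
  "LP_fun \<sigma> N \<alpha> z =
     exp (- (\<sigma>\<^sup>2) * z) * (\<Prod>j. if j \<in> index_set N then 1 - z / (\<alpha> j)\<^sup>2 else 1)"

definition L_hat :: "(real \<Rightarrow> real) \<Rightarrow> real \<Rightarrow> nat \<Rightarrow> real poly" where
  "L_hat g n d =
     (fps_op (taylor_fps g) (\<lambda>p. smult (1 / (real d * (n + real d))) (laguerre_op n p)) ^^ d)
       (monom 1 d)"

definition G_measure :: "real \<Rightarrow> enat \<Rightarrow> (nat \<Rightarrow> real) \<Rightarrow> real measure" where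
  "G_measure \<sigma> N \<alpha> = measure_of UNIV (sets borel) (\<lambda>A.
     ennreal (\<sigma>\<^sup>2) * emeasure (return borel 0) A +
     (\<Sum>j. if j \<in> index_set N
           then ennreal (1 / ((\<alpha> j)\<^sup>2 + 1) * (1 / 2)) *
             (emeasure (return borel (1 / \<alpha> j)) A + emeasure (return borel (- 1 / \<alpha> j)) A)
           else 0))"

lemma sets_G_measure [simp]: "sets (G_measure \<sigma> N \<alpha>) = sets borel"
  using sets.sets_measure_of_eq[of "borel :: real measure"] by (simp add: G_measure_def)

lemma emeasure_G_measure:
  assumes "A \<in> sets borel"
  shows "emeasure (G_measure \<sigma> N \<alpha>) A =
     ennreal (\<sigma>\<^sup>2) * emeasure (return borel 0) A +
     (\<Sum>j. if j \<in> index_set N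
           then ennreal (1 / ((\<alpha> j)\<^sup>2 + 1) * (1 / 2)) *
             (emeasure (return borel (1 / \<alpha> j)) A + emeasure (return borel (- 1 / \<alpha> j)) A)
           else 0)"
proof -
  define h where "h j A = (if j \<in> index_set N
           then ennreal (1 / ((\<alpha> j)\<^sup>2 + 1) * (1 / 2)) *
             (emeasure (return borel (1 / \<alpha> j)) A + emeasure (return borel (- 1 / \<alpha> j)) A)
           else 0)" for j A
  have h_empty: "h j {} = 0" for j
    by (simp add: h_def)
  have ret: "(\<Sum>i. emeasure (return borel x) (B i)) = emeasure (return borel x) (\<Union>i. B i)"
    if "range B \<subseteq> sets borel" "disjoint_family B" for x :: real and B :: "nat \<Rightarrow> real set"
    using that by (intro suminf_emeasure) auto
  have h: "(\<Sum>i. h j (B i)) = h j (\<Union>i. B i)"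
    if "range B \<subseteq> sets borel" "disjoint_family B" for j and B :: "nat \<Rightarrow> real set"
    by (simp add: h_def ennreal_suminf_cmult suminf_add[symmetric] ret[OF that])
  have swap: "(\<Sum>i. \<Sum>j. f i j) = (\<Sum>j. \<Sum>i. f i j)" for f :: "nat \<Rightarrow> nat \<Rightarrow> ennreal"
    using nn_integral_suminf[of "\<lambda>j i. f i j" "count_space UNIV"]
    by (simp add: nn_integral_count_space_nat)
  show ?thesis
    unfolding h_def[symmetric]
  proof (rule emeasure_measure_of[where \<Omega> = UNIV and A = "sets borel"])
    show "G_measure \<sigma> N \<alpha> = measure_of UNIV (sets borel)
       (\<lambda>A. ennreal (\<sigma>\<^sup>2) * emeasure (return borel 0) A + (\<Sum>j. h j A))"
      by (simp only: G_measure_def h_def)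
  next
    show "countably_additive (sets (G_measure \<sigma> N \<alpha>))
       (\<lambda>A. ennreal (\<sigma>\<^sup>2) * emeasure (return borel 0) A + (\<Sum>j. h j A))"
    proof (rule countably_additiveI)
      fix B :: "nat \<Rightarrow> real set"
      assume "range B \<subseteq> sets (G_measure \<sigma> N \<alpha>)" "disjoint_family B"
      then have B: "range B \<subseteq> sets borel" "disjoint_family B" by auto
      show "(\<Sum>i. ennreal (\<sigma>\<^sup>2) * emeasure (return borel 0) (B i) + (\<Sum>j. h j (B i))) =
        ennreal (\<sigma>\<^sup>2) * emeasure (return borel 0) (\<Union>i. B i) + (\<Sum>j. h j (\<Union>i. B i))"
        using swap[of "\<lambda>i j. h j (B i)"]
        by (simp add: suminf_add[symmetric] ennreal_suminf_cmult ret[OF B] h[OF B])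
    qed
  qed (use assms in \<open>auto simp: positive_def h_empty\<close>)
qed

end

theory Submission
  imports Defs "HOL-Computational_Algebra.Fundamental_Theorem_Algebra"
begin

text \<open>
  The polynomials have a moment equation that turns into the functional equation of the limit law.

  Write \<open>T = M\<^sub>n/(d(n+d))\<close> and \<open>P = g(T)\<^sup>m z\<^sup>d\<close>; the theorem is the case \<open>m = d\<close>. Since \<open>T\<close> lowers the degree
  by one, the commutator of \<open>z d/dz\<close> with a series in \<open>T\<close> is explicit, and \<open>z P' = d P + m C(T) P\<close> with
  \<open>C(z) = - z g'(z)/g(z)\<close>. The coefficients of \<open>C\<close> are the power sums of the \<open>1/\<alpha>\<^sub>j\<^sup>2\<close>, with \<open>\<sigma>\<^sup>2\<close> added
  in degree one. Let \<open>M(y)\<close> be the moment series of the roots of \<open>P\<close>,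
  without constant term, where \<open>y = 1/z\<close>. Dividing by \<open>d P\<close> gives \<open>M = (m/d) C(T') 1\<close>, where \<open>T'\<close> is \<open>T\<close> conjugated by \<open>P\<close>.
  In the variable \<open>y\<close> the operator \<open>T'\<close> is \<open>y (1 + M - E/d)(1 + M d/(n+d) - E/(n+d))\<close> with \<open>E = y d/dy\<close>
  (\<open>moment_equation\<close>, \<open>root_moment_equation\<close>). It tends to multiplication by
  \<open>H(y) = y (1 + M)(1 + \<lambda> M)\<close>. The equation is triangular, so all moments converge, and for \<open>m/d \<rightarrow> \<tau>\<close> the
  limits satisfy \<open>M = \<tau> C(H)\<close> (\<open>moments_converge\<close>). For the limit law, \<open>H\<close> is exactly the function that
  the rectangular R-transform inverts, so the equation says that the R-transform is \<open>\<tau> C\<close>; and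
  \<open>C(z)\<close> is \<open>z\<close> times the integral in the statement (\<open>G_measure_integral\<close>).

  Three things turn this computation into a proof. First, moments describe the root measure only if
  all roots are real. The operator \<open>1 - c M\<^sub>n\<close> preserves the monic polynomials with roots in \<open>[0,\<infinity>)\<close>
  (\<open>nonneg_roots_laguerre_step\<close>), and so do coefficientwise limits (\<open>nonneg_roots_limit\<close>), hence also
  \<open>g(T)\<close>. Secondly, the limit has to be pinned down. The moment series converges near zero
  (\<open>moment_growth\<close>), and a symmetric measure is determined by its R-transform at small negative
  arguments (\<open>rect_R_determines_symmetric\<close>); together with tightness this gives weak convergence
  (\<open>power_sequence_limit\<close>). Thirdly, infinite divisibility: for \<open>m = p \<lfloor>d/k\<rfloor>\<close> the same limit theorem
  produces measures with R-transform \<open>(p/k) C\<close>, and the one for \<open>p = 1\<close> is a \<open>k\<close>-th convolution root.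
\<close>

section \<open>Power series in the Laguerre operator\<close>

abbreviation scaled_op :: "real \<Rightarrow> real \<Rightarrow> real poly \<Rightarrow> real poly" where
  "scaled_op c n \<equiv> (\<lambda>p. smult c (laguerre_op n p))"

lemma coeff_laguerre_op:
  "coeff (laguerre_op n p) k = real (k + 1) * (real (k + 1) + n) * coeff p (Suc k)"
proof (cases k)
  case 0
  then show ?thesis
    by (simp add: laguerre_op_def coeff_pderiv algebra_simps)
next
  case (Suc j)
  then show ?thesis
    by (simp add: laguerre_op_def coeff_pderiv algebra_simps)
qed

lemma scaled_op_add: "scaled_op c n (p + q) = scaled_op c n p + scaled_op c n q"
  by (rule poly_eqI) (simp add: coeff_laguerre_op algebra_simps)

lemma scaled_op_smult: "scaled_op c n (smult a p) = smult a (scaled_op c n p)"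
  by (rule poly_eqI) (simp add: coeff_laguerre_op algebra_simps)

lemma funpow_scaled_op_add:
  "(scaled_op c n ^^ k) (p + q) = (scaled_op c n ^^ k) p + (scaled_op c n ^^ k) q"
proof (induction k)
  case (Suc k)
  show ?case by (simp only: funpow.simps o_apply Suc.IH scaled_op_add)
qed simp

lemma funpow_scaled_op_smult:
  "(scaled_op c n ^^ k) (smult a p) = smult a ((scaled_op c n ^^ k) p)"
proof (induction k)
  case (Suc k)
  show ?case by (simp only: funpow.simps o_apply Suc.IH scaled_op_smult)
qed simp

lemma funpow_scaled_op_0: "(scaled_op c n ^^ k) 0 = 0"
  using funpow_scaled_op_smult[of k c n 0 0] by simp

lemma funpow_scaled_op_sum:
  "(scaled_op c n ^^ k) (\<Sum>i\<in>I. f i) = (\<Sum>i\<in>I. (scaled_op c n ^^ k) (f i))"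
  by (induction I rule: infinite_finite_induct)
    (simp_all add: funpow_scaled_op_add funpow_scaled_op_0)

lemma smult_sum_right: "smult a (\<Sum>i\<in>I. f i) = (\<Sum>i\<in>I. smult a (f i))"
  by (rule poly_eqI) (simp add: coeff_sum sum_distrib_left)

lemma fps_op_eq_sum:
  assumes "degree p \<le> N"
  shows "fps_op F (scaled_op c n) p = (\<Sum>k\<le>N. smult (fps_nth F k) ((scaled_op c n ^^ k) p))"
  unfolding fps_op_def
  using assms by (intro sum.mono_neutral_left) (auto simp: laguerre_op_funpow_eq_0)

lemma degree_scaled_op: "degree (scaled_op c n p) \<le> degree p"
proof (rule degree_le)
  show "\<forall>i>degree p. coeff (scaled_op c n p) i = 0"
    by (auto simp: coeff_laguerre_op coeff_eq_0)
qed

lemma degree_funpow_scaled_op: "degree ((scaled_op c n ^^ k) p) \<le> degree p"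
proof (induction k)
  case (Suc k)
  then show ?case using degree_scaled_op[of c n "(scaled_op c n ^^ k) p"] by simp
qed simp

lemma degree_fps_op: "degree (fps_op F (scaled_op c n) p) \<le> degree p"
  unfolding fps_op_def
  by (intro degree_sum_le) (auto intro: order_trans[OF degree_smult_le] degree_funpow_scaled_op)

lemma coeff_funpow_scaled_op_top:
  "coeff ((scaled_op c n ^^ k) p) (degree p) = (if k = 0 then coeff p (degree p) else 0)"
proof (cases k)
  case (Suc j)
  have "coeff ((scaled_op c n ^^ j) p) (Suc (degree p)) = 0"
    using degree_funpow_scaled_op[of j c n p] by (intro coeff_eq_0) simp
  then show ?thesis by (simp add: Suc coeff_laguerre_op)
qed simp

lemma coeff_fps_op_top:
  "coeff (fps_op F (scaled_op c n) p) (degree p) = fps_nth F 0 * coeff p (degree p)"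
proof -
  have "coeff (fps_op F (scaled_op c n) p) (degree p) =
      (\<Sum>k\<le>degree p. fps_nth F k * (if k = 0 then coeff p (degree p) else 0))"
    unfolding fps_op_def by (simp add: coeff_sum coeff_funpow_scaled_op_top)
  also have "\<dots> = (\<Sum>k\<in>{0}. fps_nth F k * (if k = 0 then coeff p (degree p) else 0))"
    by (intro sum.mono_neutral_right) auto
  finally show ?thesis by simp
qed

text \<open>Substituting a locally nilpotent linear operator for the variable is a ring homomorphism. It
  turns iterates of \<open>g(T)\<close> into a single power series \<open>g\<^sup>m\<close> in \<open>T\<close> and lets a product of linear
  factors act one factor at a time.\<close>

lemma fps_op_mult:
  "fps_op (F * G) (scaled_op c n) p = fps_op F (scaled_op c n) (fps_op G (scaled_op c n) p)"
proof -
  let ?T = "scaled_op c n" and ?N = "degree p"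
  define h where "h i j = smult (fps_nth F i * fps_nth G j) ((?T ^^ (i + j)) p)" for i j
  have h0: "h i j = 0" if "i + j > ?N" for i j
    using that by (simp add: h_def laguerre_op_funpow_eq_0 del: funpow.simps)
  have "fps_op F ?T (fps_op G ?T p) =
      (\<Sum>i\<le>?N. smult (fps_nth F i) ((?T ^^ i) (\<Sum>j\<le>?N. smult (fps_nth G j) ((?T ^^ j) p))))"
    by (subst fps_op_eq_sum[OF degree_fps_op]) (simp add: fps_op_def)
  also have "\<dots> = (\<Sum>i\<le>?N. \<Sum>j\<le>?N. h i j)"
    by (simp add: h_def funpow_scaled_op_sum funpow_scaled_op_smult smult_sum_right funpow_add)
  also have "\<dots> = (\<Sum>(i, j)\<in>{..?N} \<times> {..?N}. h i j)"
    by (rule sum.cartesian_product)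
  also have "\<dots> = (\<Sum>(i, j)\<in>{(i, j). i + j \<le> ?N}. h i j)"
    by (rule sum.mono_neutral_right) (auto intro!: h0)
  also have "\<dots> = (\<Sum>k\<le>?N. \<Sum>i\<le>k. h i (k - i))"
    by (rule sum.triangle_reindex_eq)
  also have "\<dots> = fps_op (F * G) ?T p"
    by (simp add: fps_op_def fps_mult_nth h_def atLeast0AtMost smult_sum)
  finally show ?thesis ..
qed

lemma fps_op_1: "fps_op 1 (scaled_op c n) p = p"
proof -
  have "fps_op 1 (scaled_op c n) p =
      (\<Sum>k\<in>{0}. smult (fps_nth 1 k) ((scaled_op c n ^^ k) p))"
    unfolding fps_op_def by (intro sum.mono_neutral_right) auto
  then show ?thesis by simp
qed

lemma fps_op_power: "(fps_op F (scaled_op c n) ^^ m) p = fps_op (F ^ m) (scaled_op c n) p"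
  by (induction m) (simp_all add: fps_op_1 fps_op_mult)

lemma fps_op_linear_factor:
  "fps_op (1 - fps_const a * fps_X) (scaled_op c n) p = p - scaled_op (a * c) n p"
proof -
  let ?f = "\<lambda>k. smult (fps_nth (1 - fps_const a * fps_X) k) ((scaled_op c n ^^ k) p)"
  have "fps_op (1 - fps_const a * fps_X) (scaled_op c n) p = (\<Sum>k\<le>Suc (degree p). ?f k)"
    by (rule fps_op_eq_sum) simp
  also have "\<dots> = (\<Sum>k\<in>{0,1}. ?f k)"
    by (intro sum.mono_neutral_right) auto
  finally show ?thesis by simp
qed

section \<open>Preservation of nonnegative roots\<close>

definition nonneg_roots :: "real poly \<Rightarrow> bool" where
  "nonneg_roots p \<longleftrightarrow> (\<exists>ys. (\<forall>y\<in>set ys. 0 \<le> y) \<and> p = (\<Prod>y\<leftarrow>ys. [:-y, 1:]))"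

abbreviation cpoly :: "real poly \<Rightarrow> complex poly" where
  "cpoly \<equiv> map_poly of_real"

lemma cpoly_mult: "cpoly (p * q) = cpoly p * cpoly q"
  by (rule poly_eqI) (simp add: coeff_map_poly coeff_mult)

lemma cpoly_add: "cpoly (p + q) = cpoly p + cpoly q"
  by (rule poly_eqI) (simp add: coeff_map_poly)

lemma cpoly_diff: "cpoly (p - q) = cpoly p - cpoly q"
  by (rule poly_eqI) (simp add: coeff_map_poly)

lemma cpoly_smult: "cpoly (smult c p) = smult (of_real c) (cpoly p)"
  by (rule poly_eqI) (simp add: coeff_map_poly)

lemma poly_cpoly_prod:
  "poly (cpoly (\<Prod>y\<leftarrow>ys. [:-y, 1:])) z = (\<Prod>y\<leftarrow>ys. z - of_real y)"
  by (induction ys) (simp_all add: cpoly_mult map_poly_pCons del: mult_pCons_left)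

lemma monic_prod_linear: "lead_coeff (\<Prod>y\<leftarrow>ys. [:-y, 1:] :: real poly) = 1"
  by (induction ys) (simp_all add: lead_coeff_mult del: mult_pCons_left)

lemma degree_prod_linear: "degree (\<Prod>y\<leftarrow>ys. [:-y, 1:] :: real poly) = length ys"
proof (induction ys)
  case (Cons y ys)
  have "(\<Prod>y\<leftarrow>ys. [:-y, 1:] :: real poly) \<noteq> 0"
    using monic_prod_linear[of ys] by (metis leading_coeff_0_iff zero_neq_one)
  then show ?case using Cons by (simp add: degree_mult_eq del: mult_pCons_left)
qed simp

lemma nonneg_roots_monic: "nonneg_roots p \<Longrightarrow> lead_coeff p = 1"
  by (auto simp: nonneg_roots_def monic_prod_linear)

text \<open>At points off the half-line of nonnegative reals this is a positive lower bound for the distance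
  to the half-line, and simpler to handle than the distance itself.\<close>

definition slit_dist :: "complex \<Rightarrow> real" where
  "slit_dist z = (if Im z \<noteq> 0 then \<bar>Im z\<bar> else \<bar>Re z\<bar>)"

abbreviation off_slit :: "complex \<Rightarrow> bool" where
  "off_slit z \<equiv> z \<notin> of_real ` {0..}"

lemma off_slit_iff: "off_slit z \<longleftrightarrow> Im z \<noteq> 0 \<or> Re z < 0"
proof -
  have "z \<in> of_real ` {0..} \<longleftrightarrow> Im z = 0 \<and> 0 \<le> Re z"
    by (auto simp: image_iff complex_eq_iff)
  then show ?thesis by auto
qed

lemma slit_dist_pos: "off_slit z \<Longrightarrow> 0 < slit_dist z"
  by (auto simp: off_slit_iff slit_dist_def)

lemma slit_dist_le:
  assumes "off_slit z" "0 \<le> y"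
  shows "slit_dist z \<le> norm (z - of_real y)"
proof (cases "Im z = 0")
  case True
  then have "\<bar>Re z\<bar> \<le> \<bar>Re (z - of_real y)\<bar>" using assms by (auto simp: off_slit_iff)
  then show ?thesis using True abs_Re_le_cmod[of "z - of_real y"] by (simp add: slit_dist_def)
next
  case False
  then show ?thesis using abs_Im_le_cmod[of "z - of_real y"] by (simp add: slit_dist_def)
qed

lemma norm_prod_ge_slit_dist:
  assumes "\<forall>y\<in>set ys. 0 \<le> y" "off_slit z"
  shows "slit_dist z ^ length ys \<le> norm (\<Prod>y\<leftarrow>ys. z - of_real y)"
  using assms(1)
proof (induction ys)
  case (Cons y ys)
  then show ?case
    using slit_dist_le[OF assms(2), of y] slit_dist_pos[OF assms(2)]
    by (auto simp: norm_mult intro!: mult_mono)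
qed simp

text \<open>Having no complex roots off the half-line is a condition on values, so it can be checked by
  estimates and survives limits. By the fundamental theorem of algebra it already forces a real
  polynomial to split.\<close>

lemma nonneg_rootsI:
  assumes "lead_coeff p = 1" "\<And>z. off_slit z \<Longrightarrow> poly (cpoly p) z \<noteq> 0"
  shows "nonneg_roots p"
  using assms
proof (induction "degree p" arbitrary: p)
  case 0
  then have "p = 1"
    by (metis degree_eq_zeroE lead_coeff_pCons(2) one_pCons)
  then show ?case unfolding nonneg_roots_def by (intro exI[of _ "[]"]) simp
next
  case (Suc d)
  have "degree (cpoly p) = Suc d" using Suc.hyps by (simp add: degree_map_poly)
  then have "\<not> constant (poly (cpoly p))" by (simp add: constant_degree)
  then obtain z where z: "poly (cpoly p) z = 0"
    using fundamental_theorem_of_algebra by blast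
  then obtain y where y: "z = of_real y" "0 \<le> y" using Suc.prems by auto
  have "of_real (poly p y) = poly (cpoly p) (of_real y)"
    by (simp add: poly_altdef coeff_map_poly degree_map_poly)
  then have "poly p y = 0" using z y by simp
  then obtain q where q: "p = [:-y, 1:] * q" by (metis dvdE poly_eq_0_iff_dvd)
  have "q \<noteq> 0" using Suc.hyps(2) by (intro notI) (simp add: q)
  then have dq: "degree p = Suc (degree q)" by (simp add: q degree_mult_eq del: mult_pCons_left)
  have lq: "lead_coeff q = 1" using Suc.prems(1) by (simp add: q lead_coeff_mult del: mult_pCons_left)
  have "nonneg_roots q"
  proof (rule Suc.hyps(1))
    show "d = degree q" using dq Suc.hyps(2) by simp
    show "poly (cpoly q) z \<noteq> 0" if "off_slit z" for z
      using Suc.prems(2)[OF that] by (auto simp: q cpoly_mult simp del: mult_pCons_left)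
  qed (fact lq)
  then obtain ys where "\<forall>y\<in>set ys. 0 \<le> y" "q = (\<Prod>y\<leftarrow>ys. [:-y, 1:])"
    by (auto simp: nonneg_roots_def)
  then show ?case unfolding nonneg_roots_def q
    using y by (intro exI[of _ "y # ys"]) simp
qed

text \<open>A monic polynomial of degree \<open>d\<close> with all roots on the half-line is off the half-line at
  least the \<open>d\<close>-th power of \<^const>\<open>slit_dist\<close> in modulus. This bound does not depend on the polynomial, so it
  passes to the limit and keeps the limit free of zeros off the half-line.\<close>

lemma nonneg_roots_limit:
  assumes "\<And>m. nonneg_roots (P m)" "\<And>m. degree (P m) = d" "lead_coeff p = 1" "degree p = d"
    and conv: "\<And>k. (\<lambda>m. coeff (P m) k) \<longlonglongrightarrow> coeff p k"
  shows "nonneg_roots p"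
proof (rule nonneg_rootsI)
  fix z assume z: "off_slit z"
  have "(\<lambda>m. poly (cpoly (P m)) z) \<longlonglongrightarrow> poly (cpoly p) z"
    unfolding poly_altdef using assms
    by (auto simp: degree_map_poly coeff_map_poly intro!: tendsto_sum tendsto_mult tendsto_of_real conv)
  then have "(\<lambda>m. norm (poly (cpoly (P m)) z)) \<longlonglongrightarrow> norm (poly (cpoly p) z)"
    by (rule tendsto_norm)
  moreover have "slit_dist z ^ d \<le> norm (poly (cpoly (P m)) z)" for m
  proof -
    obtain ys where ys: "\<forall>y\<in>set ys. 0 \<le> y" "P m = (\<Prod>y\<leftarrow>ys. [:-y, 1:])"
      using assms(1)[of m] by (auto simp: nonneg_roots_def)
    then have "length ys = d" using assms(2)[of m] by (simp add: degree_prod_linear)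
    then show ?thesis using norm_prod_ge_slit_dist[OF ys(1) z] by (simp add: ys poly_cpoly_prod)
  qed
  ultimately have "slit_dist z ^ d \<le> norm (poly (cpoly p) z)"
    by (intro tendsto_lowerbound[of _ "norm (poly (cpoly p) z)"]) auto
  moreover have "0 < slit_dist z ^ d" using slit_dist_pos[OF z] by (rule zero_less_power)
  ultimately show "poly (cpoly p) z \<noteq> 0" by auto
qed fact

text \<open>For \<open>a i\<close> in the lower half-plane the quotient \<open>e\<^sub>2/e\<^sub>1\<close> of elementary symmetric functions is in
  the closed lower half-plane; here \<open>2 e\<^sub>2\<close> is written as \<open>e\<^sub>1\<^sup>2\<close> minus the sum of squares, and the
  quotient is cleared of its denominator. With \<open>a i = x i - \<i> y i\<close> and sums \<open>X\<close>, \<open>Y\<close>, the claim reduces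
  to \<open>\<Sum> y\<^sub>i\<^sup>2 \<le> Y\<^sup>2\<close> and \<open>\<Sum> y\<^sub>i (X - x\<^sub>i)\<^sup>2 \<ge> 0\<close>, where \<open>y\<^sub>i \<le> Y\<close> bounds the last term of the square.\<close>

lemma Im_e2_cnj_e1_nonpos:
  fixes a :: "'i \<Rightarrow> complex"
  assumes "finite I" "\<And>i. i \<in> I \<Longrightarrow> Im (a i) < 0"
  shows "Im (((\<Sum>i\<in>I. a i)\<^sup>2 - (\<Sum>i\<in>I. (a i)\<^sup>2)) * cnj (\<Sum>i\<in>I. a i)) \<le> 0"
proof -
  define x where "x i = Re (a i)" for i
  define y where "y i = - Im (a i)" for i
  define X where "X = (\<Sum>i\<in>I. x i)"
  define Y where "Y = (\<Sum>i\<in>I. y i)"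
  have y0: "0 \<le> y i" if "i \<in> I" for i using assms(2)[OF that] by (simp add: y_def)
  have yY: "y i \<le> Y" if "i \<in> I" for i
    unfolding Y_def using that assms(1) by (intro member_le_sum) (auto intro: y0)
  have Y0: "0 \<le> Y" unfolding Y_def by (intro sum_nonneg y0)
  have re: "Re (\<Sum>i\<in>I. a i) = X" and im: "Im (\<Sum>i\<in>I. a i) = - Y"
    by (simp_all add: X_def Y_def x_def y_def sum_negf)
  have re2: "Re (\<Sum>i\<in>I. (a i)\<^sup>2) = (\<Sum>i\<in>I. (x i)\<^sup>2) - (\<Sum>i\<in>I. (y i)\<^sup>2)"
    by (simp add: x_def y_def sum_subtractf[symmetric] power2_eq_square)
  have im2: "Im (\<Sum>i\<in>I. (a i)\<^sup>2) = - 2 * (\<Sum>i\<in>I. x i * y i)"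
    by (simp add: x_def y_def sum_distrib_left sum_negf[symmetric] power2_eq_square algebra_simps)
  have sq: "(\<Sum>i\<in>I. (y i)\<^sup>2) \<le> Y\<^sup>2"
  proof -
    have "(\<Sum>i\<in>I. (y i)\<^sup>2) \<le> (\<Sum>i\<in>I. y i * Y)"
      unfolding power2_eq_square by (intro sum_mono mult_left_mono yY y0)
    then show ?thesis by (simp add: sum_distrib_right[symmetric] Y_def power2_eq_square)
  qed
  have "0 \<le> (\<Sum>i\<in>I. y i * (X - x i)\<^sup>2)" by (intro sum_nonneg mult_nonneg_nonneg y0) auto
  also have "\<dots> = (\<Sum>i\<in>I. y i * X\<^sup>2 - 2 * X * (x i * y i) + y i * (x i)\<^sup>2)"
    by (intro sum.cong) (auto simp: power2_eq_square algebra_simps)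
  also have "\<dots> = Y * X\<^sup>2 - 2 * X * (\<Sum>i\<in>I. x i * y i) + (\<Sum>i\<in>I. y i * (x i)\<^sup>2)"
    by (simp add: sum.distrib sum_subtractf sum_distrib_left[symmetric] sum_distrib_right[symmetric] Y_def)
  also have "(\<Sum>i\<in>I. y i * (x i)\<^sup>2) \<le> (\<Sum>i\<in>I. Y * (x i)\<^sup>2)"
    by (intro sum_mono mult_right_mono yY) auto
  finally have key: "0 \<le> Y * X\<^sup>2 - 2 * X * (\<Sum>i\<in>I. x i * y i) + Y * (\<Sum>i\<in>I. (x i)\<^sup>2)"
    by (simp add: sum_distrib_left)
  have expand: "Im ((A\<^sup>2 - B) * cnj A) =
      (2 * Re A * Im A - Im B) * Re A - ((Re A)\<^sup>2 - (Im A)\<^sup>2 - Re B) * Im A" for A B :: complex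
    by (simp add: power2_eq_square algebra_simps)
  have "Im (((\<Sum>i\<in>I. a i)\<^sup>2 - (\<Sum>i\<in>I. (a i)\<^sup>2)) * cnj (\<Sum>i\<in>I. a i)) =
     - (Y * X\<^sup>2 - 2 * X * (\<Sum>i\<in>I. x i * y i) + Y * (\<Sum>i\<in>I. (x i)\<^sup>2))
     - Y * (Y\<^sup>2 - (\<Sum>i\<in>I. (y i)\<^sup>2))"
    unfolding expand re im re2 im2 by (simp add: algebra_simps power2_eq_square)
  then show ?thesis using key mult_nonneg_nonneg[OF Y0, of "Y\<^sup>2 - (\<Sum>i\<in>I. (y i)\<^sup>2)"] sq by linarith
qed

lemma pderivs_prod_linear:
  assumes "\<And>y. y \<in> set ys \<Longrightarrow> z \<noteq> complex_of_real y"
  defines "p \<equiv> (\<Prod>y\<leftarrow>ys. [:-y, 1:])"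
  defines "u \<equiv> (\<lambda>i. 1 / (z - of_real (ys ! i)))"
  shows "poly (cpoly (pderiv p)) z = poly (cpoly p) z * (\<Sum>i<length ys. u i)"
    and "poly (cpoly (pderiv (pderiv p))) z =
      poly (cpoly p) z * ((\<Sum>i<length ys. u i)\<^sup>2 - (\<Sum>i<length ys. (u i)\<^sup>2))"
proof -
  have "poly (cpoly (pderiv p)) z = poly (cpoly p) z * (\<Sum>i<length ys. u i) \<and>
    poly (cpoly (pderiv (pderiv p))) z =
      poly (cpoly p) z * ((\<Sum>i<length ys. u i)\<^sup>2 - (\<Sum>i<length ys. (u i)\<^sup>2))"
    using assms(1) unfolding p_def u_def
  proof (induction ys)
    case (Cons y ys)
    define q where "q = (\<Prod>y\<leftarrow>ys. [:-y, 1:] :: real poly)"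
    define S where "S = (\<Sum>i<length ys. 1 / (z - of_real (ys ! i)))"
    define R where "R = (\<Sum>i<length ys. (1 / (z - of_real (ys ! i)))\<^sup>2)"
    have IH: "poly (cpoly (pderiv q)) z = poly (cpoly q) z * S"
      "poly (cpoly (pderiv (pderiv q))) z = poly (cpoly q) z * (S\<^sup>2 - R)"
      using Cons unfolding q_def S_def R_def by auto
    have d1: "pderiv ([:-y, 1:] * q) = q + [:-y, 1:] * pderiv q"
      by (simp add: pderiv_mult pderiv_pCons del: mult_pCons_left)
    have d2: "pderiv (pderiv ([:-y, 1:] * q)) = smult 2 (pderiv q) + [:-y, 1:] * pderiv (pderiv q)"
      unfolding d1 pderiv_add pderiv_mult
      by (simp add: pderiv_pCons del: mult_pCons_left) (simp add: numeral_poly)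
    have lin: "poly (cpoly [:-y, 1:]) z = z - of_real y" by (simp add: map_poly_pCons)
    have nz: "z - of_real y \<noteq> 0" using Cons.prems[of y] by simp
    let ?a = "1 / (z - of_real y)"
    have va: "(z - of_real y) * ?a = 1" using nz by simp
    have alg: "P + v * (P * S) = v * P * (a + S) \<and>
        of_real 2 * (P * S) + v * (P * (S\<^sup>2 - R)) = v * P * ((a + S)\<^sup>2 - (a\<^sup>2 + R))"
      if "v * a = 1" for v a P :: complex
      using that unfolding of_real_numeral by algebra
    have sums: "(\<Sum>i<length (y # ys). 1 / (z - of_real ((y # ys) ! i))) = ?a + S"
      "(\<Sum>i<length (y # ys). (1 / (z - of_real ((y # ys) ! i)))\<^sup>2) = ?a\<^sup>2 + R"
      unfolding S_def R_def length_Cons sum.lessThan_Suc_shift by simp_all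
    have pr: "(\<Prod>y\<leftarrow>y # ys. [:-y, 1:] :: real poly) = [:-y, 1:] * q"
      by (simp add: q_def)
    show ?case
      unfolding sums pr d2 unfolding d1 cpoly_mult cpoly_add cpoly_smult poly_add poly_mult poly_smult IH lin
      using alg[OF va] by simp
  qed simp
  then show "poly (cpoly (pderiv p)) z = poly (cpoly p) z * (\<Sum>i<length ys. u i)"
    and "poly (cpoly (pderiv (pderiv p))) z =
      poly (cpoly p) z * ((\<Sum>i<length ys. u i)\<^sup>2 - (\<Sum>i<length ys. (u i)\<^sup>2))" by auto
qed

lemma Im_inverse_pos_iff: "Im (1 / w) > 0 \<longleftrightarrow> Im w < 0"
proof (cases "w = 0")
  case False
  have "Im (1 / w) = - Im w / (norm w)\<^sup>2" by (simp add: Im_divide cmod_power2)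
  then show ?thesis using False by (simp add: divide_less_0_iff zero_less_divide_iff)
qed simp

text \<open>Dividing the forbidden equation by \<open>c S\<close> would write \<open>1/(c S)\<close>, which is in the upper half-plane, as a
  sum of two terms in the closed lower half-plane.\<close>

lemma Laguerre_symbol_nonzero:
  fixes a :: "nat \<Rightarrow> complex"
  assumes a: "\<And>i. i < d \<Longrightarrow> Im (a i) < 0" and w: "Im w > 0" and c: "c > 0" and s: "s > 0"
  defines "S \<equiv> (\<Sum>i<d. a i)"
  shows "1 \<noteq> of_real c * (S\<^sup>2 - (\<Sum>i<d. (a i)\<^sup>2) + of_real s * S / w)"
proof (cases "d = 0")
  case False
  define E where "E = S\<^sup>2 - (\<Sum>i<d. (a i)\<^sup>2)"
  have "Im S < 0"
    unfolding S_def using False a sum_strict_mono[of "{..<d}" "\<lambda>i. Im (a i)" "\<lambda>_. 0"] by auto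
  then have S0: "S \<noteq> 0" and iS: "Im (1 / S) > 0"
    by (auto simp: Im_inverse_pos_iff)
  have "Im (E * cnj S) \<le> 0"
    unfolding E_def S_def by (rule Im_e2_cnj_e1_nonpos) (auto intro: a)
  then have iE: "Im (E / S) \<le> 0"
    by (simp add: complex_div_cnj[of E S] divide_nonpos_nonneg Im_divide_of_real flip: of_real_power)
  have iw: "Im (1 / w) < 0"
    using Im_inverse_pos_iff[of "- w"] w by simp
  show ?thesis
  proof
    assume "1 = of_real c * (S\<^sup>2 - (\<Sum>i<d. (a i)\<^sup>2) + of_real s * S / w)"
    then have "1 = of_real c * (E + of_real s * S / w)" by (simp add: E_def)
    also have "\<dots> = S * (of_real c * (E / S + of_real s * (1 / w)))"
      using S0 by (simp add: algebra_simps)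
    finally have "1 / S = of_real c * (E / S + of_real s * (1 / w))"
      using S0 by (metis nonzero_mult_div_cancel_left)
    then have "Im (1 / S) = Im (of_real c * (E / S + of_real s * (1 / w)))" by simp
    also have "\<dots> = c * Im (E / S) + c * s * Im (1 / w)"
      by (simp only: Im_complex_of_real Re_complex_of_real times_complex.sel plus_complex.sel)
        (simp add: algebra_simps)
    finally have "Im (1 / S) = c * Im (E / S) + c * s * Im (1 / w)" .
    moreover have "c * Im (E / S) \<le> 0" using c iE by (simp add: mult_nonneg_nonpos)
    moreover have "c * s * Im (1 / w) \<le> 0" using c s iw by (intro mult_nonneg_nonpos) auto
    ultimately show False using iS by linarith
  qed
qed (simp add: S_def)

text \<open>Let \<open>z\<close> be off the half-line and \<open>w\<close> its square root with positive imaginary part. For a root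
  \<open>y \<ge> 0\<close> one has \<open>1/(z - y) = a/w\<close> with \<open>a = 1/(w - y/w)\<close>, and \<open>a\<close> is in the lower half-plane since
  \<open>y/w\<close> is in the closed one. In these variables \<open>(p - c M p)(z) = 0\<close> becomes the equation excluded by
  the preceding lemma. Passing from \<open>z\<close> to \<open>w\<close> is what makes the sign argument work: the ratio
  \<open>M p/p\<close> itself can be real off the real line.\<close>

lemma nonneg_roots_laguerre_step:
  assumes p: "nonneg_roots p" and c: "c \<ge> 0" and n: "n > -1"
  shows "nonneg_roots (p - scaled_op c n p) \<and> degree (p - scaled_op c n p) = degree p"
proof -
  define q where "q = p - scaled_op c n p"
  have q: "q = fps_op (1 - fps_const c * fps_X) (scaled_op 1 n) p"
    using fps_op_linear_factor[of c 1 n p] by (simp only: q_def mult_1_right)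
  have lc: "lead_coeff p = 1" using p by (rule nonneg_roots_monic)
  have "coeff q (degree p) = 1" unfolding q coeff_fps_op_top using lc by simp
  moreover have "degree q \<le> degree p" unfolding q by (rule degree_fps_op)
  ultimately have dq: "degree q = degree p"
    by (metis le_antisym le_degree zero_neq_one)
  have "nonneg_roots q"
  proof (cases "c = 0")
    case True
    then show ?thesis using p by (simp add: q_def)
  next
    case False
    then have c: "c > 0" using c by simp
    obtain ys where ys: "\<forall>y\<in>set ys. 0 \<le> y" "p = (\<Prod>y\<leftarrow>ys. [:-y, 1:])"
      using p by (auto simp: nonneg_roots_def)
    show ?thesis
    proof (rule nonneg_rootsI)
      show "lead_coeff q = 1" using \<open>coeff q (degree p) = 1\<close> dq by simp
      fix z assume z: "off_slit z"
      obtain w where w: "Im w > 0" "w\<^sup>2 = z"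
      proof -
        obtain r where r: "r\<^sup>2 = z" using power2_csqrt by blast
        have "Im r \<noteq> 0"
        proof
          assume "Im r = 0"
          then have "z = of_real ((Re r)\<^sup>2)" using r by (auto simp: complex_eq_iff power2_eq_square)
          then show False using z by (metis atLeast_iff image_eqI zero_le_power2)
        qed
        then show ?thesis
          using that[of r] that[of "- r"] r by (cases "Im r > 0") auto
      qed
      have w0: "w \<noteq> 0" using w by auto
      define d where "d = length ys"
      define a where "a i = 1 / (w - of_real (ys ! i) / w)" for i
      have ima: "Im (a i) < 0" if "i < d" for i
      proof -
        have y: "0 \<le> ys ! i" using ys that by (auto simp: d_def)
        have "Im (of_real (ys ! i) / w) \<le> 0"
          using y w by (auto simp: Im_divide divide_le_0_iff)
        then have "Im (w - of_real (ys ! i) / w) > 0" using w by simp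
        then have "Im (- (1 / (w - of_real (ys ! i) / w))) > 0"
          using Im_inverse_pos_iff[of "- (w - of_real (ys ! i) / w)"] by (simp add: minus_divide_right)
        then show ?thesis by (simp add: a_def)
      qed
      have zy: "z \<noteq> of_real y" if "y \<in> set ys" for y using z ys that by auto
      define u where "u i = 1 / (z - of_real (ys ! i))" for i
      have ua: "u i = a i / w" for i
      proof -
        have "w - of_real (ys ! i) / w = (z - of_real (ys ! i)) / w"
          using w0 w(2) by (simp add: diff_divide_distrib power2_eq_square flip: w(2))
        then show ?thesis unfolding u_def a_def using w0 by simp
      qed
      define S where "S = (\<Sum>i<d. a i)"
      define R where "R = (\<Sum>i<d. (a i)\<^sup>2)"
      have su: "(\<Sum>i<d. u i) = S / w" "(\<Sum>i<d. (u i)\<^sup>2) = R / w\<^sup>2"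
        by (simp_all add: ua S_def R_def sum_divide_distrib power_divide)
      have p1: "poly (cpoly (pderiv p)) z = poly (cpoly p) z * (S / w)"
        and p2: "poly (cpoly (pderiv (pderiv p))) z = poly (cpoly p) z * ((S / w)\<^sup>2 - R / w\<^sup>2)"
        using pderivs_prod_linear[of ys z] zy su unfolding ys(2) u_def d_def by auto
      have pz: "poly (cpoly p) z \<noteq> 0"
        unfolding ys(2) poly_cpoly_prod using zy by (auto simp: prod_list_zero_iff)
      have "poly (cpoly q) z = poly (cpoly p) z - of_real c *
          (z * poly (cpoly (pderiv (pderiv p))) z + of_real (n + 1) * poly (cpoly (pderiv p)) z)"
        unfolding q_def laguerre_op_def
        by (simp add: cpoly_diff cpoly_smult cpoly_add cpoly_mult map_poly_pCons del: mult_pCons_left)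
      also have "\<dots> = poly (cpoly p) z * (1 - of_real c * (S\<^sup>2 - R + of_real (n + 1) * S / w))"
      proof -
        have e: "z * ((S / w)\<^sup>2 - R / w\<^sup>2) = S\<^sup>2 - R"
          using w0 by (simp add: power_divide right_diff_distrib flip: w(2))
        have "poly (cpoly p) z - of_real c * (z * (poly (cpoly p) z * ((S / w)\<^sup>2 - R / w\<^sup>2))
              + of_real (n + 1) * (poly (cpoly p) z * (S / w))) =
            poly (cpoly p) z * (1 - of_real c * (z * ((S / w)\<^sup>2 - R / w\<^sup>2) + of_real (n + 1) * S / w))"
          by (simp add: algebra_simps)
        then show ?thesis unfolding p1 p2 e .
      qed
      finally have eq: "poly (cpoly q) z =
          poly (cpoly p) z * (1 - of_real c * (S\<^sup>2 - R + of_real (n + 1) * S / w))" .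
      have "1 \<noteq> of_real c * (S\<^sup>2 - R + of_real (n + 1) * S / w)"
        unfolding S_def R_def by (rule Laguerre_symbol_nonzero) (use ima w c n in auto)
      then show "poly (cpoly q) z \<noteq> 0" using eq pz by auto
    qed
  qed
  then show ?thesis using dq by (simp add: q_def)
qed

lemma nonneg_roots_fps_op_prod:
  assumes "finite I" "\<And>i. i \<in> I \<Longrightarrow> 0 \<le> a i" "nonneg_roots p" "c \<ge> 0" "n > -1"
  defines "q \<equiv> fps_op (\<Prod>i\<in>I. 1 - fps_const (a i) * fps_X) (scaled_op c n) p"
  shows "nonneg_roots q \<and> degree q = degree p"
  using assms(1,2) unfolding q_def
proof (induction I rule: finite_induct)
  case (insert i I)
  then show ?case
    using nonneg_roots_laguerre_step[OF _ _ assms(5), of _ "a i * c"] assms(4)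
    by (simp add: fps_op_mult fps_op_linear_factor)
qed (simp add: fps_op_1 assms(3))

lemma nonneg_roots_fps_op_limit:
  assumes F: "\<And>m. nonneg_roots (fps_op (Fm m) (scaled_op c n) p)"
    and conv: "\<And>k. (\<lambda>m. fps_nth (Fm m) k) \<longlonglongrightarrow> fps_nth F k" 
    and 0: "\<And>m. fps_nth (Fm m) 0 = 1" and p: "nonneg_roots p"
  shows "nonneg_roots (fps_op F (scaled_op c n) p)"
proof -
  have F0: "fps_nth F 0 = 1" using LIMSEQ_unique[OF conv[of 0]] 0 by simp
  have top: "coeff (fps_op G (scaled_op c n) p) (degree p) = 1" if "fps_nth G 0 = 1" for G
    using coeff_fps_op_top[of G c n p] nonneg_roots_monic[OF p] that by simp
  have deg: "degree (fps_op G (scaled_op c n) p) = degree p" if "fps_nth G 0 = 1" for G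
    using top[OF that] degree_fps_op[of G c n p] by (metis le_antisym le_degree zero_neq_one)
  show ?thesis
  proof (rule nonneg_roots_limit[OF F])
    show "degree (fps_op (Fm m) (scaled_op c n) p) = degree p" for m by (rule deg[OF 0])
    show "degree (fps_op F (scaled_op c n) p) = degree p" by (rule deg[OF F0])
    then show "lead_coeff (fps_op F (scaled_op c n) p) = 1" using top[OF F0] by simp
    show "(\<lambda>m. coeff (fps_op (Fm m) (scaled_op c n) p) k) \<longlonglongrightarrow> coeff (fps_op F (scaled_op c n) p) k" for k
      unfolding fps_op_def by (auto simp: coeff_sum intro!: tendsto_sum tendsto_mult conv)
  qed
qed

section \<open>Logarithmic derivatives of formal power series\<close>

text \<open>Normalized so that \<open>C\<close> is \<open>- z F'/F\<close>. Then \<open>1 - a z\<close> has the series \<open>\<Sum> a\<^sup>k z\<^sup>k\<close> with \<open>k \<ge> 1\<close>, and a product of such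
  factors has the generating function of the power sums of the \<open>a\<close>'s; the same relation thus serves
  for \<open>g\<close> and its cumulants and for a reversed polynomial and its root moments.\<close>

definition has_log_deriv :: "real fps \<Rightarrow> real fps \<Rightarrow> bool" where
  "has_log_deriv F C \<longleftrightarrow> fps_nth F 0 = 1 \<and> fps_X * fps_deriv F = - C * F"

lemma has_log_deriv_1: "has_log_deriv 1 0"
  by (simp add: has_log_deriv_def)

lemma has_log_deriv_mult:
  assumes "has_log_deriv F A" "has_log_deriv G B"
  shows "has_log_deriv (F * G) (A + B)"
proof -
  have "fps_X * fps_deriv (F * G) = (fps_X * fps_deriv F) * G + F * (fps_X * fps_deriv G)"
    by (simp add: ring_distribs mult_ac)
  also have "\<dots> = - (A + B) * (F * G)"
    using assms by (simp add: has_log_deriv_def algebra_simps)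
  finally show ?thesis using assms by (simp add: has_log_deriv_def)
qed

lemma has_log_deriv_power:
  "has_log_deriv F A \<Longrightarrow> has_log_deriv (F ^ m) (of_nat m * A)"
proof (induction m)
  case (Suc m)
  then show ?case using has_log_deriv_mult[of F A "F ^ m" "of_nat m * A"]
    by (simp add: algebra_simps)
qed (simp add: has_log_deriv_1)

lemma has_log_deriv_prod:
  assumes "finite I" "\<And>i. i \<in> I \<Longrightarrow> has_log_deriv (F i) (A i)"
  shows "has_log_deriv (\<Prod>i\<in>I. F i) (\<Sum>i\<in>I. A i)"
  using assms by (induction I rule: finite_induct) (auto intro: has_log_deriv_1 has_log_deriv_mult)

definition geom_fps :: "real \<Rightarrow> real fps" where
  "geom_fps a = Abs_fps (\<lambda>k. if k = 0 then 0 else a ^ k)"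

lemma has_log_deriv_linear: "has_log_deriv (1 - fps_const a * fps_X) (geom_fps a)"
proof -
  have "fps_X * fps_deriv (1 - fps_const a * fps_X) = - fps_const a * fps_X"
    by simp
  also have "\<dots> = - geom_fps a * (1 - fps_const a * fps_X)"
  proof (rule fps_ext)
    have shape: "- geom_fps a * (1 - fps_const a * fps_X) =
        fps_X * (fps_const a * geom_fps a) - geom_fps a"
      by (simp add: ring_distribs mult_ac)
    fix k
    show "fps_nth (- fps_const a * fps_X) k = fps_nth (- geom_fps a * (1 - fps_const a * fps_X)) k"
    proof (cases k)
      case (Suc j)
      then show ?thesis
        unfolding shape by (cases j) (simp_all add: geom_fps_def)
    qed (simp add: geom_fps_def)
  qed
  finally show ?thesis by (simp add: has_log_deriv_def)
qed

text \<open>The relation is a recursion for the coefficients of \<open>F\<close>, from which bounds and limits of \<open>C\<close>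
  carry over to \<open>F\<close>.\<close>

lemma has_log_deriv_coeff:
  assumes "has_log_deriv F C" "fps_nth C 0 = 0"
  shows "real k * fps_nth F k = - (\<Sum>j=1..k. fps_nth C j * fps_nth F (k - j))"
proof -
  have "real k * fps_nth F k = fps_nth (fps_X * fps_deriv F) k"
    by (cases k) auto
  also have "\<dots> = - (\<Sum>j=0..k. fps_nth C j * fps_nth F (k - j))"
    using assms(1) by (simp add: has_log_deriv_def fps_mult_nth)
  also have "(\<Sum>j=0..k. fps_nth C j * fps_nth F (k - j)) = (\<Sum>j=1..k. fps_nth C j * fps_nth F (k - j))"
    using assms(2) by (simp add: sum.atLeast_Suc_atMost)
  finally show ?thesis .
qed

lemma has_log_deriv_bound:
  assumes "has_log_deriv F C" "fps_nth C 0 = 0" "\<And>j. \<bar>fps_nth C j\<bar> \<le> s ^ j" 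
  shows "\<bar>fps_nth F k\<bar> \<le> s ^ k"
proof (induction k rule: less_induct)
  case (less k)
  show ?case
  proof (cases "k = 0")
    case True
    then show ?thesis using assms(1) by (simp add: has_log_deriv_def)
  next
    case False
    have "real k * \<bar>fps_nth F k\<bar> = \<bar>\<Sum>j=1..k. fps_nth C j * fps_nth F (k - j)\<bar>"
      using has_log_deriv_coeff[OF assms(1,2), of k] by (metis abs_minus abs_mult abs_of_nat)
    also have "\<dots> \<le> (\<Sum>j=1..k. \<bar>fps_nth C j * fps_nth F (k - j)\<bar>)" by (rule sum_abs)
    also have "\<dots> \<le> (\<Sum>j=1..k. s ^ j * s ^ (k - j))"
      unfolding abs_mult using False
      by (intro sum_mono mult_mono assms(3) less) (auto intro: order_trans[OF _ assms(3)])
    also have "\<dots> = (\<Sum>j=1..k. s ^ k)"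
      by (intro sum.cong) (auto simp flip: power_add)
    finally show ?thesis using False by simp
  qed
qed

lemma has_log_deriv_tendsto:
  assumes F: "\<And>m. has_log_deriv (Fm m) (Cm m)" "has_log_deriv F C"
    and C0: "\<And>m. fps_nth (Cm m) 0 = 0" "fps_nth C 0 = 0"
    and conv: "\<And>j. (\<lambda>m. fps_nth (Cm m) j) \<longlonglongrightarrow> fps_nth C j"
  shows "(\<lambda>m. fps_nth (Fm m) k) \<longlonglongrightarrow> fps_nth F k"
proof (induction k rule: less_induct)
  case (less k)
  show ?case
  proof (cases "k = 0")
    case True
    then show ?thesis using F by (simp add: has_log_deriv_def)
  next
    case False
    have "(\<lambda>m. - (\<Sum>j=1..k. fps_nth (Cm m) j * fps_nth (Fm m) (k - j)) / real k)
        \<longlonglongrightarrow> - (\<Sum>j=1..k. fps_nth C j * fps_nth F (k - j)) / real k"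
      using False by (intro tendsto_intros conv less) auto
    moreover have e: "fps_nth G k = - (\<Sum>j=1..k. fps_nth D j * fps_nth G (k - j)) / real k"
      if "has_log_deriv G D" "fps_nth D 0 = 0" for G D
      using has_log_deriv_coeff[OF that, of k] False by (simp add: field_simps)
    ultimately show ?thesis unfolding e[OF F(1) C0(1)] e[OF F(2) C0(2)] by blast
  qed
qed

lemma has_log_deriv_exists:
  assumes "fps_nth C 0 = 0"
  obtains F where "has_log_deriv F C"
proof -
  define A where "A = fps_integral0 (fps_shift 1 C)"
  define F where "F = fps_exp 1 oo (- A)"
  have "fps_X * fps_deriv F = - C * F"
  proof -
    have "fps_deriv F = F * (- fps_shift 1 C)"
      unfolding F_def by (subst fps_compose_deriv) (auto simp: A_def fps_deriv_fps_integral)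
    moreover have "fps_X * fps_shift 1 C = C"
      by (rule fps_ext) (use assms in \<open>auto simp: gr0_conv_Suc\<close>)
    ultimately show ?thesis by (simp add: algebra_simps) 
  qed
  moreover have "fps_nth F 0 = 1" by (simp add: F_def)
  ultimately show ?thesis using that by (simp add: has_log_deriv_def)
qed

section \<open>The Taylor series of g\<close>

definition inv_sq :: "enat \<Rightarrow> (nat \<Rightarrow> real) \<Rightarrow> nat \<Rightarrow> real" where
  "inv_sq N \<alpha> j = (if j \<in> index_set N then 1 / (\<alpha> j)\<^sup>2 else 0)"

text \<open>The Taylor coefficients of \<open>- z g'(z)/g(z)\<close>: the power sums of the \<open>1/\<alpha>\<^sub>j\<^sup>2\<close>, with \<open>\<sigma>\<^sup>2\<close> added in degree
  one.\<close>

definition LP_cumulant_fps :: "real \<Rightarrow> enat \<Rightarrow> (nat \<Rightarrow> real) \<Rightarrow> real fps" where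
  "LP_cumulant_fps \<sigma> N \<alpha> = Abs_fps (\<lambda>k. if k = 0 then 0 else
     (if k = 1 then \<sigma>\<^sup>2 else 0) + (\<Sum>j. inv_sq N \<alpha> j ^ k))"

text \<open>Only linear factors occur, as \<open>(1 - \<sigma>\<^sup>2 z/m)\<^sup>m\<close> replaces the exponential, so each approximant
  applied to the Laguerre operator preserves nonnegative roots.\<close>

definition LP_approx :: "real \<Rightarrow> enat \<Rightarrow> (nat \<Rightarrow> real) \<Rightarrow> nat \<Rightarrow> real poly" where
  "LP_approx \<sigma> N \<alpha> m = [:1, - (\<sigma>\<^sup>2 / real m):] ^ m * (\<Prod>j\<le>m. [:1, - inv_sq N \<alpha> j:])"

lemma inv_sq_nonneg: "inv_sq N \<alpha> j \<ge> 0"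
  by (simp add: inv_sq_def)

lemma summable_inv_sq:
  assumes "(\<lambda>j. 1 / (\<alpha> j)\<^sup>2) summable_on index_set N"
  shows "summable (inv_sq N \<alpha>)"
proof -
  have "inv_sq N \<alpha> summable_on UNIV"
    using assms by (rule summable_on_cong_neutral[THEN iffD1, rotated 3]) (auto simp: inv_sq_def)
  then show ?thesis by (rule summable_on_UNIV_nonneg_real_iff[THEN iffD1, rotated]) (rule inv_sq_nonneg)
qed

lemma power_sum_le_sum_power:
  fixes a :: "'i \<Rightarrow> real"
  assumes "finite I" "\<And>i. i \<in> I \<Longrightarrow> 0 \<le> a i" "k \<ge> 1"
  shows "(\<Sum>i\<in>I. a i ^ k) \<le> (\<Sum>i\<in>I. a i) ^ k"
  using assms(3)
proof (induction k rule: dec_induct)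
  case (step k)
  have "(\<Sum>i\<in>I. a i ^ Suc k) \<le> (\<Sum>i\<in>I. (\<Sum>i\<in>I. a i) * a i ^ k)"
    using assms by (auto intro!: sum_mono mult_right_mono member_le_sum)
  also have "\<dots> \<le> (\<Sum>i\<in>I. a i) * (\<Sum>i\<in>I. a i) ^ k"
    unfolding sum_distrib_left[symmetric] using assms step by (intro mult_left_mono sum_nonneg) auto
  finally show ?case by simp
qed simp


lemma LP_cumulant_bounds:
  fixes \<sigma> :: real
  assumes "summable (inv_sq N \<alpha>)"
  defines "s \<equiv> \<sigma>\<^sup>2 + suminf (inv_sq N \<alpha>)"
  shows "0 \<le> fps_nth (LP_cumulant_fps \<sigma> N \<alpha>) k" "fps_nth (LP_cumulant_fps \<sigma> N \<alpha>) k \<le> s ^ k"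
    "k \<ge> 1 \<Longrightarrow> summable (\<lambda>j. inv_sq N \<alpha> j ^ k)" 
proof -
  define S where "S = suminf (inv_sq N \<alpha>)"
  have S: "0 \<le> S" unfolding S_def by (intro suminf_nonneg assms inv_sq_nonneg)
  have part: "(\<Sum>j<m. inv_sq N \<alpha> j ^ k) \<le> S ^ k" if "k \<ge> 1" for m
  proof -
    have "(\<Sum>j<m. inv_sq N \<alpha> j ^ k) \<le> (\<Sum>j<m. inv_sq N \<alpha> j) ^ k"
      using that by (intro power_sum_le_sum_power) (auto simp: inv_sq_nonneg)
    also have "\<dots> \<le> S ^ k"
      unfolding S_def by (intro power_mono sum_le_suminf assms sum_nonneg) (auto simp: inv_sq_nonneg)
    finally show ?thesis .
  qed
  show summ: "summable (\<lambda>j. inv_sq N \<alpha> j ^ k)" if "k \<ge> 1"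
    by (rule summableI_nonneg_bounded[OF _ part[OF that]]) (simp add: inv_sq_nonneg)
  show "0 \<le> fps_nth (LP_cumulant_fps \<sigma> N \<alpha>) k"
    using summ by (auto simp: LP_cumulant_fps_def inv_sq_nonneg intro!: suminf_nonneg add_nonneg_nonneg)
  show "fps_nth (LP_cumulant_fps \<sigma> N \<alpha>) k \<le> s ^ k"
  proof (cases "k \<le> 1")
    case True
    then show ?thesis by (cases k) (auto simp: LP_cumulant_fps_def s_def)
  next
    case False
    have "(\<Sum>j. inv_sq N \<alpha> j ^ k) \<le> S ^ k"
      using False by (intro suminf_le_const summ part) auto
    also have "\<dots> \<le> s ^ k" using S by (intro power_mono) (auto simp: s_def S_def)
    finally show ?thesis using False by (simp add: LP_cumulant_fps_def)
  qed
qed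

lemma fps_of_poly_linear: "fps_of_poly [:1, - (a :: real):] = 1 - fps_const a * fps_X"
  by (rule fps_ext) (auto simp: coeff_pCons split: nat.split)

lemma fps_of_poly_LP_approx:
  "fps_of_poly (LP_approx \<sigma> N \<alpha> m) =
    (1 - fps_const (\<sigma>\<^sup>2 / real m) * fps_X) ^ m * (\<Prod>j\<le>m. 1 - fps_const (inv_sq N \<alpha> j) * fps_X)"
  by (simp add: LP_approx_def fps_of_poly_mult fps_of_poly_power fps_of_poly_prod fps_of_poly_linear)

text \<open>The exponential is the limit of products of \<open>m\<close> factors with parameter \<open>\<sigma>\<^sup>2/m\<close>, whose power sums
  \<open>m (\<sigma>\<^sup>2/m)\<^sup>j\<close> vanish in the limit except for \<open>j = 1\<close>.\<close>

lemma LP_approx_log_deriv: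
  assumes "summable (inv_sq N \<alpha>)"
  obtains Cm where "\<And>m. has_log_deriv (fps_of_poly (LP_approx \<sigma> N \<alpha> m)) (Cm m)"
    "\<And>m. fps_nth (Cm m) 0 = 0" "\<And>j. (\<lambda>m. fps_nth (Cm m) j) \<longlonglongrightarrow> fps_nth (LP_cumulant_fps \<sigma> N \<alpha>) j"
    "\<And>m j. \<bar>fps_nth (Cm m) j\<bar> \<le> (\<sigma>\<^sup>2 + suminf (inv_sq N \<alpha>)) ^ j"
proof
  define Cm where "Cm m = of_nat m * geom_fps (\<sigma>\<^sup>2 / real m) + (\<Sum>j\<le>m. geom_fps (inv_sq N \<alpha> j))" for m
  have nth: "fps_nth (Cm m) j = (if j = 0 then 0 else
     real m * (\<sigma>\<^sup>2 / real m) ^ j + (\<Sum>i\<le>m. inv_sq N \<alpha> i ^ j))" for m j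
    by (simp add: Cm_def geom_fps_def fps_sum_nth flip: fps_of_nat)
  define s where "s = \<sigma>\<^sup>2 + suminf (inv_sq N \<alpha>)"
  show "has_log_deriv (fps_of_poly (LP_approx \<sigma> N \<alpha> m)) (Cm m)" for m
    unfolding fps_of_poly_LP_approx Cm_def
    by (intro has_log_deriv_mult has_log_deriv_power has_log_deriv_prod has_log_deriv_linear) auto
  show "fps_nth (Cm m) 0 = 0" for m by (simp add: nth)
  show "(\<lambda>m. fps_nth (Cm m) j) \<longlonglongrightarrow> fps_nth (LP_cumulant_fps \<sigma> N \<alpha>) j" for j
  proof (cases "j = 0")
    case False
    have a: "(\<lambda>m. \<Sum>i\<le>m. inv_sq N \<alpha> i ^ j) \<longlonglongrightarrow> (\<Sum>i. inv_sq N \<alpha> i ^ j)"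
      using False by (intro summable_LIMSEQ' LP_cumulant_bounds[OF assms]) auto
    have b: "(\<lambda>m. real m * (\<sigma>\<^sup>2 / real m) ^ j) \<longlonglongrightarrow> (if j = 1 then \<sigma>\<^sup>2 else 0)"
    proof (cases "j = 1")
      case True
      have "\<forall>\<^sub>F m in sequentially. real m * (\<sigma>\<^sup>2 / real m) ^ j = \<sigma>\<^sup>2"
        using eventually_gt_at_top[of 0] by eventually_elim (simp add: True)
      then show ?thesis using True by (simp add: tendsto_eventually)
    next
      case False
      then obtain i where i: "j = Suc (Suc i)" using \<open>j \<noteq> 0\<close> by (metis One_nat_def not0_implies_Suc)
      have "(\<lambda>m. \<sigma>\<^sup>2 * (\<sigma>\<^sup>2 / real m) ^ Suc i) \<longlonglongrightarrow> \<sigma>\<^sup>2 * 0 ^ Suc i"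
        by (intro tendsto_intros lim_const_over_n)
      moreover have "real m * (\<sigma>\<^sup>2 / real m) ^ j = \<sigma>\<^sup>2 * (\<sigma>\<^sup>2 / real m) ^ Suc i" for m
        by (cases "m = 0") (auto simp: i field_simps)
      ultimately show ?thesis using False by simp
    qed
    show ?thesis using tendsto_add[OF b a] False by (simp add: nth LP_cumulant_fps_def)
  qed (simp add: nth LP_cumulant_fps_def)
  show "\<bar>fps_nth (Cm m) j\<bar> \<le> s ^ j" for m j
  proof (cases "j = 0")
    case False
    have "real m * (\<sigma>\<^sup>2 / real m) ^ j + (\<Sum>i\<le>m. inv_sq N \<alpha> i ^ j) =
      (\<Sum>i\<in>{..<m} <+> {..m}. (case i of Inl _ \<Rightarrow> \<sigma>\<^sup>2 / real m | Inr i \<Rightarrow> inv_sq N \<alpha> i) ^ j)"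
      by (simp add: sum.Plus)
    also have "\<dots> \<le> (\<Sum>i\<in>{..<m} <+> {..m}. (case i of Inl _ \<Rightarrow> \<sigma>\<^sup>2 / real m | Inr i \<Rightarrow> inv_sq N \<alpha> i)) ^ j"
      using False by (intro power_sum_le_sum_power) (auto simp: inv_sq_nonneg split: sum.split)
    also have "\<dots> = (real m * (\<sigma>\<^sup>2 / real m) + (\<Sum>i\<le>m. inv_sq N \<alpha> i)) ^ j"
      by (simp add: sum.Plus)
    also have "\<dots> \<le> s ^ j"
      unfolding s_def by (intro power_mono add_mono sum_le_suminf assms add_nonneg_nonneg sum_nonneg)
        (auto simp: inv_sq_nonneg)
    finally show ?thesis using False by (simp add: nth inv_sq_nonneg sum_nonneg)
  qed (simp add: nth)
qed

lemma LP_approx_tendsto: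
  assumes "summable (inv_sq N \<alpha>)"
  shows "(\<lambda>m. poly (LP_approx \<sigma> N \<alpha> m) z) \<longlonglongrightarrow> LP_fun \<sigma> N \<alpha> z"
proof -
  have "(\<lambda>m. (1 + (- \<sigma>\<^sup>2 * z) / real m) ^ m) \<longlonglongrightarrow> exp (- \<sigma>\<^sup>2 * z)"
    by (rule tendsto_exp_limit_sequentially)
  moreover have "(\<lambda>m. \<Prod>j\<le>m. 1 - inv_sq N \<alpha> j * z) \<longlonglongrightarrow> (\<Prod>j. 1 - inv_sq N \<alpha> j * z)"
  proof (rule convergent_prod_LIMSEQ)
    have "summable (\<lambda>j. norm ((1 - inv_sq N \<alpha> j * z) - 1))"
      using assms by (simp add: abs_mult inv_sq_nonneg summable_mult2)
    then show "convergent_prod (\<lambda>j. 1 - inv_sq N \<alpha> j * z)"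
      by (intro abs_convergent_prod_imp_convergent_prod summable_imp_abs_convergent_prod)
  qed
  ultimately have "(\<lambda>m. (1 + (- \<sigma>\<^sup>2 * z) / real m) ^ m * (\<Prod>j\<le>m. 1 - inv_sq N \<alpha> j * z)) \<longlonglongrightarrow>
     exp (- \<sigma>\<^sup>2 * z) * (\<Prod>j. 1 - inv_sq N \<alpha> j * z)" by (rule tendsto_mult)
  moreover have "poly (LP_approx \<sigma> N \<alpha> m) z =
      (1 + (- \<sigma>\<^sup>2 * z) / real m) ^ m * (\<Prod>j\<le>m. 1 - inv_sq N \<alpha> j * z)" for m
    by (simp add: LP_approx_def poly_prod mult.commute)
  moreover have "LP_fun \<sigma> N \<alpha> z = exp (- \<sigma>\<^sup>2 * z) * (\<Prod>j. 1 - inv_sq N \<alpha> j * z)"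
    unfolding LP_fun_def by (intro arg_cong2[where f = "(*)"] prodinf_cong) (auto simp: inv_sq_def)
  ultimately show ?thesis by simp
qed

text \<open>The approximants converge pointwise to \<open>g\<close>, and their coefficients converge to those of the
  series \<open>F\<close> that is defined by the logarithmic derivative. The bound \<open>s\<^sup>k\<close> on the \<open>k\<close>-th coefficients
  is uniform in the approximant, so both limits may be compared near zero, and \<open>F\<close> is the Taylor
  series of \<open>g\<close>.\<close>

lemma LP_fun_taylor:
  assumes "summable (inv_sq N \<alpha>)"
  shows "has_log_deriv (taylor_fps (LP_fun \<sigma> N \<alpha>)) (LP_cumulant_fps \<sigma> N \<alpha>)"
    and "(\<lambda>m. fps_nth (fps_of_poly (LP_approx \<sigma> N \<alpha> m)) k) \<longlonglongrightarrow> fps_nth (taylor_fps (LP_fun \<sigma> N \<alpha>)) k"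
proof -
  let ?C = "LP_cumulant_fps \<sigma> N \<alpha>"
  define s where "s = \<sigma>\<^sup>2 + suminf (inv_sq N \<alpha>)"
  have s: "0 \<le> s" unfolding s_def by (intro add_nonneg_nonneg suminf_nonneg assms inv_sq_nonneg) simp
  have C0: "fps_nth ?C 0 = 0" by (simp add: LP_cumulant_fps_def)
  obtain F where F: "has_log_deriv F ?C" using has_log_deriv_exists[OF C0] .
  obtain Cm where Cm: "\<And>m. has_log_deriv (fps_of_poly (LP_approx \<sigma> N \<alpha> m)) (Cm m)"
    "\<And>m. fps_nth (Cm m) 0 = 0" "\<And>j. (\<lambda>m. fps_nth (Cm m) j) \<longlonglongrightarrow> fps_nth ?C j"
    "\<And>m j. \<bar>fps_nth (Cm m) j\<bar> \<le> s ^ j"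
    unfolding s_def using LP_approx_log_deriv[OF assms] by blast
  have conv: "(\<lambda>m. fps_nth (fps_of_poly (LP_approx \<sigma> N \<alpha> m)) k) \<longlonglongrightarrow> fps_nth F k" for k
    by (rule has_log_deriv_tendsto[OF Cm(1) F Cm(2) C0 Cm(3)])
  have bound: "\<bar>fps_nth (fps_of_poly (LP_approx \<sigma> N \<alpha> m)) k\<bar> \<le> s ^ k" for m k
    by (rule has_log_deriv_bound[OF Cm(1,2,4)])
  have "LP_fun \<sigma> N \<alpha> has_fps_expansion F"
  proof (rule has_fps_expansionI)
    have "(\<lambda>k. fps_nth F k * z ^ k) sums LP_fun \<sigma> N \<alpha> z" if "norm z < 1 / (s + 1)" for z
    proof -
      have sz: "s * \<bar>z\<bar> < 1"
      proof -
        have "s * \<bar>z\<bar> \<le> (s + 1) * \<bar>z\<bar>" by (intro mult_right_mono) auto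
        also have "\<dots> < 1" using that s by (simp add: field_simps)
        finally show ?thesis .
      qed
      let ?a = "\<lambda>k m. fps_nth (fps_of_poly (LP_approx \<sigma> N \<alpha> m)) k * z ^ k"
      have *: "eventually (\<lambda>n. summable (\<lambda>k. norm (?a k n))) sequentially \<and>
           summable (\<lambda>k. norm (fps_nth F k * z ^ k)) \<and>
           ((\<lambda>n. suminf (\<lambda>k. ?a k n)) \<longlongrightarrow> (\<Sum>k. fps_nth F k * z ^ k)) sequentially"
      proof (rule tannerys_theorem)
        show "(\<lambda>n. ?a k n) \<longlonglongrightarrow> fps_nth F k * z ^ k" for k
          by (intro tendsto_intros conv)
        show "eventually (\<lambda>(k, m). norm (?a k m) \<le> (s * \<bar>z\<bar>) ^ k) (at_top \<times>\<^sub>F sequentially)"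
          by (intro always_eventually) (use bound in \<open>auto simp: abs_mult power_mult_distrib power_abs intro!: mult_right_mono\<close>)
        show "summable (\<lambda>k. (s * \<bar>z\<bar>) ^ k)"
          using sz s by (intro summable_geometric) simp
      qed simp
      have "(\<Sum>k. ?a k n) = poly (LP_approx \<sigma> N \<alpha> n) z" for n
        using eval_fps_of_poly[of "LP_approx \<sigma> N \<alpha> n" z] unfolding eval_fps_def by simp
      then have "(\<lambda>n. poly (LP_approx \<sigma> N \<alpha> n) z) \<longlonglongrightarrow> (\<Sum>k. fps_nth F k * z ^ k)"
        using * by simp
      then have "(\<Sum>k. fps_nth F k * z ^ k) = LP_fun \<sigma> N \<alpha> z"
        using LP_approx_tendsto[OF assms] by (rule LIMSEQ_unique)
      then show ?thesis using * summable_norm_cancel summable_sums by metis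
    qed
    moreover have "eventually (\<lambda>z. norm z < 1 / (s + 1)) (nhds (0::real))"
      using s eventually_nhds_in_open[of "ball 0 (1 / (s + 1))" "0::real"] by simp
    ultimately show "eventually (\<lambda>z. (\<lambda>k. fps_nth F k * z ^ k) sums LP_fun \<sigma> N \<alpha> z) (nhds 0)"
      by (auto elim: eventually_mono)
  qed
  then have "taylor_fps (LP_fun \<sigma> N \<alpha>) = F" by (rule taylor_fps_eq)
  then show "has_log_deriv (taylor_fps (LP_fun \<sigma> N \<alpha>)) ?C"
    and "(\<lambda>m. fps_nth (fps_of_poly (LP_approx \<sigma> N \<alpha> m)) k) \<longlonglongrightarrow> fps_nth (taylor_fps (LP_fun \<sigma> N \<alpha>)) k"
    using F conv by simp_all
qed

section \<open>Moments of the roots\<close>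

definition euler :: "real fps \<Rightarrow> real fps" where
  "euler f = fps_X * fps_deriv f"

lemma euler_nth: "fps_nth (euler f) k = real k * fps_nth f k"
  by (cases k) (simp_all add: euler_def)

text \<open>Write a polynomial of degree \<open>d\<close> as \<open>z\<^sup>d Q(1/z)\<close>. With \<open>a = 1/d\<close> and \<open>b = 1/(n + d)\<close>, the operator
  \<open>M\<^sub>n/(d(n+d))\<close> acts on the series \<open>Q\<close> in \<open>y = 1/z\<close> as \<open>y (1 - a E)(1 - b E)\<close>, where \<open>E\<close> is the Euler
  operator.\<close>

definition twist :: "real \<Rightarrow> real \<Rightarrow> real fps \<Rightarrow> real fps" where
  "twist a b f = (let h = f - fps_const b * euler f in fps_X * (h - fps_const a * euler h))"

lemma twist_nth_Suc:
  "fps_nth (twist a b f) (Suc k) = (1 - real k * a) * (1 - real k * b) * fps_nth f k"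
  by (simp add: twist_def Let_def euler_nth algebra_simps)

lemma twist_nth_0: "fps_nth (twist a b f) 0 = 0"
  by (simp add: twist_def Let_def)

definition twist_weight :: "real \<Rightarrow> real \<Rightarrow> nat \<Rightarrow> real" where
  "twist_weight a b k = (\<Prod>i<k. (1 - real i * a) * (1 - real i * b))"

text \<open>The conjugate of the preceding operator by multiplication with a series \<open>Q\<close> such that
  \<open>E Q = - d M Q\<close>: each \<open>E\<close> becomes \<open>E - d M\<close>. If \<open>a\<close> and \<open>b\<close> tend to zero while \<open>d a \<rightarrow> 1\<close> and \<open>d b \<rightarrow> \<lambda>\<close>, it
  becomes multiplication by \<open>y (1 + M)(1 + \<lambda> M)\<close>.\<close>

definition conj_twist :: "real \<Rightarrow> real \<Rightarrow> real \<Rightarrow> real fps \<Rightarrow> real fps \<Rightarrow> real fps" where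
  "conj_twist d a b M f = (let h = (1 + fps_const (d * b) * M) * f - fps_const b * euler f in
      fps_X * ((1 + fps_const (d * a) * M) * h - fps_const a * euler h))"

lemma twist_conjugate:
  assumes "euler Q = - (fps_const d * M * Q)"
  shows "twist a b (Q * f) = Q * conj_twist d a b M f"
proof -
  have eul: "euler (Q * g) = Q * (euler g - fps_const d * M * g)" for g
  proof -
    have "euler (Q * g) = euler Q * g + Q * euler g"
      by (simp add: euler_def algebra_simps)
    then show ?thesis unfolding assms by (simp add: algebra_simps)
  qed
  have step: "Q * g - fps_const c * euler (Q * g) =
      Q * ((1 + fps_const (d * c) * M) * g - fps_const c * euler g)" for g c
    unfolding eul by (simp add: algebra_simps flip: fps_const_mult)
  show ?thesis
    unfolding twist_def conj_twist_def Let_def step by (simp add: mult_ac)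
qed

lemma funpow_twist_conjugate:
  assumes "euler Q = - (fps_const d * M * Q)"
  shows "(twist a b ^^ j) Q = Q * (conj_twist d a b M ^^ j) 1"
  by (induction j) (simp_all add: twist_conjugate[OF assms])

text \<open>The weights conjugate the twist operator to multiplication by the variable.\<close>

lemma funpow_twist_weight:
  "(twist a b ^^ j) (Abs_fps (\<lambda>k. twist_weight a b k * fps_nth G k)) =
     Abs_fps (\<lambda>k. twist_weight a b k * fps_nth (fps_X ^ j * G) k)"
proof (induction j)
  case (Suc j)
  show ?case
  proof (rule fps_ext)
    fix k
    show "fps_nth ((twist a b ^^ Suc j) (Abs_fps (\<lambda>k. twist_weight a b k * fps_nth G k))) k =
      fps_nth (Abs_fps (\<lambda>k. twist_weight a b k * fps_nth (fps_X ^ Suc j * G) k)) k"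
    proof (cases k)
      case (Suc i)
      have "fps_nth (fps_X ^ Suc j * G) (Suc i) = fps_nth (fps_X * (fps_X ^ j * G)) (Suc i)"
        by (simp only: power_Suc mult.assoc)
      then have "fps_nth (fps_X ^ Suc j * G) (Suc i) = fps_nth (fps_X ^ j * G) i" by simp
      then show ?thesis
        unfolding Suc funpow.simps o_apply \<open>(twist a b ^^ j) _ = _\<close> twist_nth_Suc
        by (simp add: twist_weight_def)
    next
      case 0
      then show ?thesis by (simp add: twist_nth_0)
    qed
  qed
qed simp

text \<open>The relation \<open>E G = - \<tau> C G\<close> becomes \<open>E Q = - \<tau> C(T) Q\<close> on the weighted series, where \<open>T\<close> is the
  twist operator. On the other hand \<open>E Q = - d M Q\<close>. Conjugating by \<open>Q\<close> and cancelling it gives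
  \<open>d M = \<tau> C(T') 1\<close> with the conjugated operator \<open>T'\<close>, which is the version for finite \<open>d\<close> of the
  functional equation of the limit law. The sum stops at \<open>k\<close> because \<open>T'\<close> raises the order of a
  series.\<close>

lemma moment_equation:
  fixes G C M :: "real fps" and a b d \<tau> :: real
  assumes G: "has_log_deriv G (fps_const \<tau> * C)" and C0: "fps_nth C 0 = 0"
  defines "Q \<equiv> Abs_fps (\<lambda>k. twist_weight a b k * fps_nth G k)"
  assumes M: "has_log_deriv Q (fps_const d * M)"
  shows "d * fps_nth M k = \<tau> * (\<Sum>j=1..k. fps_nth C j * fps_nth ((conj_twist d a b M ^^ j) 1) k)"
proof -
  define A where "A = (\<Sum>j=1..k. fps_const (fps_nth C j) * (conj_twist d a b M ^^ j) 1)"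
  have eQ: "euler Q = - (fps_const d * M * Q)" using M by (simp add: has_log_deriv_def euler_def)
  have Q0: "fps_nth Q 0 = 1" using M by (simp add: has_log_deriv_def)
  have main: "fps_nth (fps_const d * M * Q) i = fps_nth (fps_const \<tau> * A * Q) i" if "i \<le> k" for i
  proof -
    have nthX: "fps_nth (fps_X ^ j * G) i = (if j \<le> i then fps_nth G (i - j) else 0)" for j
      by (simp add: fps_X_power_mult_nth)
    have "fps_nth (fps_const d * M * Q) i = - fps_nth (euler Q) i" by (simp add: eQ mult.assoc)
    also have "\<dots> = - twist_weight a b i * (real i * fps_nth G i)"
      by (simp add: euler_nth Q_def)
    also have "real i * fps_nth G i = - (\<Sum>j=1..i. fps_nth (fps_const \<tau> * C) j * fps_nth G (i - j))"
      by (rule has_log_deriv_coeff[OF G]) (simp add: C0)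
    also have "- twist_weight a b i * \<dots> = \<tau> * (\<Sum>j=1..i. fps_nth C j * (twist_weight a b i * fps_nth G (i - j)))"
      by (simp add: sum_distrib_left sum_negf mult_ac)
    also have "(\<Sum>j=1..i. fps_nth C j * (twist_weight a b i * fps_nth G (i - j))) =
        (\<Sum>j=1..i. fps_nth C j * (twist_weight a b i * fps_nth (fps_X ^ j * G) i))"
      by (intro sum.cong) (auto simp: nthX)
    also have "\<dots> = (\<Sum>j=1..k. fps_nth C j * (twist_weight a b i * fps_nth (fps_X ^ j * G) i))"
      using that by (intro sum.mono_neutral_left) (auto simp: nthX)
    also have "\<dots> = (\<Sum>j=1..k. fps_nth C j * fps_nth ((twist a b ^^ j) Q) i)"
      unfolding Q_def funpow_twist_weight by simp
    also have "\<dots> = fps_nth (A * Q) i"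
      unfolding funpow_twist_conjugate[OF eQ] A_def sum_distrib_right
      by (simp add: fps_sum_nth mult.assoc mult.commute[of Q])
    finally show ?thesis by (simp add: mult.assoc)
  qed
  have cancel: "fps_nth X k = 0" if "\<And>i. i \<le> k \<Longrightarrow> fps_nth (X * Q) i = 0" for X k
    using that
  proof (induction k rule: less_induct)
    case (less k)
    have z: "fps_nth X i = 0" if "i < k" for i using less that by simp
    have "0 = (\<Sum>i=0..k. fps_nth X i * fps_nth Q (k - i))"
      using less.prems[of k] by (simp add: fps_mult_nth)
    also have "\<dots> = (\<Sum>i\<in>{k}. fps_nth X i * fps_nth Q (k - i))"
      by (intro sum.mono_neutral_right) (auto simp: z)
    finally show ?case by (simp add: Q0)
  qed
  have "fps_nth (fps_const d * M - fps_const \<tau> * A) k = 0"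
    by (rule cancel) (simp add: left_diff_distrib main)
  then show ?thesis by (simp add: A_def fps_sum_nth)
qed

text \<open>Convergence of the moments is proved by induction on their order, so it has to be tracked up to a
  given order. Limits are taken coefficientwise in the reals, not in the adic topology.\<close>

definition conv_upto :: "nat \<Rightarrow> (nat \<Rightarrow> real fps) \<Rightarrow> bool" where
  "conv_upto K A \<longleftrightarrow> (\<forall>k\<le>K. convergent (\<lambda>d. fps_nth (A d) k))"

lemma conv_upto_mult: "conv_upto K A \<Longrightarrow> conv_upto K B \<Longrightarrow> conv_upto K (\<lambda>d. A d * B d)"
  unfolding conv_upto_def fps_mult_nth by (auto intro!: convergent_sum convergent_mult)

lemma conv_upto_const: "convergent c \<Longrightarrow> conv_upto K (\<lambda>d. fps_const (c d))"
  unfolding conv_upto_def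
proof (intro allI impI)
  fix k
  assume "convergent c"
  then show "convergent (\<lambda>d. fps_nth (fps_const (c d)) k)"
    by (cases k) (simp_all add: convergent_const)
qed

lemma conv_upto_fixed: "conv_upto K (\<lambda>d. A)"
  unfolding conv_upto_def by (auto intro: convergent_const)

lemma conv_upto_add: "conv_upto K A \<Longrightarrow> conv_upto K B \<Longrightarrow> conv_upto K (\<lambda>d. A d + B d)"
  unfolding conv_upto_def by (auto intro!: convergent_add)

lemma conv_upto_diff: "conv_upto K A \<Longrightarrow> conv_upto K B \<Longrightarrow> conv_upto K (\<lambda>d. A d - B d)"
  unfolding conv_upto_def by (auto intro!: convergent_diff)

lemma conv_upto_euler: "conv_upto K A \<Longrightarrow> conv_upto K (\<lambda>d. euler (A d))"
  unfolding conv_upto_def euler_nth by (auto intro!: convergent_mult convergent_const)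

lemma conv_upto_X: "conv_upto K A \<Longrightarrow> conv_upto (Suc K) (\<lambda>d. fps_X * A d)"
  unfolding conv_upto_def
proof (intro allI impI)
  fix k
  assume "\<forall>k\<le>K. convergent (\<lambda>d. fps_nth (A d) k)" "k \<le> Suc K"
  then show "convergent (\<lambda>d. fps_nth (fps_X * A d) k)"
    by (cases k) (simp_all add: convergent_const)
qed

lemma conv_upto_mono: "conv_upto K A \<Longrightarrow> L \<le> K \<Longrightarrow> conv_upto L A"
  unfolding conv_upto_def by auto

lemma conv_upto_conj_twist:
  assumes "conv_upto K A" "conv_upto K M" "convergent a" "convergent b"
    "convergent (\<lambda>d. r d * a d)" "convergent (\<lambda>d. r d * b d)"
  shows "conv_upto (Suc K) (\<lambda>d. conj_twist (r d) (a d) (b d) (M d) (A d))"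
  unfolding conj_twist_def Let_def
  by (intro conv_upto_X conv_upto_diff conv_upto_mult conv_upto_add conv_upto_euler conv_upto_fixed
      conv_upto_const assms)

definition conv_to :: "(nat \<Rightarrow> real fps) \<Rightarrow> real fps \<Rightarrow> bool" where
  "conv_to A B \<longleftrightarrow> (\<forall>k. (\<lambda>d. fps_nth (A d) k) \<longlonglongrightarrow> fps_nth B k)"

lemma conv_to_conj_twist:
  assumes A: "conv_to A B" and M: "conv_to M L" and a: "a \<longlonglongrightarrow> 0" and b: "b \<longlonglongrightarrow> 0"
    and ra: "(\<lambda>d. r d * a d) \<longlonglongrightarrow> x" and rb: "(\<lambda>d. r d * b d) \<longlonglongrightarrow> y"
  shows "conv_to (\<lambda>d. conj_twist (r d) (a d) (b d) (M d) (A d))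
     (fps_X * (1 + fps_const x * L) * (1 + fps_const y * L) * B)"
proof -
  have mult: "conv_to (\<lambda>d. A d * B d) (A' * B')" if "conv_to A A'" "conv_to B B'" for A B A' B'
    using that unfolding conv_to_def fps_mult_nth by (auto intro!: tendsto_intros)
  have fixed: "conv_to (\<lambda>d. A) A" for A by (simp add: conv_to_def)
  have const: "conv_to (\<lambda>d. fps_const (c d)) (fps_const c')" if "c \<longlonglongrightarrow> c'" for c c'
    using that by (auto simp: conv_to_def)
  have add: "conv_to (\<lambda>d. A d + B d) (A' + B')" if "conv_to A A'" "conv_to B B'" for A B A' B'
    using that unfolding conv_to_def by (auto intro!: tendsto_intros)
  have diff: "conv_to (\<lambda>d. A d - B d) (A' - B')" if "conv_to A A'" "conv_to B B'" for A B A' B'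
    using that unfolding conv_to_def by (auto intro!: tendsto_intros)
  have eul: "conv_to (\<lambda>d. euler (A d)) (euler A')" if "conv_to A A'" for A A'
    using that unfolding conv_to_def euler_nth by (auto intro!: tendsto_intros)
  let ?h = "(1 + fps_const y * L) * B - fps_const 0 * euler B"
  have "conv_to (\<lambda>d. conj_twist (r d) (a d) (b d) (M d) (A d))
     (fps_X * ((1 + fps_const x * L) * ?h - fps_const 0 * euler ?h))"
    unfolding conj_twist_def Let_def
    by (intro mult add diff eul const fixed assms)
  then show ?thesis by (simp add: mult.assoc)
qed

text \<open>The right-hand side of the moment equation at order \<open>k\<close> involves only moments of order less than
  \<open>k\<close>, because the conjugated operator has a factor \<open>y\<close>. Hence the moments converge one after the
  other, and the limits satisfy the equation with the limit operator.\<close>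

lemma moments_converge:
  fixes M :: "nat \<Rightarrow> real fps" and r a b t :: "nat \<Rightarrow> real"
  assumes eq: "\<And>d k. fps_nth (M d) k =
      t d * (\<Sum>j=1..k. fps_nth C j * fps_nth ((conj_twist (r d) (a d) (b d) (M d) ^^ j) 1) k)"
    and a: "a \<longlonglongrightarrow> 0" and b: "b \<longlonglongrightarrow> 0" and t: "t \<longlonglongrightarrow> \<tau>"
    and ra: "(\<lambda>d. r d * a d) \<longlonglongrightarrow> 1" and rb: "(\<lambda>d. r d * b d) \<longlonglongrightarrow> lam"
  obtains L where "conv_to M L" "fps_nth L 0 = 0"
    "\<And>k. fps_nth L k = \<tau> * (\<Sum>j=1..k. fps_nth C j *
        fps_nth ((fps_X * (1 + L) * (1 + fps_const lam * L)) ^ j) k)"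
proof -
  let ?T = "\<lambda>d. conj_twist (r d) (a d) (b d) (M d)"
  have conv: "convergent a" "convergent b" "convergent t"
      "convergent (\<lambda>d. r d * a d)" "convergent (\<lambda>d. r d * b d)"
    using a b t ra rb by (auto simp: convergent_def)
  have upto: "conv_upto K M" for K
  proof (induction K)
    case 0
    show ?case using eq[of _ 0] by (simp add: conv_upto_def convergent_const)
  next
    case (Suc K)
    have T: "conv_upto (Suc K) (\<lambda>d. (?T d ^^ j) 1)" for j
    proof (induction j)
      case (Suc j)
      show ?case unfolding funpow.simps o_apply
        by (intro conv_upto_conj_twist conv_upto_mono[OF Suc] \<open>conv_upto K M\<close> conv) simp
    qed (simp add: conv_upto_fixed)
    show ?case unfolding conv_upto_def
    proof (intro allI impI)
      fix k assume k: "k \<le> Suc K"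
      have "convergent (\<lambda>d. fps_nth ((?T d ^^ j) 1) k)" for j
        using T[of j] k by (auto simp: conv_upto_def)
      then show "convergent (\<lambda>d. fps_nth (M d) k)"
        by (subst eq) (intro convergent_mult convergent_sum convergent_const conv)
    qed
  qed
  define L where "L = Abs_fps (\<lambda>k. lim (\<lambda>d. fps_nth (M d) k))"
  have convL: "conv_to M L"
    using upto by (auto simp: conv_to_def conv_upto_def L_def convergent_LIMSEQ_iff)
  let ?H = "fps_X * (1 + L) * (1 + fps_const lam * L)"
  have T: "conv_to (\<lambda>d. (?T d ^^ j) 1) (?H ^ j)" for j
  proof (induction j)
    case (Suc j)
    show ?case using conv_to_conj_twist[OF Suc convL a b ra rb] by simp
  qed (simp add: conv_to_def)
  have rec: "fps_nth L k = \<tau> * (\<Sum>j=1..k. fps_nth C j * fps_nth (?H ^ j) k)" for k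
  proof (rule LIMSEQ_unique)
    show "(\<lambda>d. fps_nth (M d) k) \<longlonglongrightarrow> fps_nth L k" using convL by (simp add: conv_to_def)
    have "(\<lambda>d. fps_nth ((?T d ^^ j) 1) k) \<longlonglongrightarrow> fps_nth (?H ^ j) k" for j
      using T[of j] by (simp add: conv_to_def)
    then show "(\<lambda>d. fps_nth (M d) k) \<longlonglongrightarrow> \<tau> * (\<Sum>j=1..k. fps_nth C j * fps_nth (?H ^ j) k)"
      by (subst eq) (intro tendsto_intros t)
  qed
  show ?thesis using that[OF convL _ rec] rec[of 0] by simp
qed

section \<open>The limiting moment series\<close>

definition trunc_eval :: "nat \<Rightarrow> real fps \<Rightarrow> real \<Rightarrow> real" where
  "trunc_eval K A x = (\<Sum>k\<le>K. fps_nth A k * x ^ k)"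

lemma trunc_eval_X: "trunc_eval (Suc K) (fps_X * A) x = x * trunc_eval K A x"
  unfolding trunc_eval_def sum.atMost_Suc_shift by (simp add: sum_distrib_left mult_ac)

lemma trunc_eval_mult_le:
  assumes "\<And>k. 0 \<le> fps_nth A k" "\<And>k. 0 \<le> fps_nth B k" "0 \<le> x"
  shows "trunc_eval K (A * B) x \<le> trunc_eval K A x * trunc_eval K B x"
proof -
  define f where "f i j = (fps_nth A i * x ^ i) * (fps_nth B j * x ^ j)" for i j
  have "trunc_eval K (A * B) x = (\<Sum>k\<le>K. \<Sum>i\<le>k. f i (k - i))"
    unfolding trunc_eval_def fps_mult_nth sum_distrib_right f_def atLeast0AtMost
    by (intro sum.cong refl) (simp add: power_add[symmetric] mult_ac)
  also have "\<dots> = (\<Sum>(i, j)\<in>{(i, j). i + j \<le> K}. f i j)"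
    by (rule sum.triangle_reindex_eq[symmetric])
  also have "\<dots> \<le> (\<Sum>(i, j)\<in>{..K} \<times> {..K}. f i j)"
    by (rule sum_mono2) (use assms in \<open>auto simp: f_def\<close>)
  also have "\<dots> = trunc_eval K A x * trunc_eval K B x"
    by (simp add: trunc_eval_def f_def sum_product sum.cartesian_product)
  finally show ?thesis .
qed

lemma trunc_eval_nonneg: "(\<And>k. 0 \<le> fps_nth A k) \<Longrightarrow> 0 \<le> x \<Longrightarrow> 0 \<le> trunc_eval K A x"
  unfolding trunc_eval_def by (intro sum_nonneg) auto

lemma fps_mult_nonneg:
  fixes A B :: "real fps"
  shows "(\<And>k. 0 \<le> fps_nth A k) \<Longrightarrow> (\<And>k. 0 \<le> fps_nth B k) \<Longrightarrow> 0 \<le> fps_nth (A * B) k"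
  unfolding fps_mult_nth by (intro sum_nonneg) auto

lemma fps_power_nonneg:
  fixes A :: "real fps"
  shows "(\<And>k. 0 \<le> fps_nth A k) \<Longrightarrow> 0 \<le> fps_nth (A ^ j) k"
proof (induction j arbitrary: k)
  case (Suc j)
  then show ?case by (simp add: fps_mult_nonneg)
qed simp

lemma trunc_eval_power_le:
  assumes "\<And>k. 0 \<le> fps_nth A k" "0 \<le> x"
  shows "trunc_eval K (A ^ j) x \<le> trunc_eval K A x ^ j"
proof (induction j)
  case 0
  show ?case by (simp add: trunc_eval_def)
    (simp add: sum.atMost_shift)
next
  case (Suc j)
  have "trunc_eval K (A * A ^ j) x \<le> trunc_eval K A x * trunc_eval K (A ^ j) x"
    by (intro trunc_eval_mult_le assms fps_power_nonneg)
  also have "\<dots> \<le> trunc_eval K A x * trunc_eval K A x ^ j"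
    by (intro mult_left_mono Suc trunc_eval_nonneg assms)
  finally show ?case by simp
qed

text \<open>All coefficients are nonnegative, so truncated sums are submultiplicative. At \<open>x = 1/(8 s)\<close> the
  functional equation bounds the sum truncated at \<open>K + 1\<close> by \<open>\<Sum> (4 s x)\<^sup>j = \<Sum> 2\<^sup>-\<^sup>j \<le> 1\<close> as soon as the
  one truncated at \<open>K\<close> is at most \<open>1\<close>. So the moment series converges near zero.\<close>

lemma moment_growth:
  fixes L C :: "real fps"
  assumes L: "\<And>k. 0 \<le> fps_nth L k" "fps_nth L 0 = 0"
    and rec: "\<And>k. fps_nth L k = (\<Sum>j=1..k. fps_nth C j *
        fps_nth ((fps_X * (1 + L) * (1 + fps_const lam * L)) ^ j) k)"
    and C: "\<And>j. 0 \<le> fps_nth C j" "\<And>j. fps_nth C j \<le> s ^ j"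
    and s: "0 < s" and lam: "0 \<le> lam" "lam \<le> 1"
  shows "fps_nth L k \<le> (8 * s) ^ k"
proof -
  let ?B = "(1 + L) * (1 + fps_const lam * L)"
  let ?H = "fps_X * (1 + L) * (1 + fps_const lam * L)"
  define x where "x = 1 / (8 * s)"
  have x: "0 < x" using s by (simp add: x_def)
  have nonneg: "0 \<le> fps_nth (1 + L) k" "0 \<le> fps_nth (1 + fps_const lam * L) k" for k
    using L lam by auto
  have nH: "0 \<le> fps_nth ?H k" for k
    by (intro fps_mult_nonneg nonneg) (auto simp: fps_X_def)
  have "trunc_eval K L x \<le> 1" for K
  proof (induction K)
    case 0
    show ?case by (simp add: trunc_eval_def L)
  next
    case (Suc K)
    have one: "trunc_eval K (1 + fps_const c * L) x = 1 + c * trunc_eval K L x" for c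
      by (simp add: trunc_eval_def sum.distrib ring_distribs sum_distrib_left mult.assoc)
        (simp add: sum.atMost_shift)
    have "trunc_eval (Suc K) ?H x = x * trunc_eval K ?B x"
      unfolding mult.assoc by (rule trunc_eval_X)
    also have "\<dots> \<le> x * ((1 + 1 * trunc_eval K L x) * (1 + lam * trunc_eval K L x))"
      unfolding one[symmetric] using x nonneg
      by (intro mult_left_mono order_trans[OF trunc_eval_mult_le]) auto
    also have "\<dots> \<le> x * ((1 + 1 * 1) * (1 + 1 * 1))"
      using x lam Suc trunc_eval_nonneg[OF L(1), of x K]
      by (intro mult_left_mono mult_mono add_mono) auto
    finally have H: "trunc_eval (Suc K) ?H x \<le> 4 * x" by simp
    have "trunc_eval (Suc K) L x = (\<Sum>k\<le>Suc K. \<Sum>j=1..k. fps_nth C j * fps_nth (?H ^ j) k * x ^ k)"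
      unfolding trunc_eval_def by (subst rec) (simp add: sum_distrib_right)
    also have "\<dots> \<le> (\<Sum>k\<le>Suc K. \<Sum>j=1..Suc K. fps_nth C j * fps_nth (?H ^ j) k * x ^ k)"
      using x by (intro sum_mono sum_mono2 mult_nonneg_nonneg C fps_power_nonneg nH) auto
    also have "\<dots> = (\<Sum>j=1..Suc K. fps_nth C j * trunc_eval (Suc K) (?H ^ j) x)"
      unfolding trunc_eval_def by (subst sum.swap)
        (simp add: sum_distrib_left mult.assoc del: sum.atMost_Suc sum.cl_ivl_Suc)
    also have "\<dots> \<le> (\<Sum>j=1..Suc K. s ^ j * (4 * x) ^ j)"
    proof (intro sum_mono mult_mono C)
      fix j
      have "trunc_eval (Suc K) (?H ^ j) x \<le> trunc_eval (Suc K) ?H x ^ j"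
        by (rule trunc_eval_power_le) (use nH x in auto)
      also have "\<dots> \<le> (4 * x) ^ j"
        by (intro power_mono H trunc_eval_nonneg nH) (use x in auto)
      finally show "trunc_eval (Suc K) (?H ^ j) x \<le> (4 * x) ^ j" .
      show "0 \<le> trunc_eval (Suc K) (?H ^ j) x"
        by (intro trunc_eval_nonneg fps_power_nonneg nH) (use x in auto)
    qed (use s in auto)
    also have "\<dots> = (\<Sum>j=1..Suc K. (1 / 2) ^ j)"
      using s by (intro sum.cong refl) (simp add: x_def flip: power_mult_distrib)
    also have "\<dots> \<le> 1"
    proof -
      have "(\<Sum>j=1..n. (1 / 2 :: real) ^ j) = 1 - (1 / 2) ^ n" for n
        by (induction n) auto
      then show ?thesis by simp
    qed
    finally show ?case .
  qed
  then have "fps_nth L k * x ^ k \<le> 1"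
  proof (rule order_trans[rotated])
    show "fps_nth L k * x ^ k \<le> trunc_eval k L x"
      unfolding trunc_eval_def using x L by (intro member_le_sum) auto
  qed
  then show ?thesis using s by (simp add: x_def power_divide field_simps)
qed

text \<open>Evaluating the formal identity \<open>L = C(y (1 + L)(1 + \<lambda> L))\<close> at a point interchanges two summations;
  the nonnegative coefficients of \<open>L\<close> dominate all partial sums, also at negative arguments.\<close>

lemma moment_functional_equation:
  fixes L C :: "real fps" and z :: real
  assumes L: "\<And>k. 0 \<le> fps_nth L k" "fps_nth L 0 = 0" "\<And>k. fps_nth L k \<le> r ^ k"
    and rec: "\<And>k. fps_nth L k = (\<Sum>j=1..k. fps_nth C j *
        fps_nth ((fps_X * (1 + L) * (1 + fps_const lam * L)) ^ j) k)"
    and C: "\<And>j. 0 \<le> fps_nth C j"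
    and lam: "0 \<le> lam" and z: "r * \<bar>z\<bar> < 1" and r: "0 < r"
  defines "f \<equiv> eval_fps L z"
  shows "(\<lambda>k. fps_nth L k * z ^ k) sums f"
    and "(\<lambda>j. fps_nth C (Suc j) * (z * (1 + f) * (1 + lam * f)) ^ Suc j) sums f"
proof -
  let ?H = "fps_X * (1 + L) * (1 + fps_const lam * L)"
  have nonneg: "0 \<le> fps_nth (1 + L) k" "0 \<le> fps_nth (1 + fps_const lam * L) k" for k
    using L lam by auto
  have nH: "0 \<le> fps_nth ?H k" for k
    by (intro fps_mult_nonneg nonneg) (auto simp: fps_X_def)
  have summ: "summable (\<lambda>k. fps_nth L k * \<bar>z\<bar> ^ k)"
  proof (rule summable_comparison_test')
    show "summable (\<lambda>k. (r * \<bar>z\<bar>) ^ k)" using z r by (intro summable_geometric) simp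
    show "norm (fps_nth L k * \<bar>z\<bar> ^ k) \<le> (r * \<bar>z\<bar>) ^ k" for k
      using L by (simp add: abs_mult power_mult_distrib mult_right_mono)
  qed
  have rad: "ereal \<bar>z\<bar> < fps_conv_radius L"
  proof -
    have "ereal (1 / r) \<le> fps_conv_radius L" unfolding fps_conv_radius_def
    proof (rule conv_radius_geI_ex')
      fix x assume x: "0 < x" "ereal x < ereal (1 / r)"
      show "summable (\<lambda>n. fps_nth L n * of_real x ^ n)"
      proof (rule summable_comparison_test')
        show "summable (\<lambda>k. (r * x) ^ k)" using x r by (intro summable_geometric) (simp add: field_simps)
        show "norm (fps_nth L k * of_real x ^ k) \<le> (r * x) ^ k" for k
          using L x by (simp add: abs_mult power_mult_distrib mult_right_mono)
      qed
    qed
    moreover have "\<bar>z\<bar> < 1 / r" using z r by (simp add: field_simps)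
    ultimately show ?thesis by (meson ereal_less(2) less_ereal.simps(1) less_le_trans)
  qed
  have norm_sum: "norm (fps_nth L k * z ^ k) = fps_nth L k * \<bar>z\<bar> ^ k" for k
    using L by (simp add: abs_mult power_abs)
  have sumsL: "(\<lambda>k. fps_nth L k * z ^ k) sums eval_fps L z"
    using rad by (intro sums_eval_fps) simp
  then show "(\<lambda>k. fps_nth L k * z ^ k) sums f" by (simp add: f_def)
  have rad1: "ereal (norm z) < fps_conv_radius (1 + L)"
    using less_le_trans[OF _ fps_conv_radius_add[of 1 L]] rad by simp
  have radl: "ereal (norm z) < fps_conv_radius (fps_const lam * L)"
    using less_le_trans[OF _ fps_conv_radius_mult[of "fps_const lam" L]] rad by simp
  have rad2: "ereal (norm z) < fps_conv_radius (1 + fps_const lam * L)"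
    using less_le_trans[OF _ fps_conv_radius_add[of 1 "fps_const lam * L"]] radl by simp
  have radX: "ereal (norm z) < fps_conv_radius (fps_X * (1 + L))"
    using less_le_trans[OF _ fps_conv_radius_mult[of fps_X "1 + L"]] rad1 by simp
  have radH: "ereal (norm z) < fps_conv_radius ?H"
    using less_le_trans[OF _ fps_conv_radius_mult[of "fps_X * (1 + L)" "1 + fps_const lam * L"]]
      radX rad2 by simp
  have "eval_fps ?H z = z * (1 + f) * (1 + lam * f)"
    using rad rad1 radl rad2 radX
    by (simp add: f_def eval_fps_mult eval_fps_add del: fps_const_mult_left)
  then have evH: "(\<lambda>k. fps_nth (?H ^ j) k * z ^ k) sums (z * (1 + f) * (1 + lam * f)) ^ j" for j
    using sums_eval_fps[of z "?H ^ j"] less_le_trans[OF radH fps_conv_radius_power] radH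
    by (simp add: eval_fps_power)
  define c where "c n k = (\<Sum>j=1..n. fps_nth C j * fps_nth (?H ^ j) k)" for n k
  have vanish: "fps_nth (?H ^ j) k = 0" if "k < j" for j k
    using that startsby_zero_power_prefix[of ?H j] by simp
  have cL: "c n k \<le> fps_nth L k" "0 \<le> c n k" for n k
  proof -
    show "0 \<le> c n k" unfolding c_def by (intro sum_nonneg mult_nonneg_nonneg C fps_power_nonneg nH)
    have "c n k \<le> (\<Sum>j=1..max n k. fps_nth C j * fps_nth (?H ^ j) k)"
      unfolding c_def by (intro sum_mono2 mult_nonneg_nonneg C fps_power_nonneg nH) auto
    also have "\<dots> = (\<Sum>j=1..k. fps_nth C j * fps_nth (?H ^ j) k)"
      by (intro sum.mono_neutral_right) (auto simp: vanish)
    finally show "c n k \<le> fps_nth L k" by (subst rec)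
  qed
  have ceq: "c n k = fps_nth L k" if "k \<le> n" for n k
    unfolding c_def by (subst rec) (intro sum.mono_neutral_right, use that in \<open>auto simp: vanish\<close>)
  have csum: "(\<lambda>k. c n k * z ^ k) sums (\<Sum>j=1..n. fps_nth C j * (z * (1 + f) * (1 + lam * f)) ^ j)" for n
    unfolding c_def sum_distrib_right mult.assoc[of "fps_nth C _"]
    by (intro sums_sum sums_mult evH)
  have "eventually (\<lambda>n. summable (\<lambda>k. norm (c n k * z ^ k))) sequentially \<and>
           summable (\<lambda>k. norm (fps_nth L k * z ^ k)) \<and>
           ((\<lambda>n. suminf (\<lambda>k. c n k * z ^ k)) \<longlongrightarrow> (\<Sum>k. fps_nth L k * z ^ k)) sequentially"
  proof (rule tannerys_theorem[where a = "\<lambda>k n. c n k * z ^ k"])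
    show "(\<lambda>n. c n k * z ^ k) \<longlonglongrightarrow> fps_nth L k * z ^ k" for k
      by (intro tendsto_eventually eventually_mono[OF eventually_ge_at_top[of k]]) (simp add: ceq)
    show "eventually (\<lambda>(k, n). norm (c n k * z ^ k) \<le> fps_nth L k * \<bar>z\<bar> ^ k) (at_top \<times>\<^sub>F sequentially)"
      by (intro always_eventually) (auto simp: abs_mult power_abs cL intro!: mult_right_mono)
  qed (use summ in auto)
  then have "(\<lambda>n. \<Sum>j=1..n. fps_nth C j * (z * (1 + f) * (1 + lam * f)) ^ j) \<longlonglongrightarrow> f"
    using sums_unique[OF csum] sums_unique[OF sumsL] by (simp add: f_def)
  moreover have shift: "(\<Sum>j=1..n. h j) = (\<Sum>j<n. h (Suc j))" for n and h :: "nat \<Rightarrow> real"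
    by (induction n) auto
  ultimately show "(\<lambda>j. fps_nth C (Suc j) * (z * (1 + f) * (1 + lam * f)) ^ Suc j) sums f"
    unfolding sums_def using shift[of "\<lambda>j. fps_nth C j * (z * (1 + f) * (1 + lam * f)) ^ j"]
    by (simp only:)
qed

section \<open>The root moments of the polynomials\<close>

lemma funpow_scaled_op_monom:
  assumes "k \<le> d" "d \<ge> 1" "n > -1"
  shows "(scaled_op (1 / (real d * (n + real d))) n ^^ k) (monom 1 d) =
     monom (twist_weight (1 / real d) (1 / (n + real d)) k) (d - k)"
  using assms(1)
proof (induction k)
  case 0
  then show ?case by (simp add: twist_weight_def)
next
  case (Suc k)
  let ?w = "twist_weight (1 / real d) (1 / (n + real d))"
  have nd: "n + real d > 0" "real d > 0" using assms by auto
  have "scaled_op (1 / (real d * (n + real d))) n (monom (?w k) (d - k)) =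
      monom (?w (Suc k)) (d - Suc k)"
  proof (rule poly_eqI)
    fix i
    have eq: "(real d - real k) * (real d - real k + n) / (real d * (n + real d)) =
       (1 - real k * (1 / real d)) * (1 - real k * (1 / (n + real d)))"
      using nd by (simp add: field_simps)
    show "coeff (scaled_op (1 / (real d * (n + real d))) n (monom (?w k) (d - k))) i =
        coeff (monom (?w (Suc k)) (d - Suc k)) i"
    proof (cases "i = d - Suc k")
      case True
      then have "real (i + 1) = real d - real k" and "d - k = Suc i" using Suc.prems by auto
      then have "coeff (scaled_op (1 / (real d * (n + real d))) n (monom (?w k) (d - k))) i =
          (real d - real k) * (real d - real k + n) / (real d * (n + real d)) * ?w k"
        by (simp add: coeff_laguerre_op)
      also have "\<dots> = ?w (Suc k)" unfolding eq by (simp add: twist_weight_def)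
      finally show ?thesis using True by simp
    next
      case False
      then have "d - k \<noteq> Suc i" by auto
      then show ?thesis using False by (simp add: coeff_laguerre_op)
    qed
  qed
  then show ?case using Suc by simp
qed

lemma coeff_fps_op_monom:
  assumes "k \<le> d" "d \<ge> 1" "n > -1"
  shows "coeff (fps_op G (scaled_op (1 / (real d * (n + real d))) n) (monom 1 d)) (d - k) =
    twist_weight (1 / real d) (1 / (n + real d)) k * fps_nth G k"
proof -
  let ?w = "twist_weight (1 / real d) (1 / (n + real d))"
  have "coeff (fps_op G (scaled_op (1 / (real d * (n + real d))) n) (monom 1 d)) (d - k) =
      (\<Sum>j\<le>d. fps_nth G j * coeff ((scaled_op (1 / (real d * (n + real d))) n ^^ j) (monom 1 d)) (d - k))"
    unfolding fps_op_def by (simp add: coeff_sum degree_monom_eq)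
  also have "\<dots> = (\<Sum>j\<le>d. if j = k then ?w k * fps_nth G k else 0)"
    using assms by (intro sum.cong refl) (auto simp: funpow_scaled_op_monom)
  finally show ?thesis using assms by simp
qed

lemma reflect_poly_prod_linear:
  "reflect_poly (\<Prod>y\<leftarrow>ys. [:-y, 1:]) = (\<Prod>y\<leftarrow>ys. [:1, - (y::real):])"
proof (induction ys)
  case (Cons y ys)
  have "reflect_poly [:-y, 1:] = [:1, -y:]" by (simp add: reflect_poly_def)
  then show ?case using Cons by (simp add: reflect_poly_mult del: mult_pCons_left)
qed simp

definition moment_fps :: "real list \<Rightarrow> real fps" where
  "moment_fps ys = Abs_fps (\<lambda>k. if k = 0 then 0 else (\<Sum>y\<leftarrow>ys. y ^ k) / real (length ys))"

lemma has_log_deriv_reflected: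
  "has_log_deriv (fps_of_poly (\<Prod>y\<leftarrow>ys. [:1, - y:])) (\<Sum>y\<leftarrow>ys. geom_fps y)"
  by (induction ys)
    (simp_all add: has_log_deriv_1 fps_of_poly_mult fps_of_poly_linear has_log_deriv_mult
      has_log_deriv_linear del: mult_pCons_left)

lemma sum_list_geom_fps: "(\<Sum>y\<leftarrow>ys. geom_fps y) = fps_const (real (length ys)) * moment_fps ys"
proof (rule fps_ext)
  fix k
  have "fps_nth (\<Sum>y\<leftarrow>ys. geom_fps y) k = (if k = 0 then 0 else (\<Sum>y\<leftarrow>ys. y ^ k))"
    by (induction ys) (auto simp: geom_fps_def)
  then show "fps_nth (\<Sum>y\<leftarrow>ys. geom_fps y) k = fps_nth (fps_const (real (length ys)) * moment_fps ys) k"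
    by (cases ys) (auto simp: moment_fps_def)
qed

text \<open>The reversal of \<open>\<Prod> (z - y)\<close> is \<open>\<Prod> (1 - y z)\<close>, whose logarithmic derivative is \<open>d\<close> times the moment
  series, while its coefficients are those of \<open>F\<^sup>m\<close> times the weights.\<close>

lemma root_moment_equation:
  fixes ys :: "real list" and F C :: "real fps"
  assumes F: "has_log_deriv F C" "fps_nth C 0 = 0" and d: "d \<ge> 1" and n: "n > -1"
    and L: "fps_op (F ^ m) (scaled_op (1 / (real d * (n + real d))) n) (monom 1 d) = (\<Prod>y\<leftarrow>ys. [:-y, 1:])"
  shows "length ys = d"
    "fps_nth (moment_fps ys) k = (real m / real d) * (\<Sum>j=1..k. fps_nth C j *
      fps_nth ((conj_twist (real d) (1 / real d) (1 / (n + real d)) (moment_fps ys) ^^ j) 1) k)"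
proof -
  let ?L = "fps_op (F ^ m) (scaled_op (1 / (real d * (n + real d))) n) (monom 1 d)"
  let ?w = "twist_weight (1 / real d) (1 / (n + real d))"
  have Fm: "has_log_deriv (F ^ m) (fps_const (real m) * C)"
    using has_log_deriv_power[OF F(1), of m] by (simp add: fps_of_nat)
  have "coeff ?L d = 1"
    using coeff_fps_op_monom[of 0 d n "F ^ m"] d n Fm by (simp add: twist_weight_def has_log_deriv_def)
  moreover have "degree ?L \<le> d"
    using degree_fps_op[of "F ^ m" _ n "monom 1 d"] by (simp add: degree_monom_eq)
  ultimately have deg: "degree ?L = d" by (metis le_antisym le_degree zero_neq_one)
  then show len: "length ys = d" using degree_prod_linear[of ys] by (simp add: L)
  have Q: "Abs_fps (\<lambda>k. ?w k * fps_nth (F ^ m) k) = fps_of_poly (\<Prod>y\<leftarrow>ys. [:1, - y:])"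
  proof (rule fps_ext)
    fix k
    have "fps_nth (fps_of_poly (\<Prod>y\<leftarrow>ys. [:1, - y:])) k = coeff (reflect_poly ?L) k"
      by (simp add: L reflect_poly_prod_linear)
    also have "\<dots> = (if k > d then 0 else coeff ?L (d - k))"
      by (simp only: coeff_reflect_poly deg)
    also have "\<dots> = ?w k * fps_nth (F ^ m) k"
    proof (cases "k > d")
      case True
      \<comment> \<open>For \<open>k > d\<close> the weight contains the factor \<open>1 - d/d\<close>.\<close>
      have "?w k = 0"
        unfolding twist_weight_def using True d by (intro prod_zero) (auto intro!: bexI[of _ d])
      then show ?thesis using True by simp
    next
      case False
      then show ?thesis using coeff_fps_op_monom[of k d n "F ^ m"] d n by simp
    qed
    finally show "fps_nth (Abs_fps (\<lambda>k. ?w k * fps_nth (F ^ m) k)) k =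
      fps_nth (fps_of_poly (\<Prod>y\<leftarrow>ys. [:1, - y:])) k" by simp
  qed
  have "real d * fps_nth (moment_fps ys) k = real m * (\<Sum>j=1..k. fps_nth C j *
      fps_nth ((conj_twist (real d) (1 / real d) (1 / (n + real d)) (moment_fps ys) ^^ j) 1) k)"
  proof (rule moment_equation[OF Fm F(2)])
    show "has_log_deriv (Abs_fps (\<lambda>k. ?w k * fps_nth (F ^ m) k)) (fps_const (real d) * moment_fps ys)"
      unfolding Q using has_log_deriv_reflected[of ys] by (simp add: sum_list_geom_fps len)
  qed
  then show "fps_nth (moment_fps ys) k = (real m / real d) * (\<Sum>j=1..k. fps_nth C j *
      fps_nth ((conj_twist (real d) (1 / real d) (1 / (n + real d)) (moment_fps ys) ^^ j) 1) k)"
    using d by (simp add: field_simps)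
qed

lemma nonneg_roots_monom: "nonneg_roots (monom 1 d)"
  unfolding nonneg_roots_def
  by (intro exI[of _ "replicate d 0"]) (auto simp: prod_list_replicate monom_altdef)

lemma nonneg_roots_LP_op:
  assumes "summable (inv_sq N \<alpha>)" "nonneg_roots p" "c \<ge> 0" "n > -1"
  shows "nonneg_roots (fps_op (taylor_fps (LP_fun \<sigma> N \<alpha>)) (scaled_op c n) p)"
proof (rule nonneg_roots_fps_op_limit[OF _ LP_fun_taylor(2)[OF assms(1)] _ assms(2)])
  show "fps_nth (fps_of_poly (LP_approx \<sigma> N \<alpha> m)) 0 = 1" for m
    by (simp add: LP_approx_def coeff_mult_0 coeff_0_power flip: poly_0_coeff_0) (simp add: poly_prod)
  show "nonneg_roots (fps_op (fps_of_poly (LP_approx \<sigma> N \<alpha> m)) (scaled_op c n) p)" for m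
  proof -
    have e: "(1 - fps_const (\<sigma>\<^sup>2 / real m) * fps_X) ^ m =
        (\<Prod>j<m. 1 - fps_const (\<sigma>\<^sup>2 / real m) * fps_X)" by simp
    show ?thesis
      unfolding fps_of_poly_LP_approx e fps_op_mult
      using assms by (intro nonneg_roots_fps_op_prod[THEN conjunct1]) (auto simp: inv_sq_nonneg)
  qed
qed

lemma nonneg_roots_LP_op_funpow:
  assumes "summable (inv_sq N \<alpha>)" "c \<ge> 0" "n > -1"
  shows "nonneg_roots ((fps_op (taylor_fps (LP_fun \<sigma> N \<alpha>)) (scaled_op c n) ^^ m) (monom 1 d))"
  by (induction m) (simp_all add: nonneg_roots_monom nonneg_roots_LP_op[OF assms(1) _ assms(2,3)])

section \<open>The symmetrized root measures\<close>

text \<open>The image of a uniform distribution on a finite set, so that integrals are finite sums.\<close>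

definition sym_root_measure :: "real list \<Rightarrow> real measure" where
  "sym_root_measure ys = distr (measure_pmf (pmf_of_set ({..<length ys} \<times> UNIV))) borel
     (\<lambda>(i, b). if b then sqrt (ys ! i) else - sqrt (ys ! i))"

lemma proots_prod_linear: "proots (\<Prod>y\<leftarrow>ys. [:-y, 1:] :: real poly) = mset ys"
proof (induction ys)
  case (Cons y ys)
  have "(\<Prod>y\<leftarrow>ys. [:-y, 1:] :: real poly) \<noteq> 0"
    using monic_prod_linear[of ys] by (metis leading_coeff_0_iff zero_neq_one)
  then show ?case using Cons by (simp add: proots_mult proots_linear_factor del: mult_pCons_left)
qed simp

lemma pmf_of_multiset_mset:
  assumes "ys \<noteq> []"
  shows "pmf_of_multiset (mset ys) = map_pmf (nth ys) (pmf_of_set {..<length ys})"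
proof -
  have "image_mset (nth ys) (mset_set {..<length ys}) = mset (map (nth ys) [0..<length ys])"
    by (simp add: lessThan_atLeast0 del: map_nth)
  then show ?thesis using assms by (subst map_pmf_of_set) (auto simp: map_nth)
qed

lemma sqrt_root_measure:
  assumes "ys \<noteq> []"
  shows "sqrt_measure (root_measure (\<Prod>y\<leftarrow>ys. [:-y, 1:])) = sym_root_measure ys"
proof (rule measure_eqI)
  let ?p = "\<Prod>y\<leftarrow>ys. [:-y, 1:] :: real poly" and ?d = "length ys"
  show "sets (sqrt_measure (root_measure ?p)) = sets (sym_root_measure ys)"
    by (simp add: sqrt_measure_def sym_root_measure_def)
  fix A assume "A \<in> sets (sqrt_measure (root_measure ?p))"
  then have A: "A \<in> sets borel" by (simp add: sqrt_measure_def)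
  have ne: "{..<?d} \<noteq> {}" using assms by auto
  have root: "root_measure ?p = distr (measure_pmf (pmf_of_set {..<?d})) borel (nth ys)"
    unfolding root_measure_def proots_prod_linear pmf_of_multiset_mset[OF assms]
    by (subst map_pmf_rep_eq) (simp add: distr_distr o_def)
  have e1: "emeasure (distr (root_measure ?p) borel sqrt) B =
      ennreal (real (card {i\<in>{..<?d}. sqrt (ys ! i) \<in> B}) / real ?d)" if "B \<in> sets borel" for B
    unfolding root using that ne
    by (simp add: distr_distr o_def emeasure_distr emeasure_pmf_of_set)
      (simp add: Int_def vimage_def)
  have e2: "emeasure (distr (distr (root_measure ?p) borel sqrt) borel uminus) B =
      ennreal (real (card {i\<in>{..<?d}. - sqrt (ys ! i) \<in> B}) / real ?d)" if "B \<in> sets borel" for B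
    unfolding root using that ne
    by (simp add: distr_distr o_def emeasure_distr emeasure_pmf_of_set)
      (simp add: Int_def vimage_def)
  let ?g = "\<lambda>(i, b). if b then sqrt (ys ! i) else - sqrt (ys ! i)"
  have "{x \<in> {..<?d} \<times> UNIV. ?g x \<in> A} =
     {i\<in>{..<?d}. sqrt (ys ! i) \<in> A} \<times> {True} \<union> {i\<in>{..<?d}. - sqrt (ys ! i) \<in> A} \<times> {False}"
    by (auto split: if_splits)
  then have card: "card {x \<in> {..<?d} \<times> UNIV. ?g x \<in> A} =
     card {i\<in>{..<?d}. sqrt (ys ! i) \<in> A} + card {i\<in>{..<?d}. - sqrt (ys ! i) \<in> A}"
    by (simp add: card_Un_disjoint card_cartesian_product) (subst card_Un_disjoint, auto simp: card_cartesian_product)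
  have "emeasure (sym_root_measure ys) A = ennreal (real (card {x \<in> {..<?d} \<times> UNIV. ?g x \<in> A}) / real (2 * ?d))"
    unfolding sym_root_measure_def using A ne
    by (simp add: emeasure_distr emeasure_pmf_of_set card_cartesian_product mult.commute)
      (simp add: Int_def vimage_def)
  also have "\<dots> = (ennreal (real (card {i\<in>{..<?d}. sqrt (ys ! i) \<in> A}) / real ?d) +
      ennreal (real (card {i\<in>{..<?d}. - sqrt (ys ! i) \<in> A}) / real ?d)) / 2"
    unfolding card by (simp add: ennreal_plus[symmetric] ennreal_divide_numeral add_divide_distrib mult.commute
        del: ennreal_plus)
  finally show "emeasure (sqrt_measure (root_measure ?p)) A = emeasure (sym_root_measure ys) A"
    unfolding sqrt_measure_def using A by (simp add: emeasure_symmetrization e1 e2)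
qed

lemma integral_sym_root_measure:
  fixes f :: "real \<Rightarrow> real"
  assumes "ys \<noteq> []" "f \<in> borel_measurable borel"
  shows "(\<integral>t. f t \<partial>sym_root_measure ys) =
    (\<Sum>y\<leftarrow>ys. (f (sqrt y) + f (- sqrt y)) / 2) / real (length ys)"
proof -
  have ne: "{..<length ys} \<times> (UNIV :: bool set) \<noteq> {}" using assms by auto
  have half: "(\<Sum>y\<leftarrow>zs. g y / 2) = (\<Sum>y\<leftarrow>zs. g y) / 2" for zs and g :: "real \<Rightarrow> real"
    by (induction zs) (auto simp: add_divide_distrib)
  have "(\<integral>t. f t \<partial>sym_root_measure ys) =
      (\<Sum>(i, b)\<in>{..<length ys} \<times> UNIV. f (if b then sqrt (ys ! i) else - sqrt (ys ! i))) / real (length ys * 2)"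
    unfolding sym_root_measure_def using assms
    by (subst integral_distr)
      (auto simp: integral_pmf_of_set[OF ne] card_cartesian_product case_prod_unfold)
  also have "(\<Sum>(i, b)\<in>{..<length ys} \<times> UNIV. f (if b then sqrt (ys ! i) else - sqrt (ys ! i))) =
     (\<Sum>i<length ys. f (sqrt (ys ! i)) + f (- sqrt (ys ! i)))"
    by (simp add: sum.cartesian_product[symmetric] UNIV_bool add.commute)
  also have "\<dots> = (\<Sum>y\<leftarrow>ys. f (sqrt y) + f (- sqrt y))"
    by (simp add: sum_list_sum_nth lessThan_atLeast0)
  also have "\<dots> / real (length ys * 2) = (\<Sum>y\<leftarrow>ys. (f (sqrt y) + f (- sqrt y)) / 2) / real (length ys)"
    by (simp add: half mult.commute)
  finally show ?thesis .
qed

lemma symmetric_sym_root_measure: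
  assumes "ys \<noteq> []"
  shows "symmetric_distribution (sym_root_measure ys)"
proof -
  let ?S = "{..<length ys} \<times> (UNIV :: bool set)"
  let ?P = "pmf_of_set ?S"
  let ?g = "\<lambda>(i, b). if b then sqrt (ys ! i) else - sqrt (ys ! i)"
  have "map_pmf (\<lambda>(i, b). (i, \<not> b)) ?P = ?P"
  proof (rule map_pmf_of_set_bij_betw)
    show "bij_betw (\<lambda>(i, b). (i, \<not> b)) ?S ?S"
      by (rule bij_betw_byWitness[where f' = "\<lambda>(i, b). (i, \<not> b)"]) auto
  qed (use assms in auto)
  then have "distr (measure_pmf ?P) borel (uminus \<circ> ?g) = distr (measure_pmf (map_pmf (\<lambda>(i, b). (i, \<not> b)) ?P)) borel (uminus \<circ> ?g)"
    by simp
  also have "\<dots> = distr (measure_pmf ?P) borel ((uminus \<circ> ?g) \<circ> (\<lambda>(i, b). (i, \<not> b)))"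
    by (simp add: map_pmf_rep_eq distr_distr)
  also have "(uminus \<circ> ?g) \<circ> (\<lambda>(i, b). (i, \<not> b)) = ?g" by (auto simp: fun_eq_iff)
  finally have inv: "distr (measure_pmf ?P) borel (uminus \<circ> ?g) = distr (measure_pmf ?P) borel ?g" .
  have "distr (distr (measure_pmf ?P) borel ?g) borel uminus = distr (measure_pmf ?P) borel (uminus \<circ> ?g)"
    by (rule distr_distr) simp_all
  then have "distr (sym_root_measure ys) borel uminus = sym_root_measure ys"
    unfolding sym_root_measure_def inv .
  moreover have "prob_space (sym_root_measure ys)"
    unfolding sym_root_measure_def by (intro measure_pmf.prob_space_distr) simp
  ultimately show ?thesis
    by (auto simp: symmetric_distribution_def real_distribution_def real_distribution_axioms_def sym_root_measure_def)
qed

lemma rect_M_sym_root_measure: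
  assumes "ys \<noteq> []" "\<And>y. y \<in> set ys \<Longrightarrow> 0 \<le> y"
  shows "rect_M (sym_root_measure ys) z = (\<Sum>y\<leftarrow>ys. z * y / (1 - y * z)) / real (length ys)"
proof -
  have "(\<Sum>y\<leftarrow>ys. (z * (sqrt y)\<^sup>2 / (1 - (sqrt y)\<^sup>2 * z) + z * (- sqrt y)\<^sup>2 / (1 - (- sqrt y)\<^sup>2 * z)) / 2) =
    (\<Sum>y\<leftarrow>ys. z * y / (1 - y * z))"
  proof (intro arg_cong[where f = sum_list] map_cong refl)
    fix y assume "y \<in> set ys"
    then have y: "(sqrt y)\<^sup>2 = y" using assms by simp
    have half: "(a + a) / 2 = a" for a :: real by simp
    show "(z * (sqrt y)\<^sup>2 / (1 - (sqrt y)\<^sup>2 * z) + z * (- sqrt y)\<^sup>2 / (1 - (- sqrt y)\<^sup>2 * z)) / 2 =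
        z * y / (1 - y * z)"
      by (simp only: power2_minus y half)
  qed
  moreover have "rect_M (sym_root_measure ys) z =
    (\<Sum>y\<leftarrow>ys. (z * (sqrt y)\<^sup>2 / (1 - (sqrt y)\<^sup>2 * z) + z * (- sqrt y)\<^sup>2 / (1 - (- sqrt y)\<^sup>2 * z)) / 2)
      / real (length ys)"
    unfolding rect_M_def by (rule integral_sym_root_measure[OF assms(1)]) simp
  ultimately show ?thesis by (simp only:)
qed

text \<open>The remainder of the geometric series for \<open>z y/(1 - y z)\<close> is \<open>(y z)\<^sup>K\<^sup>+\<^sup>1/(1 - y z)\<close>, and the denominator
  is at least \<open>1\<close> for \<open>z \<le> 0\<close>. The bound by one single moment makes convergence of the moments
  sufficient.\<close>

lemma rect_M_sym_root_measure_approx: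
  assumes "ys \<noteq> []" "\<And>y. y \<in> set ys \<Longrightarrow> 0 \<le> y" "z \<le> 0"
  shows "\<bar>rect_M (sym_root_measure ys) z - (\<Sum>k\<le>K. fps_nth (moment_fps ys) k * z ^ k)\<bar> \<le>
    fps_nth (moment_fps ys) (Suc K) * \<bar>z\<bar> ^ Suc K"
proof -
  have remainder: "z * y / (1 - y * z) - (\<Sum>k=1..K. y ^ k * z ^ k) = (y * z) ^ Suc K / (1 - y * z)"
    if "0 \<le> y" for y
  proof -
    have nz: "1 - y * z > 0" using mult_nonneg_nonpos[OF that assms(3)] by linarith
    have "(\<Sum>k=1..K. (y * z) ^ k) * (1 - y * z) = y * z - (y * z) ^ Suc K"
    proof (induction K)
      case (Suc K)
      then show ?case by (simp add: distrib_right) (simp add: algebra_simps)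
    qed simp
    then have "(\<Sum>k=1..K. (y * z) ^ k) = (y * z - (y * z) ^ Suc K) / (1 - y * z)"
      using nz by (simp add: eq_divide_eq)
    then show ?thesis by (simp add: power_mult_distrib diff_divide_distrib mult.commute)
  qed
  have "(\<Sum>k\<le>K. fps_nth (moment_fps ys) k * z ^ k) = (\<Sum>k=1..K. fps_nth (moment_fps ys) k * z ^ k)"
    by (intro sum.mono_neutral_right) (auto simp: moment_fps_def)
  also have "\<dots> = (\<Sum>k=1..K. (\<Sum>y\<leftarrow>ys. y ^ k * z ^ k) / real (length ys))"
    by (intro sum.cong refl) (auto simp: moment_fps_def sum_list_mult_const)
  also have "\<dots> = (\<Sum>y\<leftarrow>ys. \<Sum>k=1..K. y ^ k * z ^ k) / real (length ys)"
    by (simp add: sum_divide_distrib[symmetric] sum_list_sum_nth sum.swap[of _ "{Suc 0..K}"])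
  finally have "rect_M (sym_root_measure ys) z - (\<Sum>k\<le>K. fps_nth (moment_fps ys) k * z ^ k) =
      (\<Sum>y\<leftarrow>ys. z * y / (1 - y * z) - (\<Sum>k=1..K. y ^ k * z ^ k)) / real (length ys)"
    by (simp add: rect_M_sym_root_measure[OF assms(1,2)] sum_list_subtractf diff_divide_distrib)
  also have "(\<Sum>y\<leftarrow>ys. z * y / (1 - y * z) - (\<Sum>k=1..K. y ^ k * z ^ k)) =
      (\<Sum>y\<leftarrow>ys. (y * z) ^ Suc K / (1 - y * z))"
    by (intro arg_cong[where f = sum_list] map_cong refl remainder assms)
  finally have "\<bar>rect_M (sym_root_measure ys) z - (\<Sum>k\<le>K. fps_nth (moment_fps ys) k * z ^ k)\<bar> =
      \<bar>\<Sum>y\<leftarrow>ys. (y * z) ^ Suc K / (1 - y * z)\<bar> / real (length ys)" by simp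
  also have "\<bar>\<Sum>y\<leftarrow>ys. (y * z) ^ Suc K / (1 - y * z)\<bar> \<le> (\<Sum>y\<leftarrow>ys. \<bar>(y * z) ^ Suc K / (1 - y * z)\<bar>)"
    using sum_list_abs[of "map (\<lambda>y. (y * z) ^ Suc K / (1 - y * z)) ys"] by (simp add: o_def)
  also have "\<dots> \<le> (\<Sum>y\<leftarrow>ys. y ^ Suc K * \<bar>z\<bar> ^ Suc K)"
  proof (rule sum_list_mono)
    fix y assume "y \<in> set ys"
    then have y: "0 \<le> y" using assms by auto
    then have "1 - y * z \<ge> 1" using assms(3) by (simp add: mult_nonneg_nonpos)
    then have "\<bar>(y * z) ^ Suc K / (1 - y * z)\<bar> \<le> \<bar>(y * z) ^ Suc K\<bar> / 1"
      unfolding abs_divide by (intro divide_left_mono) auto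
    then show "\<bar>(y * z) ^ Suc K / (1 - y * z)\<bar> \<le> y ^ Suc K * \<bar>z\<bar> ^ Suc K"
      using y by (simp add: abs_mult power_abs power_mult_distrib mult_ac)
  qed
  also have "\<dots> / real (length ys) = fps_nth (moment_fps ys) (Suc K) * \<bar>z\<bar> ^ Suc K"
    by (simp add: moment_fps_def sum_list_mult_const)
  finally show ?thesis by (simp add: divide_right_mono)
qed

text \<open>The second moment of the symmetrized measure is the first moment of the roots, so Markov's
  inequality applies.\<close>

lemma tight_sym_root_measures:
  fixes B :: real
  assumes "\<And>d. ys d \<noteq> []" "\<And>d y. y \<in> set (ys d) \<Longrightarrow> 0 \<le> y"
    and bound: "\<And>d. fps_nth (moment_fps (ys d)) 1 \<le> B"
  shows "tight (\<lambda>d. sym_root_measure (ys d))"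
  unfolding tight_def
proof (intro conjI allI impI)
  fix d show rd: "real_distribution (sym_root_measure (ys d))"
    using symmetric_sym_root_measure[OF assms(1)] by (simp add: symmetric_distribution_def)
next
  fix \<epsilon> :: real assume e: "\<epsilon> > 0"
  define R where "R = sqrt ((\<bar>B\<bar> + 1) / \<epsilon>)"
  have R: "0 < R" "R\<^sup>2 = (\<bar>B\<bar> + 1) / \<epsilon>" using e by (auto simp: R_def)
  have "measure (sym_root_measure (ys d)) {- R<..R} > 1 - \<epsilon>" for d
  proof -
    let ?M = "sym_root_measure (ys d)"
    interpret real_distribution ?M
      using symmetric_sym_root_measure[OF assms(1)] by (simp add: symmetric_distribution_def)
    have "{..<length (ys d)} \<times> (UNIV :: bool set) \<noteq> {}" using assms(1)[of d] by auto
    then have "finite (set_pmf (pmf_of_set ({..<length (ys d)} \<times> (UNIV :: bool set))))"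
      by (subst set_pmf_of_set) auto
    then have int: "integrable ?M (\<lambda>t. t\<^sup>2)"
      unfolding sym_root_measure_def
      by (subst integrable_distr_eq) (auto intro!: integrable_measure_pmf_finite)
    have "(\<integral>t. t\<^sup>2 \<partial>?M) = (\<Sum>y\<leftarrow>ys d. ((sqrt y)\<^sup>2 + (- sqrt y)\<^sup>2) / 2) / real (length (ys d))"
      by (rule integral_sym_root_measure[OF assms(1)]) simp
    also have "(\<Sum>y\<leftarrow>ys d. ((sqrt y)\<^sup>2 + (- sqrt y)\<^sup>2) / 2) = (\<Sum>y\<leftarrow>ys d. y)"
      by (intro arg_cong[where f = sum_list] map_cong refl) (use assms in auto)
    also have "\<dots> / real (length (ys d)) = fps_nth (moment_fps (ys d)) 1" by (simp add: moment_fps_def)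
    finally have m2: "(\<integral>t. t\<^sup>2 \<partial>?M) \<le> B" using bound[of d] by simp
    have "prob {t \<in> space ?M. R\<^sup>2 \<le> t\<^sup>2} \<le> (\<integral>t. t\<^sup>2 \<partial>?M) / R\<^sup>2"
      by (rule integral_Markov_inequality_measure[OF int, of "{}"]) (use R(1) in auto)
    also have "\<dots> \<le> B / R\<^sup>2" by (intro divide_right_mono m2) simp
    also have "\<dots> < \<epsilon>" using e unfolding R(2) by (simp add: field_simps) (auto simp: abs_if algebra_simps)
    finally have "prob {t \<in> space ?M. R\<^sup>2 \<le> t\<^sup>2} < \<epsilon>" .
    moreover have "1 - prob {- R<..R} = prob (space ?M - {- R<..R})" by (subst prob_compl) auto
    moreover have "prob (space ?M - {- R<..R}) \<le> prob {t \<in> space ?M. R\<^sup>2 \<le> t\<^sup>2}"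
      using R(1) by (intro finite_measure_mono) (auto simp: abs_le_square_iff[symmetric])
    ultimately show ?thesis by linarith
  qed
  then show "\<exists>a b. a < b \<and> (\<forall>d. measure (sym_root_measure (ys d)) {a<..b} > 1 - \<epsilon>)"
    using R by (intro exI[of _ "- R"] exI[of _ R]) auto
qed

section \<open>The rectangular R-transform\<close>

text \<open>For \<open>z \<le> 0\<close> this is \<open>1\<close> plus \<^term>\<open>rect_M \<mu> z\<close>, with an integrand that takes values in \<open>(0,1]\<close> and thus
  can be integrated against every distribution.\<close>

definition resolvent :: "real measure \<Rightarrow> real \<Rightarrow> real" where
  "resolvent \<mu> z = (\<integral>t. 1 / (1 - t\<^sup>2 * z) \<partial>\<mu>)"

lemma denominator_ge_1: "z \<le> 0 \<Longrightarrow> 1 \<le> 1 - t\<^sup>2 * (z :: real)"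
  using mult_nonneg_nonpos[of "t\<^sup>2" z] by simp

lemma kernel_bounds:
  assumes "z \<le> (0 :: real)"
  shows "0 < 1 / (1 - t\<^sup>2 * z)" "1 / (1 - t\<^sup>2 * z) \<le> 1"
  using denominator_ge_1[OF assms, of t] by simp_all

lemma norm_kernel_le_1: "z \<le> (0 :: real) \<Longrightarrow> norm (1 / (1 - t\<^sup>2 * z)) \<le> 1"
  using denominator_ge_1[of z t] by simp

lemma kernel_differences:
  fixes s :: real
  assumes "1 - s * z1 \<noteq> 0" "1 - s * z2 \<noteq> 0"
  defines "a \<equiv> 1 / (1 - s * z1)" and "b \<equiv> 1 / (1 - s * z2)"
  shows "z2 * b - z1 * a = (z2 - z1) * (a * b)"
    and "(- z1) * (b - a) = (z2 - z1) * ((1 - a) * b)"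
proof -
  have "a * (1 - s * z1) = 1" "b * (1 - s * z2) = 1" using assms by auto
  then show "z2 * b - z1 * a = (z2 - z1) * (a * b)"
    and "(- z1) * (b - a) = (z2 - z1) * ((1 - a) * b)" by algebra+
qed

lemma (in real_distribution) integrable_kernel:
  assumes "z \<le> 0"
  shows "integrable M (\<lambda>t. 1 / (1 - t\<^sup>2 * z))"
  by (intro integrable_const_bound[where B = 1] AE_I2 norm_kernel_le_1 assms) auto

lemma (in real_distribution) rect_M_eq_resolvent:
  assumes "z \<le> 0"
  shows "rect_M M z = resolvent M z - 1"
proof -
  have "rect_M M z = (\<integral>t. 1 / (1 - t\<^sup>2 * z) - 1 \<partial>M)"
    unfolding rect_M_def
  proof (intro Bochner_Integration.integral_cong refl)
    fix t
    show "z * t\<^sup>2 / (1 - t\<^sup>2 * z) = 1 / (1 - t\<^sup>2 * z) - 1"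
      using denominator_ge_1[OF assms, of t] by (simp add: field_simps)
  qed
  also have "\<dots> = resolvent M z - 1"
    unfolding resolvent_def using prob_space
    by (subst Bochner_Integration.integral_diff[OF integrable_kernel[OF assms]]) auto
  finally show ?thesis .
qed

lemma (in real_distribution) resolvent_bounds:
  assumes "z \<le> 0"
  shows "0 < resolvent M z" "resolvent M z \<le> 1"
proof -
  show "resolvent M z \<le> 1"
    unfolding resolvent_def using kernel_bounds[OF assms]
    by (intro integral_le_const integrable_kernel assms) auto
  show "0 < resolvent M z"
    unfolding resolvent_def
    by (rule expectation_greater[OF integrable_kernel[OF assms]]) (use kernel_bounds[OF assms] in auto)
qed

lemma (in real_distribution) resolvent_0: "resolvent M 0 = 1"
  unfolding resolvent_def using prob_space by simp

lemma (in real_distribution) resolvent_mono: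
  assumes "z1 \<le> z2" "z2 \<le> 0"
  shows "resolvent M z1 \<le> resolvent M z2"
  unfolding resolvent_def
proof (intro integral_mono integrable_kernel)
  fix t
  have "1 - t\<^sup>2 * z2 \<le> 1 - t\<^sup>2 * z1" using assms by (simp add: mult_left_mono)
  then show "1 / (1 - t\<^sup>2 * z1) \<le> 1 / (1 - t\<^sup>2 * z2)"
    using denominator_ge_1[OF assms(2), of t] by (intro divide_left_mono) auto
qed (use assms in auto)

lemma (in real_distribution) continuous_resolvent: "continuous_on {..0} (resolvent M)"
  unfolding continuous_on_sequentially
proof (intro ballI allI impI, elim conjE)
  fix x :: "nat \<Rightarrow> real" and a
  assume x: "\<forall>n. x n \<in> {..0}" "x \<longlonglongrightarrow> a" and a: "a \<in> {..0}"
  show "(resolvent M \<circ> x) \<longlonglongrightarrow> resolvent M a"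
    unfolding resolvent_def o_def
  proof (rule integral_dominated_convergence[where w = "\<lambda>_. 1"])
    show "AE t in M. (\<lambda>n. 1 / (1 - t\<^sup>2 * x n)) \<longlonglongrightarrow> 1 / (1 - t\<^sup>2 * a)"
    proof (intro AE_I2 tendsto_intros x)
      fix t show "1 - t\<^sup>2 * a \<noteq> 0" using denominator_ge_1[of a t] a by simp
    qed
    show "AE t in M. norm (1 / (1 - t\<^sup>2 * x n)) \<le> 1" for n
      using x(1) by (intro AE_I2 norm_kernel_le_1) auto
  qed auto
qed

lemma (in real_distribution) rect_H_eq:
  assumes "z \<le> 0"
  shows "rect_H lam M z = z * (1 + lam * (resolvent M z - 1)) * resolvent M z"
  unfolding rect_H_def rect_M_eq_resolvent[OF assms] by (simp add: add.commute)

text \<open>Write \<open>U\<close> for the resolvent, so that \<open>H(z) = z U(z) \<cdot> (1 + \<lambda>(U(z) - 1))\<close>. The first factor is negative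
  and increasing and the second is positive and increasing, so monotonicity of \<open>H\<close> is a matter of
  size: with \<open>\<delta> = z2 - z1\<close> the first factor grows by at least \<open>\<delta>(U1 + U2 - 1) \<ge> \<delta>/2\<close>, and the increase
  of the second one costs at most \<open>\<delta>(1 - U1) \<le> \<delta>/4\<close>; finally \<open>\<delta>/2 \<cdot> 3/4 > \<delta>/4\<close>.\<close>

lemma (in real_distribution) rect_H_strict_mono:
  assumes z: "z1 < z2" "z2 < 0" and lam: "0 < lam" "lam \<le> 1" and U: "3/4 \<le> resolvent M z1"
  shows "rect_H lam M z1 < rect_H lam M z2"
proof -
  define U1 U2 where "U1 = resolvent M z1" and "U2 = resolvent M z2"
  define u where "u z t = 1 / (1 - t\<^sup>2 * z)" for z t :: real
  have int: "integrable M (u z1)" "integrable M (u z2)"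
    unfolding u_def using z by (auto intro!: integrable_kernel)
  have u: "0 < u z1 t" "u z1 t \<le> 1" "0 < u z2 t" "u z2 t \<le> 1" for t
    unfolding u_def using kernel_bounds[of z1 t] kernel_bounds[of z2 t] z by auto
  have U12: "U1 = (\<integral>t. u z1 t \<partial>M)" "U2 = (\<integral>t. u z2 t \<partial>M)"
    by (simp_all add: U1_def U2_def resolvent_def u_def)
  have mono: "U1 \<le> U2" unfolding U1_def U2_def using z by (intro resolvent_mono) auto
  have U2: "U2 \<le> 1" "0 < U1" "U1 \<le> 1" using resolvent_bounds z by (auto simp: U1_def U2_def)
  have den: "1 - t\<^sup>2 * z1 > 0" "1 - t\<^sup>2 * z2 > 0" for t
    using denominator_ge_1[of z1 t] denominator_ge_1[of z2 t] z by auto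
  have ptw: "(z2 - z1) * (u z1 t + u z2 t - 1) \<le> z2 * u z2 t - z1 * u z1 t" for t
  proof -
    have "z2 * u z2 t - z1 * u z1 t = (z2 - z1) * (u z1 t * u z2 t)"
      unfolding u_def using den[of t] by (intro kernel_differences) auto
    moreover have "0 \<le> (1 - u z1 t) * (1 - u z2 t)" using u by (intro mult_nonneg_nonneg) auto
    then have "u z1 t + u z2 t - 1 \<le> u z1 t * u z2 t" by (simp add: algebra_simps)
    ultimately show ?thesis using z by (simp add: mult_left_mono)
  qed
  have "(\<integral>t. (z2 - z1) * (u z1 t + u z2 t - 1) \<partial>M) \<le> (\<integral>t. z2 * u z2 t - z1 * u z1 t \<partial>M)"
    using int by (intro integral_mono ptw) auto
  then have A: "(z2 - z1) * (U1 + U2 - 1) \<le> z2 * U2 - z1 * U1"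
    using int prob_space by (simp add: U12)
  have ptw2: "(- z1) * (u z2 t - u z1 t) \<le> (z2 - z1) * (1 - u z1 t)" for t
  proof -
    have "(- z1) * (u z2 t - u z1 t) = (z2 - z1) * ((1 - u z1 t) * u z2 t)"
      unfolding u_def using den[of t] by (intro kernel_differences) auto
    also have "\<dots> \<le> (z2 - z1) * ((1 - u z1 t) * 1)"
      using z u by (intro mult_left_mono) auto
    finally show ?thesis by simp
  qed
  have "(\<integral>t. (- z1) * (u z2 t - u z1 t) \<partial>M) \<le> (\<integral>t. (z2 - z1) * (1 - u z1 t) \<partial>M)"
    using int by (intro integral_mono ptw2) auto
  then have B: "(- z1) * (U2 - U1) \<le> (z2 - z1) * (1 - U1)"
    using int prob_space by (simp add: U12)
  define b1 b2 where "b1 = 1 + lam * (U1 - 1)" and "b2 = 1 + lam * (U2 - 1)"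
  have b2: "U1 \<le> b2"
  proof -
    have "lam * (1 - U2) \<le> 1 * (1 - U2)" using lam U2 by (intro mult_right_mono) auto
    then show ?thesis using mono by (simp add: b2_def algebra_simps)
  qed
  have eq: "rect_H lam M z2 - rect_H lam M z1 = (z2 * U2 - z1 * U1) * b2 - (lam * U1) * ((- z1) * (U2 - U1))"
    using z by (simp add: rect_H_eq b1_def b2_def U1_def U2_def algebra_simps)
    have "(z2 - z1) * (1/2) \<le> (z2 - z1) * (U1 + U2 - 1)"
      using z U mono by (intro mult_left_mono) (auto simp: U1_def)
    with A have A': "(z2 - z1) * (1/2) \<le> z2 * U2 - z1 * U1" by simp
    have "((z2 - z1) * (1/2)) * (3/4) \<le> (z2 * U2 - z1 * U1) * b2"
      using A' b2 U z U1_def by (intro mult_mono) (auto intro: order_trans[OF _ A'])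
    moreover have "(lam * U1) * ((- z1) * (U2 - U1)) \<le> 1 * ((z2 - z1) * (1/4))"
    proof (rule mult_mono)
      show "lam * U1 \<le> 1" using lam U2 by (intro mult_le_one) auto
      have "(z2 - z1) * (1 - U1) \<le> (z2 - z1) * (1/4)" using z U by (intro mult_left_mono) (auto simp: U1_def)
      with B show "(- z1) * (U2 - U1) \<le> (z2 - z1) * (1/4)" by simp
      show "0 \<le> (- z1) * (U2 - U1)" using z mono by (intro mult_nonneg_nonneg) auto
    qed auto
    moreover have "x1 < x2" if "x2 - x1 = P - Q" "\<delta> * (1/2) * (3/4) \<le> P" "Q \<le> 1 * (\<delta> * (1/4))" "0 < \<delta>"
      for x1 x2 P Q \<delta> :: real
      using that by linarith
    ultimately show ?thesis using eq z by (metis diff_gt_0_iff_gt)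
qed

lemma (in real_distribution) rect_H_injective_near_0:
  assumes lam: "0 < lam" "lam \<le> 1"
  shows "\<exists>\<beta>>0. inj_on (rect_H lam M) {-\<beta><..<0}"
proof -
  have "((resolvent M) \<longlongrightarrow> resolvent M 0) (at 0 within {..0})"
    using continuous_resolvent by (auto simp: continuous_on_def)
  then have "eventually (\<lambda>z. resolvent M z > 3/4) (at 0 within {..0})"
    by (rule order_tendstoD) (simp add: resolvent_0)
  then obtain e where e: "e > 0" "\<And>z. z \<le> 0 \<Longrightarrow> z \<noteq> 0 \<Longrightarrow> \<bar>z\<bar> < e \<Longrightarrow> resolvent M z > 3/4"
    unfolding eventually_at by (auto simp: dist_real_def)
  have mono: "rect_H lam M z1 < rect_H lam M z2" if "z1 < z2" "z1 \<in> {-e<..<0}" "z2 \<in> {-e<..<0}" for z1 z2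
    using that e(2)[of z1] by (intro rect_H_strict_mono lam) auto
  have "inj_on (rect_H lam M) {-e<..<0}"
    by (rule linorder_inj_onI') (use mono in fastforce)
  then show ?thesis using e(1) by blast
qed

lemma (in real_distribution) rect_H_neg:
  assumes "z < 0" "0 < lam" "lam \<le> 1"
  shows "rect_H lam M z < 0"
proof -
  have "lam * (1 - resolvent M z) \<le> 1 * (1 - resolvent M z)"
    using resolvent_bounds[of z] assms by (intro mult_right_mono) auto
  then have "0 < 1 + lam * (resolvent M z - 1)"
    using resolvent_bounds[of z] assms by (simp add: algebra_simps)
  then show ?thesis
    unfolding rect_H_eq[OF less_imp_le[OF assms(1)]] using resolvent_bounds[of z] assms
    by (intro mult_neg_pos) auto
qed

lemma (in real_distribution) continuous_rect_H: "continuous_on {..0} (rect_H lam M)"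
proof -
  have "continuous_on {..0} (\<lambda>z. z * (1 + lam * (resolvent M z - 1)) * resolvent M z)"
    by (intro continuous_intros continuous_resolvent)
  then show ?thesis by (rule continuous_on_eq) (simp add: rect_H_eq)
qed

lemma (in real_distribution) rect_H_at_left:
  assumes "0 < lam" "lam \<le> 1"
  shows "filterlim (rect_H lam M) (at_left 0) (at_left 0)"
proof (rule filterlim_at[THEN iffD2], rule conjI)
  have "((rect_H lam M) \<longlongrightarrow> rect_H lam M 0) (at 0 within {..0})"
    using continuous_rect_H by (auto simp: continuous_on_def)
  moreover have "at_left (0::real) \<le> at 0 within {..0}" by (rule at_le) auto
  ultimately show "((rect_H lam M) \<longlongrightarrow> 0) (at_left 0)"
    by (auto simp: rect_H_def[of _ _ 0] intro: tendsto_mono)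
  show "\<forall>\<^sub>F x in at_left 0. rect_H lam M x \<in> {..<0} \<and> rect_H lam M x \<noteq> 0"
    unfolding eventually_at_filter
  proof (intro always_eventually allI impI)
    fix x :: real assume "x \<in> {..<0}"
    then have "rect_H lam M x < 0" by (intro rect_H_neg assms) auto
    then show "rect_H lam M x \<in> {..<0} \<and> rect_H lam M x \<noteq> 0" by auto
  qed
qed

text \<open>The interval chosen in the definition of the inverse is unknown, but \<open>H\<close> is injective on it. By the
  intermediate value theorem each small negative value is attained close to zero, hence inside that
  interval.\<close>

lemma (in real_distribution) rect_H_inverse:
  assumes lam: "0 < lam" "lam \<le> 1"
  shows "eventually (\<lambda>w. rect_H_inv lam M (rect_H lam M w) = w) (at_left 0)"
    and "eventually (\<lambda>z. rect_H_inv lam M z < 0 \<and> rect_H lam M (rect_H_inv lam M z) = z) (at_left 0)"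
    and "(rect_H_inv lam M \<longlongrightarrow> 0) (at_left 0)"
proof -
  define \<beta> where "\<beta> = (SOME \<beta>. 0 < \<beta> \<and> inj_on (rect_H lam M) {-\<beta><..<0})"
  have \<beta>: "0 < \<beta>" "inj_on (rect_H lam M) {-\<beta><..<0}"
    using someI_ex[OF rect_H_injective_near_0[OF lam]] unfolding \<beta>_def by auto
  have inv: "rect_H_inv lam M = inv_into {-\<beta><..<0} (rect_H lam M)"
    by (simp add: rect_H_inv_def Let_def \<beta>_def)
  have left: "rect_H_inv lam M (rect_H lam M w) = w" if "w \<in> {-\<beta><..<0}" for w
    unfolding inv using \<beta>(2) that by (rule inv_into_f_f)
  have ev: "eventually (\<lambda>w. w \<in> {-\<beta><..<0}) (at_left 0)"
    using \<beta>(1) by (intro eventually_at_leftI[of "-\<beta>"]) auto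
  then show "eventually (\<lambda>w. rect_H_inv lam M (rect_H lam M w) = w) (at_left 0)"
    by eventually_elim (rule left)
  have small: "eventually (\<lambda>z. rect_H_inv lam M z \<in> {-e<..<0} \<and> rect_H lam M (rect_H_inv lam M z) = z) (at_left 0)"
    if e: "0 < e" "e \<le> \<beta>" for e
  proof (rule eventually_at_leftI[of "rect_H lam M (- e / 2)"])
    show "rect_H lam M (- e / 2) < 0" using e by (intro rect_H_neg lam) auto
    fix z assume z: "z \<in> {rect_H lam M (- e / 2)<..<0}"
    have "\<exists>w\<ge>- e / 2. w \<le> 0 \<and> rect_H lam M w = z"
    proof (rule IVT')
      show "continuous_on {- e / 2..0} (rect_H lam M)"
        by (rule continuous_on_subset[OF continuous_rect_H]) auto
    qed (use z e in \<open>auto simp: rect_H_def[of _ _ 0]\<close>)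
    then obtain w where w: "- e / 2 \<le> w" "w \<le> 0" "rect_H lam M w = z" by blast
    have "w \<noteq> 0" using w(3) z by (auto simp: rect_H_def)
    then have "w \<in> {-e<..<0}" using w e by auto
    moreover have "rect_H_inv lam M z = w" using left[of w] w \<open>w \<in> {-e<..<0}\<close> e by auto
    ultimately show "rect_H_inv lam M z \<in> {-e<..<0} \<and> rect_H lam M (rect_H_inv lam M z) = z"
      using w by simp
  qed
  show "eventually (\<lambda>z. rect_H_inv lam M z < 0 \<and> rect_H lam M (rect_H_inv lam M z) = z) (at_left 0)"
    using small[OF \<beta>(1)] by (auto elim: eventually_mono)
  show "(rect_H_inv lam M \<longlongrightarrow> 0) (at_left 0)"
    unfolding tendsto_iff
  proof (intro allI impI)
    fix e :: real assume "e > 0"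
    then have "eventually (\<lambda>z. rect_H_inv lam M z \<in> {- min e \<beta><..<0} \<and> rect_H lam M (rect_H_inv lam M z) = z) (at_left 0)"
      using \<beta>(1) by (intro small) auto
    then show "eventually (\<lambda>z. dist (rect_H_inv lam M z) 0 < e) (at_left 0)"
      by eventually_elim (auto simp: dist_real_def)
  qed
qed

text \<open>The square root picks the branch with \<open>2 \<lambda> u + \<lambda> + 1 > 0\<close>, which is where \<open>u > -1\<close> and \<open>\<lambda> \<le> 1\<close> enter.\<close>

lemma rect_U_inverse:
  assumes "0 < lam" "lam \<le> 1" "-1 < u"
  shows "rect_U lam ((lam * u + 1) * (u + 1) - 1) = u"
proof -
  have "lam * (-1) < lam * u" using assms by (intro mult_strict_left_mono) auto
  then have "0 < 2 * lam * u + lam + 1" using assms by linarith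
  moreover have "(lam + 1)\<^sup>2 + 4 * lam * ((lam * u + 1) * (u + 1) - 1) = (2 * lam * u + lam + 1)\<^sup>2"
    by (simp add: power2_eq_square algebra_simps)
  ultimately show ?thesis using assms(1) by (simp add: rect_U_def)
qed

lemma (in real_distribution) rect_R_eq:
  assumes lam: "0 < lam" "lam \<le> 1"
  shows "eventually (\<lambda>z. rect_R lam M z = rect_M M (rect_H_inv lam M z)) (at_left 0)"
  using rect_H_inverse(2)[OF lam]
proof eventually_elim
  case (elim z)
  define w where "w = rect_H_inv lam M z"
  have w: "w < 0" "rect_H lam M w = z" using elim by (auto simp: w_def)
  have "z / w - 1 = (lam * rect_M M w + 1) * (rect_M M w + 1) - 1"
    using w(1) by (simp add: w(2)[symmetric] rect_H_def)
  moreover have "-1 < rect_M M w"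
    using w resolvent_bounds[of w] by (simp add: rect_M_eq_resolvent)
  ultimately show ?case
    unfolding rect_R_def w_def[symmetric] by (simp only: rect_U_inverse[OF lam])
qed

lemma (in real_distribution) rect_R_of_functional_equation:
  assumes lam: "0 < lam" "lam \<le> 1"
    and eq: "eventually (\<lambda>w. rect_M M w = c (rect_H lam M w)) (at_left 0)"
  shows "eventually (\<lambda>z. rect_R lam M z = c z) (at_left 0)"
proof -
  have "filterlim (rect_H_inv lam M) (at_left 0) (at_left 0)"
    using rect_H_inverse(2,3)[OF lam]
    by (intro filterlim_at[THEN iffD2]) (auto elim: eventually_mono)
  from eventually_compose_filterlim[OF eq this] rect_R_eq[OF lam] rect_H_inverse(2)[OF lam]
  show ?thesis by eventually_elim auto
qed

text \<open>If \<open>w\<close> is the inverse image of \<open>z\<close> under \<open>H\<close> and \<open>m = R(z) = M(w)\<close>, then \<open>w (\<lambda> m + 1)(m + 1) = z\<close>. So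
  \<open>R\<close> determines the inverse of \<open>H\<close> near zero, hence \<open>H\<close>, hence \<open>M\<close>.\<close>

lemma rect_R_determines_rect_M:
  assumes "real_distribution \<mu>" "real_distribution \<nu>" and lam: "0 < lam" "lam \<le> 1"
    and R: "eventually (\<lambda>z. rect_R lam \<mu> z = rect_R lam \<nu> z) (at_left 0)"
  shows "eventually (\<lambda>w. rect_M \<mu> w = rect_M \<nu> w) (at_left 0)"
proof -
  interpret \<mu>: real_distribution \<mu> by fact
  interpret \<nu>: real_distribution \<nu> by fact
  have "eventually (\<lambda>z. rect_M \<mu> (rect_H_inv lam \<mu> z) = rect_M \<nu> (rect_H_inv lam \<mu> z)) (at_left 0)"
    using R \<mu>.rect_R_eq[OF lam] \<nu>.rect_R_eq[OF lam] \<mu>.rect_H_inverse(2)[OF lam] \<nu>.rect_H_inverse(2)[OF lam]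
  proof eventually_elim
    case (elim z)
    define v w where "v = rect_H_inv lam \<mu> z" and "w = rect_H_inv lam \<nu> z"
    define m where "m = rect_M \<mu> v"
    have m: "m = rect_M \<nu> w" using elim by (simp add: m_def v_def w_def)
    have "v * ((lam * m + 1) * (m + 1)) = z" "w * ((lam * m + 1) * (m + 1)) = z"
      using elim unfolding m_def m v_def w_def rect_H_def by (simp_all add: mult.assoc)
    moreover have "z \<noteq> 0"
      using elim \<mu>.rect_H_neg[OF _ lam, of v] by (auto simp: v_def)
    ultimately have "v = w" by (metis mult_cancel_right mult_zero_right)
    then show ?case using m by (simp add: m_def v_def w_def)
  qed
  from eventually_compose_filterlim[OF this \<mu>.rect_H_at_left[OF lam]] \<mu>.rect_H_inverse(1)[OF lam]
  show ?thesis by eventually_elim simp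
qed

section \<open>Uniqueness of the measure with a given R-transform\<close>

lemma bounded_moments_determine_distribution:
  assumes M: "real_distribution M" "real_distribution N"
    and bnd: "AE x in M. \<bar>x\<bar> \<le> 1" "AE x in N. \<bar>x\<bar> \<le> 1"
    and eq: "\<And>k. (\<integral>x. x ^ k \<partial>M) = (\<integral>x. x ^ k \<partial>N)"
  shows "M = N"
proof (rule Levy_uniqueness[OF M])
  have approx: "cmod (char M t - (\<Sum>k \<le> n. ((\<i> * t)^k / fact k) * (\<integral>x. x ^ k \<partial>M))) \<le> 2 * (\<bar>t\<bar>^n / fact n)"
    if M: "real_distribution M" and b: "AE x in M. \<bar>x\<bar> \<le> 1" for M t n
  proof -
    interpret real_distribution M by fact
    have pw: "AE x in M. \<bar>x\<bar> ^ k \<le> 1" for k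
      using b by eventually_elim (auto intro: power_le_one)
    have int: "integrable M (\<lambda>x. x ^ k)" for k
      using pw[of k] by (intro integrable_const_bound[where B = 1]) (auto simp: power_abs)
    have "expectation (\<lambda>x. \<bar>x\<bar> ^ n) \<le> 1"
      using pw[of n] int[of n]
      by (intro integral_le_const) (auto simp: power_abs[symmetric])
    then have "(2*\<bar>t\<bar>^n / fact n) * expectation (\<lambda>x. \<bar>x\<bar>^n) \<le> (2*\<bar>t\<bar>^n / fact n) * 1"
      by (intro mult_left_mono) auto
    then show ?thesis using char_approx1[of n t] int by (auto intro: order_trans)
  qed
  show "char M = char N"
  proof
    fix t
    have "cmod (char M t - char N t) \<le> 4 * (\<bar>t\<bar>^n / fact n)" for n
    proof -
      let ?S = "\<Sum>k \<le> n. ((\<i> * t)^k / fact k) * complex_of_real (\<integral>x. x ^ k \<partial>M)"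
      have "cmod (char M t - ?S) \<le> 2 * (\<bar>t\<bar>^n / fact n)" by (rule approx[OF M(1) bnd(1)])
      moreover have "cmod (char N t - ?S) \<le> 2 * (\<bar>t\<bar>^n / fact n)"
        unfolding eq by (rule approx[OF M(2) bnd(2)])
      ultimately show ?thesis
        using norm_triangle_ineq4[of "char M t - ?S" "char N t - ?S"] by simp
    qed
    moreover have "(\<lambda>n. 4 * (\<bar>t\<bar>^n / fact n)) \<longlonglongrightarrow> 4 * 0"
      using summable_LIMSEQ_zero[OF summable_exp[of "\<bar>t\<bar>"]]
      by (intro tendsto_intros) (simp add: divide_inverse mult.commute)
    ultimately have "cmod (char M t - char N t) \<le> 4 * 0"
      by (intro LIMSEQ_le_const) auto
    then show "char M t = char N t" by simp
  qed
qed

text \<open>Products of distinct kernels are linear combinations of kernels: with \<open>v\<^sub>x = 1/(1 + x t\<^sup>2)\<close> one has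
  \<open>v\<^sub>x v\<^sub>y = (x v\<^sub>x - y v\<^sub>y)/(x - y)\<close>.\<close>

lemma kernel_product_integrals:
  assumes \<mu>: "real_distribution \<mu>" "real_distribution \<nu>"
    and eq: "\<And>x. 0 < x \<Longrightarrow> x < e \<Longrightarrow> resolvent \<mu> (- x) = resolvent \<nu> (- x)"
  shows "distinct xs \<Longrightarrow> (\<And>x. x \<in> set xs \<Longrightarrow> 0 < x \<and> x < e) \<Longrightarrow>
    (\<integral>t. (\<Prod>x\<leftarrow>xs. 1 / (1 + t\<^sup>2 * x)) \<partial>\<mu>) = (\<integral>t. (\<Prod>x\<leftarrow>xs. 1 / (1 + t\<^sup>2 * x)) \<partial>\<nu>)"
proof (induction "length xs" arbitrary: xs rule: less_induct)
  case less
  have bounds: "0 \<le> (\<Prod>x\<leftarrow>zs. 1 / (1 + t\<^sup>2 * x)) \<and> (\<Prod>x\<leftarrow>zs. 1 / (1 + t\<^sup>2 * x)) \<le> 1"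
    if "\<And>x. x \<in> set zs \<Longrightarrow> 0 < x" for zs and t :: real
    using that
  proof (induction zs)
    case (Cons z zs)
    have "0 \<le> 1 / (1 + t\<^sup>2 * z)" "1 / (1 + t\<^sup>2 * z) \<le> 1"
      using Cons.prems[of z] by (auto simp: divide_le_eq_1)
    moreover have "0 \<le> (\<Prod>x\<leftarrow>zs. 1 / (1 + t\<^sup>2 * x)) \<and> (\<Prod>x\<leftarrow>zs. 1 / (1 + t\<^sup>2 * x)) \<le> 1"
      using Cons by simp
    ultimately show ?case
      unfolding list.map prod_list.Cons by (intro conjI mult_nonneg_nonneg mult_le_one) auto
  qed simp
  have int: "integrable M (\<lambda>t. \<Prod>x\<leftarrow>zs. 1 / (1 + t\<^sup>2 * x))"
    if "real_distribution M" "\<And>x. x \<in> set zs \<Longrightarrow> 0 < x" for M zs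
  proof -
    interpret real_distribution M by fact
    have "(\<lambda>t. \<Prod>x\<leftarrow>zs. 1 / (1 + t\<^sup>2 * x)) \<in> borel_measurable borel"
      by (induction zs) auto
    then show ?thesis using bounds[OF that(2)]
      by (intro integrable_const_bound[where B = 1]) auto
  qed
  consider "xs = []" | x where "xs = [x]" | x y zs where "xs = x # y # zs"
    by (metis list.exhaust)
  then show ?case
  proof cases
    case 1
    then show ?thesis using \<mu> by (simp add: real_distribution_def prob_space.prob_space)
  next
    case (2 x)
    then show ?thesis using eq[of x] less.prems(2)[of x] by (simp add: resolvent_def)
  next
    case (3 x y zs)
    have pos: "0 < x" "0 < y" "x \<noteq> y" "\<And>z. z \<in> set zs \<Longrightarrow> 0 < z" using less.prems 3 by auto
    let ?P = "\<lambda>zs t. \<Prod>x\<leftarrow>zs. 1 / (1 + t\<^sup>2 * x)"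
    have split: "?P (x # y # zs) t = (x * ?P (x # zs) t - y * ?P (y # zs) t) / (x - y)" for t
    proof -
      have "1 + t\<^sup>2 * x > 0" "1 + t\<^sup>2 * y > 0" using pos by (auto intro!: add_pos_nonneg)
      then have "1 / (1 + t\<^sup>2 * x) * (1 / (1 + t\<^sup>2 * y)) =
         (x * (1 / (1 + t\<^sup>2 * x)) - y * (1 / (1 + t\<^sup>2 * y))) / (x - y)"
        using pos(3) by (simp add: divide_simps) (simp add: algebra_simps)
      moreover have "a * (b * c) = (x * (a * c) - y * (b * c)) / (x - y)"
        if "a * b = (x * a - y * b) / (x - y)" for a b c
      proof -
        have "a * (b * c) = (x * a - y * b) / (x - y) * c" by (simp only: mult.assoc[symmetric] that)
        then show ?thesis by (simp add: left_diff_distrib mult.assoc)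
      qed
      ultimately show ?thesis unfolding list.map prod_list.Cons by blast
    qed
    have I: "(\<integral>t. ?P (x # y # zs) t \<partial>M) = (x * (\<integral>t. ?P (x # zs) t \<partial>M) - y * (\<integral>t. ?P (y # zs) t \<partial>M)) / (x - y)"
      if "real_distribution M" for M
    proof -
      have "integrable M (?P (x # zs))" "integrable M (?P (y # zs))"
        using pos by (intro int that; auto)+
      then show ?thesis unfolding split by (simp del: list.map prod_list.Cons)
    qed
    have "(\<integral>t. ?P (x # zs) t \<partial>\<mu>) = (\<integral>t. ?P (x # zs) t \<partial>\<nu>)"
      "(\<integral>t. ?P (y # zs) t \<partial>\<mu>) = (\<integral>t. ?P (y # zs) t \<partial>\<nu>)"
      using less.prems 3 by (intro less.hyps; auto)+
    then show ?thesis unfolding 3 I[OF \<mu>(1)] I[OF \<mu>(2)] by simp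
  qed
qed

text \<open>Letting distinct nodes merge at \<open>e/2\<close> gives the moments of the single bounded function
  \<open>1/(1 + t\<^sup>2 e/2)\<close>, and these determine its distribution. This replaces analytic continuation of the
  resolvent from an interval to the whole half-line.\<close>

lemma kernel_power_integrals:
  assumes \<mu>: "real_distribution \<mu>" "real_distribution \<nu>" and e: "0 < e"
    and eq: "\<And>x. 0 < x \<Longrightarrow> x < e \<Longrightarrow> resolvent \<mu> (- x) = resolvent \<nu> (- x)"
  shows "(\<integral>t. (1 / (1 + t\<^sup>2 * (e / 2))) ^ k \<partial>\<mu>) = (\<integral>t. (1 / (1 + t\<^sup>2 * (e / 2))) ^ k \<partial>\<nu>)"
proof -
  \<comment> \<open>The denominator is larger than \<open>k > i\<close>, so the nodes stay below \<open>e\<close>; they are distinct for each \<open>n\<close>.\<close>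
  define x where "x n i = e / 2 + (e / 2) * (real i / real (k + Suc n))" for n i
  have xpos: "0 < x n i" for n i using e by (auto simp: x_def intro!: add_pos_nonneg)
  have xlt: "x n i < e" if "i < k" for n i
  proof -
    have "real i / real (k + Suc n) < 1" using that by simp
    then have "(e / 2) * (real i / real (k + Suc n)) < (e / 2) * 1" using e by (intro mult_strict_left_mono) auto
    then show ?thesis unfolding x_def by linarith
  qed
  have inj: "inj_on (x n) {..<k}" for n using e by (auto simp: inj_on_def x_def)
  have xlim: "(\<lambda>n. x n i) \<longlonglongrightarrow> e / 2" for i
  proof -
    have "(\<lambda>n. real i / real (n + Suc k)) \<longlonglongrightarrow> 0"
      by (rule LIMSEQ_ignore_initial_segment[OF lim_const_over_n])
    then have "(\<lambda>n. e / 2 + (e / 2) * (real i / real (n + Suc k))) \<longlonglongrightarrow> e / 2 + e / 2 * 0"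
      by (intro tendsto_intros)
    then show ?thesis by (simp add: x_def add.commute)
  qed
  have lim: "(\<lambda>n. \<integral>t. (\<Prod>i<k. 1 / (1 + t\<^sup>2 * x n i)) \<partial>M) \<longlonglongrightarrow> (\<integral>t. (1 / (1 + t\<^sup>2 * (e / 2))) ^ k \<partial>M)"
    if "real_distribution M" for M
  proof -
    interpret real_distribution M by fact
    show ?thesis
    proof (rule integral_dominated_convergence[where w = "\<lambda>_. 1"])
      show "AE t in M. (\<lambda>n. \<Prod>i<k. 1 / (1 + t\<^sup>2 * x n i)) \<longlonglongrightarrow> (1 / (1 + t\<^sup>2 * (e / 2))) ^ k"
      proof (rule AE_I2)
        fix t :: real
        have "(1 + t\<^sup>2 * (e / 2)) \<noteq> 0" using e by (metis add_pos_nonneg half_gt_zero less_irrefl mult_nonneg_nonneg less_imp_le zero_le_power2 zero_less_one)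
        then have "(\<lambda>n. \<Prod>i<k. 1 / (1 + t\<^sup>2 * x n i)) \<longlonglongrightarrow> (\<Prod>i<k. 1 / (1 + t\<^sup>2 * (e / 2)))"
          by (intro tendsto_prod tendsto_intros xlim)
        then show "(\<lambda>n. \<Prod>i<k. 1 / (1 + t\<^sup>2 * x n i)) \<longlonglongrightarrow> (1 / (1 + t\<^sup>2 * (e / 2))) ^ k" by simp
      qed
      have "0 \<le> 1 / (1 + t\<^sup>2 * x n i) \<and> 1 / (1 + t\<^sup>2 * x n i) \<le> 1" for t n i
        using xpos[of n i] by (auto simp: divide_le_eq_1)
      then show "AE t in M. norm (\<Prod>i<k. 1 / (1 + t\<^sup>2 * x n i)) \<le> 1" for n
        by (intro AE_I2) (auto simp: abs_prod intro!: prod_le_1)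
    qed auto
  qed
  have "(\<integral>t. (\<Prod>i<k. 1 / (1 + t\<^sup>2 * x n i)) \<partial>\<mu>) = (\<integral>t. (\<Prod>i<k. 1 / (1 + t\<^sup>2 * x n i)) \<partial>\<nu>)" for n
  proof -
    have "(\<Prod>i<k. 1 / (1 + t\<^sup>2 * x n i)) = (\<Prod>x\<leftarrow>map (x n) [0..<k]. 1 / (1 + t\<^sup>2 * x))" for t
    proof -
      have "(\<Prod>i<m. f i) = prod_list (map f [0..<m])" for f :: "nat \<Rightarrow> real" and m
        by (induction m) auto
      then show ?thesis by (simp add: o_def)
    qed
    then have prod: "(\<lambda>t. \<Prod>i<k. 1 / (1 + t\<^sup>2 * x n i)) =
        (\<lambda>t. \<Prod>x\<leftarrow>map (x n) [0..<k]. 1 / (1 + t\<^sup>2 * x))" by (rule ext)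
    show ?thesis unfolding prod
    proof (rule kernel_product_integrals[OF \<mu>, of e])
      show "distinct (map (x n) [0..<k])"
        using inj[of n] by (simp add: distinct_map lessThan_atLeast0)
      show "0 < y \<and> y < e" if "y \<in> set (map (x n) [0..<k])" for y
        using that xpos xlt by auto
    qed (fact eq)
  qed
  then show ?thesis using lim[OF \<mu>(1)] lim[OF \<mu>(2)] by (intro LIMSEQ_unique[OF lim[OF \<mu>(1)]]) simp
qed

text \<open>For a symmetric distribution the characteristic function is the integral of a function of \<open>\<bar>t\<bar>\<close>, and \<open>\<bar>t\<bar>\<close> can be
  recovered from any injective function of \<open>t\<^sup>2\<close>.\<close>

lemma symmetric_char:
  assumes "symmetric_distribution \<mu>"
  shows "char \<mu> \<xi> = (\<integral>t. complex_of_real (cos (\<xi> * \<bar>t\<bar>)) \<partial>\<mu>)"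
proof -
  interpret real_distribution \<mu> using assms by (simp add: symmetric_distribution_def)
  have int: "integrable \<mu> (\<lambda>t. iexp (\<xi> * t))" "integrable \<mu> (\<lambda>t. iexp (\<xi> * (- t)))"
    by (auto intro!: integrable_const_bound[where B = 1] simp: norm_exp_i_times[of "_ * _", simplified])
  have "char \<mu> \<xi> = (\<integral>t. iexp (\<xi> * t) \<partial>distr \<mu> borel uminus)"
    using assms by (simp add: char_def symmetric_distribution_def)
  also have "\<dots> = (\<integral>t. iexp (\<xi> * (- t)) \<partial>\<mu>)" by (subst integral_distr) auto
  finally have "2 * char \<mu> \<xi> = (\<integral>t. iexp (\<xi> * t) + iexp (\<xi> * (- t)) \<partial>\<mu>)"
    using int by (simp add: char_def)
  also have "\<dots> = (\<integral>t. 2 * complex_of_real (cos (\<xi> * \<bar>t\<bar>)) \<partial>\<mu>)"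
  proof (intro Bochner_Integration.integral_cong refl)
    fix t
    have "cos (\<xi> * \<bar>t\<bar>) = cos (\<xi> * t)" by (cases "t \<ge> 0") auto
    then show "iexp (\<xi> * t) + iexp (\<xi> * (- t)) = 2 * complex_of_real (cos (\<xi> * \<bar>t\<bar>))"
      by (simp add: complex_eq_iff Re_exp Im_exp)
  qed
  finally show ?thesis by simp
qed

lemma rect_M_determines_symmetric:
  assumes \<mu>: "symmetric_distribution \<mu>" "symmetric_distribution \<nu>"
    and eq: "eventually (\<lambda>w. rect_M \<mu> w = rect_M \<nu> w) (at_left 0)"
  shows "\<mu> = \<nu>"
proof -
  have rd: "real_distribution \<mu>" "real_distribution \<nu>" using \<mu> by (auto simp: symmetric_distribution_def)
  interpret \<mu>: real_distribution \<mu> by fact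
  interpret \<nu>: real_distribution \<nu> by fact
  obtain b where b: "b < 0" "\<And>w. b < w \<Longrightarrow> w < 0 \<Longrightarrow> rect_M \<mu> w = rect_M \<nu> w"
    using eq unfolding eventually_at_left_field by auto
  define e where "e = - b"
  have e: "0 < e" using b by (simp add: e_def)
  have res: "resolvent \<mu> (- x) = resolvent \<nu> (- x)" if "0 < x" "x < e" for x
    using b(2)[of "- x"] that \<mu>.rect_M_eq_resolvent[of "- x"] \<nu>.rect_M_eq_resolvent[of "- x"]
    by (simp add: e_def)
  define v where "v t = 1 / (1 + t\<^sup>2 * (e / 2))" for t :: real
  have v [measurable]: "v \<in> borel_measurable borel" unfolding v_def by measurable
  have vb: "0 < v t" "v t \<le> 1" for t using e by (auto simp: v_def divide_le_eq_1 intro!: add_pos_nonneg)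
  have D: "distr \<mu> borel v = distr \<nu> borel v"
  proof (rule bounded_moments_determine_distribution)
    show "real_distribution (distr \<mu> borel v)" "real_distribution (distr \<nu> borel v)"
      by (auto intro!: \<mu>.real_distribution_distr \<nu>.real_distribution_distr)
    have "AE x in distr M borel v. \<bar>x\<bar> \<le> 1" if "sets M = sets borel" for M
      using vb that by (subst AE_distr_iff) (auto simp: abs_le_iff less_imp_le order_trans[of _ 0] intro!: AE_I2
          cong: measurable_cong_sets)
    then show "AE x in distr \<mu> borel v. \<bar>x\<bar> \<le> 1" "AE x in distr \<nu> borel v. \<bar>x\<bar> \<le> 1" by auto
    show "(\<integral>x. x ^ k \<partial>distr \<mu> borel v) = (\<integral>x. x ^ k \<partial>distr \<nu> borel v)" for k
      using kernel_power_integrals[OF rd e res, of k]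
      by (simp add: integral_distr) (simp add: v_def)
  qed
  define h where "h \<xi> y = complex_of_real (cos (\<xi> * sqrt ((1 / y - 1) / (e / 2))))" for \<xi> y
  have hv: "complex_of_real (cos (\<xi> * \<bar>t\<bar>)) = h \<xi> (v t)" for \<xi> t
  proof -
    have "1 / v t - 1 = t\<^sup>2 * (e / 2)" by (simp add: v_def)
    then have "sqrt ((1 / v t - 1) / (e / 2)) = \<bar>t\<bar>" using e by simp
    then show ?thesis by (simp add: h_def)
  qed
  have [measurable]: "h \<xi> \<in> borel_measurable borel" for \<xi> unfolding h_def by measurable
  show ?thesis
  proof (rule Levy_uniqueness[OF rd], rule ext)
    fix \<xi>
    have "char \<mu> \<xi> = (\<integral>y. h \<xi> y \<partial>distr \<mu> borel v)"
      unfolding symmetric_char[OF \<mu>(1)] hv by (subst integral_distr) auto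
    also have "\<dots> = char \<nu> \<xi>"
      unfolding D symmetric_char[OF \<mu>(2)] hv by (subst integral_distr) auto
    finally show "char \<mu> \<xi> = char \<nu> \<xi>" .
  qed
qed

theorem rect_R_determines_symmetric:
  assumes "symmetric_distribution \<mu>" "symmetric_distribution \<nu>" "0 < lam" "lam \<le> 1"
    and "eventually (\<lambda>z. rect_R lam \<mu> z = rect_R lam \<nu> z) (at_left 0)"
  shows "\<mu> = \<nu>"
  using assms by (intro rect_M_determines_symmetric rect_R_determines_rect_M)
    (auto simp: symmetric_distribution_def)

text \<open>Uniqueness makes the definite description in the definition of the convolution meaningful.\<close>

lemma rect_conv_eqI:
  assumes "symmetric_distribution \<rho>" "0 < lam" "lam \<le> 1"
    and "eventually (\<lambda>z. rect_R lam \<rho> z = rect_R lam \<mu> z + rect_R lam \<nu> z) (at_left 0)"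
  shows "rect_conv lam \<mu> \<nu> = \<rho>"
  unfolding rect_conv_def
proof (rule the_equality)
  fix \<rho>' assume r: "symmetric_distribution \<rho>' \<and>
     (\<forall>\<^sub>F z in at_left 0. rect_R lam \<rho>' z = rect_R lam \<mu> z + rect_R lam \<nu> z)"
  then have "eventually (\<lambda>z. rect_R lam \<rho>' z = rect_R lam \<rho> z) (at_left 0)"
    using assms(4) by (auto elim: eventually_elim2)
  then show "\<rho>' = \<rho>" using r assms by (intro rect_R_determines_symmetric) auto
qed (use assms in auto)

lemma weak_limit_symmetric:
  assumes M: "\<And>n. symmetric_distribution (M n)" and \<mu>: "real_distribution \<mu>" and w: "weak_conv_m M \<mu>"
  shows "symmetric_distribution \<mu>"
proof -
  interpret real_distribution \<mu> by fact
  have rd: "real_distribution (M n)" for n using M by (simp add: symmetric_distribution_def)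
  have neg: "char (distr N borel uminus) t = char N (- t)" if "real_distribution N" for N t
  proof -
    interpret N: real_distribution N by fact
    show ?thesis by (simp add: char_def integral_distr)
  qed
  have "distr \<mu> borel uminus = \<mu>"
  proof (rule Levy_uniqueness)
    show "real_distribution (distr \<mu> borel uminus)" by (rule real_distribution_distr) auto
    show "char (distr \<mu> borel uminus) = char \<mu>"
    proof
      fix t
      have "char (M n) (- t) = char (M n) t" for n
        using neg[OF rd, of n t] M[of n] by (simp add: symmetric_distribution_def)
      then show "char (distr \<mu> borel uminus) t = char \<mu> t"
        using levy_continuity1[OF rd \<mu> w, of t] levy_continuity1[OF rd \<mu> w, of "- t"]
        by (simp add: neg[OF \<mu>] LIMSEQ_unique)
    qed
  qed fact
  then show ?thesis using \<mu> by (simp add: symmetric_distribution_def)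
qed

lemma weak_limit_rect_M:
  assumes M: "\<And>n. real_distribution (M n)" and \<mu>: "real_distribution \<mu>" and w: "weak_conv_m M \<mu>" and z: "z \<le> 0"
  shows "(\<lambda>n. rect_M (M n) z) \<longlonglongrightarrow> rect_M \<mu> z"
proof -
  have "(\<lambda>n. resolvent (M n) z) \<longlonglongrightarrow> resolvent \<mu> z"
    unfolding resolvent_def
  proof (rule weak_conv_imp_integral_bdd_continuous_conv[OF M \<mu> w])
    show "isCont (\<lambda>t. 1 / (1 - t\<^sup>2 * z)) t" for t
      using denominator_ge_1[OF z, of t] by (intro continuous_intros) auto
    show "norm (1 / (1 - t\<^sup>2 * z)) \<le> 1" for t using kernel_bounds[OF z, of t] by simp
  qed
  then show ?thesis
    using M \<mu> z by (simp add: real_distribution.rect_M_eq_resolvent tendsto_diff)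
qed

section \<open>The integral against the measure of the R-transform\<close>

definition G_atom_weight :: "real \<Rightarrow> enat \<Rightarrow> (nat \<Rightarrow> real) \<Rightarrow> nat \<Rightarrow> real" where
  "G_atom_weight \<sigma> N \<alpha> j = (if j = 0 then \<sigma>\<^sup>2 else if j \<in> index_set N then 1 / ((\<alpha> j)\<^sup>2 + 1) else 0)"

lemma zero_notin_index_set: "0 \<notin> index_set N"
  by (simp add: index_set_def)

text \<open>The integrands of interest are functions of \<open>t\<^sup>2\<close>. The image of the measure under squaring has its
  atoms indexed by the naturals, where the free index \<open>0\<close> carries the mass \<open>\<sigma>\<^sup>2\<close> at zero.\<close>

lemma distr_G_measure_square:
  "distr (G_measure \<sigma> N \<alpha>) borel (\<lambda>t. t\<^sup>2) =
   distr (density (count_space UNIV) (\<lambda>j. ennreal (G_atom_weight \<sigma> N \<alpha> j))) borel (inv_sq N \<alpha>)"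
proof (rule measure_eqI)
  fix B assume "B \<in> sets (distr (G_measure \<sigma> N \<alpha>) borel (\<lambda>t. t\<^sup>2))"
  then have B: "B \<in> sets borel" by simp
  let ?A = "(\<lambda>t::real. t\<^sup>2) -` B"
  have meas: "(\<lambda>t::real. t\<^sup>2) \<in> borel_measurable borel" by measurable
  have A: "?A \<in> sets borel" using measurable_sets_borel[OF meas B] .
  have sp: "space (G_measure \<sigma> N \<alpha>) = UNIV"
    using sets_eq_imp_space_eq[OF sets_G_measure] by simp
  let ?w = "\<lambda>j. ennreal (G_atom_weight \<sigma> N \<alpha> j) * indicator B (inv_sq N \<alpha> j)"
  let ?h = "\<lambda>j. if j \<in> index_set N
           then ennreal (1 / ((\<alpha> j)\<^sup>2 + 1) * (1 / 2)) *
             (emeasure (return borel (1 / \<alpha> j)) ?A + emeasure (return borel (- 1 / \<alpha> j)) ?A)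
           else 0"
  have "emeasure (distr (G_measure \<sigma> N \<alpha>) borel (\<lambda>t. t\<^sup>2)) B = emeasure (G_measure \<sigma> N \<alpha>) ?A"
    using B meas by (subst emeasure_distr) (auto simp: sp cong: measurable_cong_sets)
  also have "\<dots> = ennreal (\<sigma>\<^sup>2) * emeasure (return borel 0) ?A + (\<Sum>j. ?h j)"
    by (rule emeasure_G_measure[OF A])
  also have "ennreal (\<sigma>\<^sup>2) * emeasure (return borel 0) ?A = (\<Sum>j. if j = 0 then ?w 0 else 0)"
    using A by (subst suminf_finite[of "{0}"])
      (auto simp: G_atom_weight_def inv_sq_def zero_notin_index_set indicator_def)
  also have "(\<Sum>j. if j = 0 then ?w 0 else 0) + (\<Sum>j. ?h j) = (\<Sum>j. (if j = 0 then ?w 0 else 0) + ?h j)"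
    by (rule suminf_add) auto
  also have "\<dots> = (\<Sum>j. ?w j)"
  proof (rule suminf_cong)
    fix j
    show "(if j = 0 then ?w 0 else 0) + ?h j = ?w j"
    proof (cases "j \<in> index_set N")
      case True
      then have j: "j \<noteq> 0" by (simp add: index_set_def)
      have ind: "emeasure (return borel (1 / \<alpha> j)) ?A = indicator B (inv_sq N \<alpha> j)"
        "emeasure (return borel (- 1 / \<alpha> j)) ?A = indicator B (inv_sq N \<alpha> j)"
        using A True by (auto simp: indicator_def inv_sq_def power_divide)
      have "ennreal (w * (1 / 2)) * (x + x) = ennreal w * x" if "0 \<le> w" for x and w :: real
      proof -
        have "ennreal (w * (1 / 2)) * (x + x) = (ennreal (w * (1 / 2)) + ennreal (w * (1 / 2))) * x"
          by (simp add: ring_distribs)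
        also have "ennreal (w * (1 / 2)) + ennreal (w * (1 / 2)) = ennreal (w * (1 / 2) + w * (1 / 2))"
          using that by (intro ennreal_plus[symmetric]) auto
        finally show ?thesis by simp
      qed
      from this[of "1 / ((\<alpha> j)\<^sup>2 + 1)"]
      have "ennreal (1 / ((\<alpha> j)\<^sup>2 + 1) * (1 / 2)) * (x + x) = ennreal (1 / ((\<alpha> j)\<^sup>2 + 1)) * x" for x
        by simp
      then show ?thesis using True j unfolding ind by (simp add: G_atom_weight_def)
    qed (auto simp: G_atom_weight_def)
  qed
  also have "\<dots> = emeasure (distr (density (count_space UNIV) (\<lambda>j. ennreal (G_atom_weight \<sigma> N \<alpha> j))) borel (inv_sq N \<alpha>)) B"
    using B by (simp add: emeasure_distr emeasure_density nn_integral_count_space_nat indicator_def of_bool_def)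
  finally show "emeasure (distr (G_measure \<sigma> N \<alpha>) borel (\<lambda>t. t\<^sup>2)) B = \<dots>" .
qed simp

lemma geometric_term_sums:
  fixes x :: real
  assumes "\<bar>x\<bar> < 1"
  shows "(\<lambda>k. x ^ Suc k) sums (x / (1 - x))"
  using sums_mult[OF geometric_sums[of x], of x] assms by simp

text \<open>The weight \<open>1/(\<alpha>\<^sup>2 + 1)\<close> cancels the numerator, and an atom contributes \<open>a/(1 - z a)\<close> with
  \<open>a = 1/\<alpha>\<^sup>2\<close>. Expanding in geometric series and summing over the atoms first gives the power sums.\<close>

lemma G_measure_integral:
  assumes \<alpha>: "\<And>j. j \<in> index_set N \<Longrightarrow> \<alpha> j \<noteq> 0" and summ: "summable (inv_sq N \<alpha>)"
    and z: "z \<le> 0" "(\<sigma>\<^sup>2 + suminf (inv_sq N \<alpha>)) * \<bar>z\<bar> < 1"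
  shows "(\<lambda>k. fps_nth (LP_cumulant_fps \<sigma> N \<alpha>) (Suc k) * z ^ Suc k) sums
    (z * (\<integral>t. (t\<^sup>2 + 1) / (1 - z * t\<^sup>2) \<partial>G_measure \<sigma> N \<alpha>))"
proof -
  define a where "a = inv_sq N \<alpha>"
  define S where "S = suminf a"
  have a0: "0 \<le> a j" for j by (simp add: a_def inv_sq_nonneg)
  have summ_a: "summable a" using summ by (simp add: a_def)
  have S0: "0 \<le> S" unfolding S_def by (intro suminf_nonneg summ_a a0)
  have Sz: "S * \<bar>z\<bar> < 1"
  proof -
    have "S * \<bar>z\<bar> \<le> (\<sigma>\<^sup>2 + S) * \<bar>z\<bar>" by (intro mult_right_mono) auto
    then show ?thesis using z(2) by (simp add: S_def a_def)
  qed
  have aS: "a j \<le> S" for j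
    unfolding S_def using sum_le_suminf[OF summ_a, of "{j}"] a0 by simp
  have den: "1 - z * a j \<ge> 1" for j using z(1) a0[of j] by (simp add: mult_nonpos_nonneg)
  define b where "b j = a j / (1 - z * a j)" for j
  have b: "0 \<le> b j" "b j \<le> a j" for j
    using den[of j] a0[of j] by (auto simp: b_def divide_le_eq mult_right_mono mult_le_cancel_left1)
  have summ_b: "summable b"
    by (rule summable_comparison_test'[OF summ_a]) (use b in auto)
  define h where "h x = (x + 1) / (1 - z * x)" for x :: real
  have [measurable]: "h \<in> borel_measurable borel" unfolding h_def by measurable
  have [measurable]: "(\<lambda>t::real. t\<^sup>2) \<in> borel_measurable (G_measure \<sigma> N \<alpha>)"
    using sets_G_measure[of \<sigma> N \<alpha>] by (auto cong: measurable_cong_sets)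
  have wh: "G_atom_weight \<sigma> N \<alpha> j * h (inv_sq N \<alpha> j) = (if j = 0 then \<sigma>\<^sup>2 else 0) + b j" for j
  proof (cases "j \<in> index_set N")
    case True
    then have j: "j \<noteq> 0" by (simp add: index_set_def)
    have aj: "a j = 1 / (\<alpha> j)\<^sup>2" using True by (simp add: a_def inv_sq_def)
    have frac: "1 / (x + 1) * (1 / x + 1) = 1 / x" if "0 < x" for x :: real
    proof -
      have "1 / x + 1 = (x + 1) / x" "x + 1 \<noteq> 0" using that by (auto simp: field_simps)
      then show ?thesis by simp
    qed
    have "(\<alpha> j)\<^sup>2 > 0" using \<alpha>[OF True] by simp
    then have "1 / ((\<alpha> j)\<^sup>2 + 1) * (a j + 1) = a j"
      unfolding aj using frac by blast
    then show ?thesis using True j by (simp add: G_atom_weight_def h_def b_def a_def)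
  qed (auto simp: G_atom_weight_def h_def b_def a_def inv_sq_def)
  have summ_wh: "summable (\<lambda>j. (if j = 0 then \<sigma>\<^sup>2 else 0) + b j)"
    by (intro summable_add summ_b) (auto intro: summable_finite[of "{0}"])
  have "(\<integral>t. (t\<^sup>2 + 1) / (1 - z * t\<^sup>2) \<partial>G_measure \<sigma> N \<alpha>) = (\<integral>x. h x \<partial>distr (G_measure \<sigma> N \<alpha>) borel (\<lambda>t. t\<^sup>2))"
    by (subst integral_distr) (auto simp: h_def)
  also have "\<dots> = (\<integral>j. h (inv_sq N \<alpha> j) \<partial>density (count_space UNIV) (\<lambda>j. ennreal (G_atom_weight \<sigma> N \<alpha> j)))"
    unfolding distr_G_measure_square by (subst integral_distr) auto
  also have "\<dots> = (\<integral>j. G_atom_weight \<sigma> N \<alpha> j * h (inv_sq N \<alpha> j) \<partial>count_space UNIV)"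
    by (subst integral_density) (auto simp: G_atom_weight_def)
  also have "\<dots> = (\<Sum>j. (if j = 0 then \<sigma>\<^sup>2 else 0) + b j)"
    unfolding wh using summ_wh b by (intro integral_count_space_nat) (auto simp: integrable_count_space_nat_iff)
  also have "\<dots> = (\<Sum>j. if j = (0::nat) then \<sigma>\<^sup>2 else 0) + suminf b"
    by (intro suminf_add[symmetric] summ_b) (auto intro: summable_finite[of "{0}"])
  also have "(\<Sum>j. if j = (0::nat) then \<sigma>\<^sup>2 else 0) = \<sigma>\<^sup>2"
    by (subst suminf_finite[of "{0}"]) auto
  finally have int: "(\<integral>t. (t\<^sup>2 + 1) / (1 - z * t\<^sup>2) \<partial>G_measure \<sigma> N \<alpha>) = \<sigma>\<^sup>2 + suminf b" .
  define A where "A k m = (\<Sum>j<m. a j ^ Suc k) * z ^ Suc k" for k m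
  have powS: "(\<Sum>j<m. a j ^ Suc k) \<le> S ^ Suc k" for k m
  proof -
    have "(\<Sum>j<m. a j ^ Suc k) \<le> (\<Sum>j<m. a j) ^ Suc k"
      by (rule power_sum_le_sum_power) (auto simp: a0)
    also have "\<dots> \<le> S ^ Suc k"
      unfolding S_def by (intro power_mono sum_le_suminf summ_a sum_nonneg) (auto simp: a0)
    finally show ?thesis .
  qed
  have A_sums: "(\<lambda>k. A k m) sums (\<Sum>j<m. z * b j)" for m
  proof -
    have "(\<lambda>k. \<Sum>j<m. (z * a j) ^ Suc k) sums (\<Sum>j<m. (z * a j) / (1 - z * a j))"
    proof (intro sums_sum geometric_term_sums)
      fix j
      have "\<bar>z * a j\<bar> \<le> S * \<bar>z\<bar>" using aS[of j] a0[of j] by (simp add: abs_mult mult.commute[of S] mult_left_mono)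
      then show "\<bar>z * a j\<bar> < 1" using Sz by linarith
    qed
    moreover have "(\<Sum>j<m. (z * a j) ^ Suc k) = A k m" for k
      unfolding A_def sum_distrib_right by (intro sum.cong refl) (simp only: power_mult_distrib mult.commute)
    ultimately show ?thesis by (simp add: b_def)
  qed
  have "eventually (\<lambda>m. summable (\<lambda>k. norm (A k m))) sequentially \<and>
           summable (\<lambda>k. norm ((\<Sum>j. a j ^ Suc k) * z ^ Suc k)) \<and>
           ((\<lambda>m. suminf (\<lambda>k. A k m)) \<longlongrightarrow> (\<Sum>k. (\<Sum>j. a j ^ Suc k) * z ^ Suc k)) sequentially"
  proof (rule tannerys_theorem)
    show "(\<lambda>m. A k m) \<longlonglongrightarrow> (\<Sum>j. a j ^ Suc k) * z ^ Suc k" for k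
      unfolding A_def a_def by (intro tendsto_intros summable_LIMSEQ LP_cumulant_bounds(3)[OF summ]) auto
    have "norm (A k m) \<le> (S * \<bar>z\<bar>) ^ Suc k" for k m
    proof -
      have nonneg: "0 \<le> (\<Sum>j<m. a j ^ Suc k)" by (intro sum_nonneg zero_le_power a0)
      have "norm (A k m) = (\<Sum>j<m. a j ^ Suc k) * \<bar>z\<bar> ^ Suc k"
        unfolding A_def real_norm_def by (simp only: abs_mult power_abs abs_of_nonneg[OF nonneg])
      also have "\<dots> \<le> S ^ Suc k * \<bar>z\<bar> ^ Suc k" by (intro mult_right_mono powS) auto
      finally show ?thesis by (simp only: power_mult_distrib)
    qed
    then show "eventually (\<lambda>(k, m). norm (A k m) \<le> (S * \<bar>z\<bar>) ^ Suc k) (at_top \<times>\<^sub>F sequentially)"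
      by (intro always_eventually) auto
    show "summable (\<lambda>k. (S * \<bar>z\<bar>) ^ Suc k)"
      using sums_summable[OF geometric_term_sums[of "S * \<bar>z\<bar>"]] Sz S0 by auto
  qed simp
  then have summ_lim: "summable (\<lambda>k. (\<Sum>j. a j ^ Suc k) * z ^ Suc k)"
    and lim: "(\<lambda>m. suminf (\<lambda>k. A k m)) \<longlonglongrightarrow> (\<Sum>k. (\<Sum>j. a j ^ Suc k) * z ^ Suc k)"
    by (auto intro: summable_norm_cancel)
  have "(\<lambda>m. suminf (\<lambda>k. A k m)) \<longlonglongrightarrow> z * suminf b"
    unfolding sums_unique[OF A_sums, symmetric] sum_distrib_left[symmetric]
    by (intro tendsto_intros summable_LIMSEQ summ_b)
  with lim have "(\<Sum>k. (\<Sum>j. a j ^ Suc k) * z ^ Suc k) = z * suminf b" by (rule LIMSEQ_unique)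
  with summ_lim have s1: "(\<lambda>k. (\<Sum>j. a j ^ Suc k) * z ^ Suc k) sums (z * suminf b)"
    by (metis summable_sums)
  have "(\<lambda>k. if k = 0 then \<sigma>\<^sup>2 * z else 0) sums (\<sigma>\<^sup>2 * z)" by (rule sums_single)
  from sums_add[OF this s1] have "(\<lambda>k. (if k = 0 then \<sigma>\<^sup>2 * z else 0) + (\<Sum>j. a j ^ Suc k) * z ^ Suc k) sums (z * (\<sigma>\<^sup>2 + suminf b))"
    by (simp add: algebra_simps)
  moreover have "(if k = 0 then \<sigma>\<^sup>2 * z else 0) + (\<Sum>j. a j ^ Suc k) * z ^ Suc k =
     fps_nth (LP_cumulant_fps \<sigma> N \<alpha>) (Suc k) * z ^ Suc k" for k
    by (simp add: LP_cumulant_fps_def a_def algebra_simps)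
  ultimately show ?thesis unfolding int by simp
qed

section \<open>Convergence and infinite divisibility\<close>

text \<open>The number \<open>m d\<close> of applications of \<open>g(T)\<close> is allowed to grow like \<open>\<tau> d\<close>, which multiplies the
  R-transform by \<open>\<tau>\<close>. The case \<open>\<tau> = 1\<close> is the convergence statement; the cases \<open>\<tau> = p/k\<close> supply the
  measures that are needed for infinite divisibility, even though \<open>g\<close> to the power \<open>1/k\<close> may fail to
  preserve real roots. The root measures are tight, and every subsequential limit has the same
  \<open>rect_M\<close> near zero, namely the sum of the limiting moment series.\<close>

lemma power_sequence_limit:
  fixes \<sigma> lam \<tau> :: real and N :: enat and \<alpha> n :: "nat \<Rightarrow> real" and m :: "nat \<Rightarrow> nat"
  assumes \<alpha>: "\<And>j. j \<in> index_set N \<Longrightarrow> \<alpha> j \<noteq> 0" and summ: "summable (inv_sq N \<alpha>)"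
    and n: "\<And>d. d \<ge> 1 \<Longrightarrow> n d > -1"
    and ratio: "(\<lambda>d. real d / (n d + real d)) \<longlonglongrightarrow> lam" and lam: "0 < lam" "lam \<le> 1"
    and m: "(\<lambda>d. real (m d) / real d) \<longlonglongrightarrow> \<tau>" "0 \<le> \<tau>"
  defines "P \<equiv> \<lambda>d. (fps_op (taylor_fps (LP_fun \<sigma> N \<alpha>)) (scaled_op (1 / (real d * (n d + real d))) (n d)) ^^ m d) (monom 1 d)"
  shows "\<exists>\<mu>. symmetric_distribution \<mu> \<and>
     (\<forall>\<^sub>F z in at_left 0. rect_R lam \<mu> z =
        \<tau> * (z * (\<integral>t. (t\<^sup>2 + 1) / (1 - z * t\<^sup>2) \<partial>G_measure \<sigma> N \<alpha>))) \<and>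
     weak_conv_m (\<lambda>d. sqrt_measure (root_measure (P d))) \<mu>"
proof -
  let ?F = "taylor_fps (LP_fun \<sigma> N \<alpha>)" and ?C = "LP_cumulant_fps \<sigma> N \<alpha>"
  have F: "has_log_deriv ?F ?C" by (rule LP_fun_taylor(1)[OF summ])
  have C0: "fps_nth ?C 0 = 0" by (simp add: LP_cumulant_fps_def)
  have "\<exists>ys. (\<forall>y\<in>set ys. 0 \<le> y) \<and> P (Suc d) = (\<Prod>y\<leftarrow>ys. [:-y, 1:])" for d
    unfolding nonneg_roots_def[symmetric] P_def
    by (rule nonneg_roots_LP_op_funpow[OF summ]) (use n[of "Suc d"] in auto)
  then obtain ys where ys: "\<And>d y. y \<in> set (ys d) \<Longrightarrow> 0 \<le> y" "\<And>d. P (Suc d) = (\<Prod>y\<leftarrow>ys d. [:-y, 1:])"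
    by metis
  have P: "fps_op (?F ^ m (Suc d)) (scaled_op (1 / (real (Suc d) * (n (Suc d) + real (Suc d)))) (n (Suc d))) (monom 1 (Suc d))
      = (\<Prod>y\<leftarrow>ys d. [:-y, 1:])" for d
    using ys(2)[of d] by (simp only: P_def fps_op_power)
  have n': "n (Suc d) > -1" for d using n by simp
  have len: "length (ys d) = Suc d" for d
    by (rule root_moment_equation(1)[OF F C0 _ n' P]) simp
  then have ne: "ys d \<noteq> []" for d by (metis list.size(3) nat.distinct(1))
  let ?M = "\<lambda>d. moment_fps (ys d)"
  have meq: "fps_nth (?M d) k = (real (m (Suc d)) / real (Suc d)) * (\<Sum>j=1..k. fps_nth ?C j *
      fps_nth ((conj_twist (real (Suc d)) (1 / real (Suc d)) (1 / (n (Suc d) + real (Suc d))) (?M d) ^^ j) 1) k)" for d k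
    by (rule root_moment_equation(2)[OF F C0 _ n' P]) simp
  have a: "(\<lambda>d. 1 / real (Suc d)) \<longlonglongrightarrow> 0"
    using LIMSEQ_inverse_real_of_nat by (simp add: inverse_eq_divide)
  have rb: "(\<lambda>d. real (Suc d) * (1 / (n (Suc d) + real (Suc d)))) \<longlonglongrightarrow> lam"
    using LIMSEQ_Suc[OF ratio] by simp
  have b: "(\<lambda>d. 1 / (n (Suc d) + real (Suc d))) \<longlonglongrightarrow> 0"
  proof -
    have "(\<lambda>d. real (Suc d) * (1 / (n (Suc d) + real (Suc d))) * (1 / real (Suc d))) \<longlonglongrightarrow> lam * 0"
      by (intro tendsto_mult rb a)
    then show ?thesis by simp
  qed
  have ra: "(\<lambda>d. real (Suc d) * (1 / real (Suc d))) \<longlonglongrightarrow> 1"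
    by (rule Lim_transform_eventually[OF tendsto_const]) (auto intro: always_eventually)
  obtain L where L: "conv_to ?M L" "fps_nth L 0 = 0"
    "\<And>k. fps_nth L k = \<tau> * (\<Sum>j=1..k. fps_nth ?C j *
        fps_nth ((fps_X * (1 + L) * (1 + fps_const lam * L)) ^ j) k)"
    using moments_converge[OF meq a b LIMSEQ_Suc[OF m(1)] ra rb] by blast
  define C' where "C' = fps_const \<tau> * ?C"
  have rec: "fps_nth L k = (\<Sum>j=1..k. fps_nth C' j *
        fps_nth ((fps_X * (1 + L) * (1 + fps_const lam * L)) ^ j) k)" for k
    by (subst L(3)) (simp add: C'_def sum_distrib_left mult.assoc)
  define s where "s = \<sigma>\<^sup>2 + suminf (inv_sq N \<alpha>)"
  have s: "0 \<le> s" unfolding s_def by (intro add_nonneg_nonneg suminf_nonneg summ inv_sq_nonneg) simp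
  \<comment> \<open>Both factors are at least \<open>1\<close>, so that \<open>\<tau> s\<^sup>j \<le> s'\<^sup>j\<close> for all \<open>j \<ge> 1\<close> and \<open>s' > 0\<close>.\<close>
  define s' where "s' = (\<tau> + 1) * (s + 1)"
  have s': "0 < s'" using s m(2) by (simp add: s'_def)
  have C'0: "0 \<le> fps_nth C' j" for j using m(2) LP_cumulant_bounds(1)[OF summ] by (simp add: C'_def)
  have C's: "fps_nth C' j \<le> s' ^ j" for j
  proof (cases "j = 0")
    case False
    have "\<tau> * fps_nth ?C j \<le> (\<tau> + 1) ^ j * (s + 1) ^ j"
    proof (intro mult_mono)
      have "(\<tau> + 1) ^ 1 \<le> (\<tau> + 1) ^ j" using m(2) False by (intro power_increasing) auto
      then show "\<tau> \<le> (\<tau> + 1) ^ j" by simp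
      have "fps_nth ?C j \<le> s ^ j" unfolding s_def by (rule LP_cumulant_bounds(2)[OF summ])
      also have "\<dots> \<le> (s + 1) ^ j" using s by (intro power_mono) auto
      finally show "fps_nth ?C j \<le> (s + 1) ^ j" .
    qed (use m(2) LP_cumulant_bounds(1)[OF summ] in auto)
    then show ?thesis by (simp add: C'_def s'_def power_mult_distrib)
  qed (simp add: C'_def C0)
  have L0: "0 \<le> fps_nth L k" for k
  proof (rule LIMSEQ_le_const)
    show "(\<lambda>d. fps_nth (?M d) k) \<longlonglongrightarrow> fps_nth L k" using L(1) by (simp add: conv_to_def)
    have "0 \<le> fps_nth (?M d) k" for d
      using ys(1) by (auto simp: moment_fps_def intro!: divide_nonneg_nonneg sum_list_nonneg)
    then show "\<exists>N. \<forall>d\<ge>N. 0 \<le> fps_nth (?M d) k" by blast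
  qed
  define r where "r = 8 * s'"
  have r: "0 < r" using s' by (simp add: r_def)
  have Lr: "fps_nth L k \<le> r ^ k" for k
    unfolding r_def by (rule moment_growth[OF L0 L(2) rec C'0 C's s']) (use lam in auto)
  define f where "f z = eval_fps L z" for z
  have fe: "(\<lambda>k. fps_nth L k * z ^ k) sums f z"
    "(\<lambda>j. fps_nth C' (Suc j) * (z * (1 + f z) * (1 + lam * f z)) ^ Suc j) sums f z" if "r * \<bar>z\<bar> < 1" for z
    unfolding f_def by (rule moment_functional_equation[OF L0 L(2) Lr rec C'0 _ that r]; use lam in simp)+
  define \<nu> where "\<nu> d = sym_root_measure (ys d)" for d
  have \<nu>: "symmetric_distribution (\<nu> d)" "real_distribution (\<nu> d)" for d
    using symmetric_sym_root_measure[OF ne] by (auto simp: \<nu>_def symmetric_distribution_def)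
  have limit_M: "rect_M \<rho> z = f z"
    if q: "strict_mono q" "real_distribution \<rho>" "weak_conv_m (\<nu> \<circ> q) \<rho>" and z: "z \<le> 0" "r * \<bar>z\<bar> < 1" for q \<rho> z
  proof -
    have lim: "(\<lambda>i. rect_M (\<nu> (q i)) z) \<longlonglongrightarrow> rect_M \<rho> z"
      using weak_limit_rect_M[OF _ q(2,3) z(1)] \<nu> by simp
    have Lq: "(\<lambda>i. fps_nth (?M (q i)) k) \<longlonglongrightarrow> fps_nth L k" for k
      using LIMSEQ_subseq_LIMSEQ[OF _ q(1), of "\<lambda>d. fps_nth (?M d) k"] L(1) by (simp add: conv_to_def o_def)
    have "\<bar>rect_M \<rho> z - (\<Sum>k\<le>K. fps_nth L k * z ^ k)\<bar> \<le> (r * \<bar>z\<bar>) ^ Suc K" for K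
    proof -
      have "\<bar>rect_M \<rho> z - (\<Sum>k\<le>K. fps_nth L k * z ^ k)\<bar> \<le> fps_nth L (Suc K) * \<bar>z\<bar> ^ Suc K"
      proof (rule LIMSEQ_le)
        show "(\<lambda>i. \<bar>rect_M (\<nu> (q i)) z - (\<Sum>k\<le>K. fps_nth (?M (q i)) k * z ^ k)\<bar>) \<longlonglongrightarrow>
            \<bar>rect_M \<rho> z - (\<Sum>k\<le>K. fps_nth L k * z ^ k)\<bar>"
          by (intro tendsto_intros lim Lq)
        show "(\<lambda>i. fps_nth (?M (q i)) (Suc K) * \<bar>z\<bar> ^ Suc K) \<longlonglongrightarrow> fps_nth L (Suc K) * \<bar>z\<bar> ^ Suc K"
          by (intro tendsto_intros Lq)
        show "\<exists>N. \<forall>i\<ge>N. \<bar>rect_M (\<nu> (q i)) z - (\<Sum>k\<le>K. fps_nth (?M (q i)) k * z ^ k)\<bar> \<le>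
            fps_nth (?M (q i)) (Suc K) * \<bar>z\<bar> ^ Suc K"
          unfolding \<nu>_def
          by (intro exI allI impI rect_M_sym_root_measure_approx[OF ne _ z(1)]) (rule ys(1))
      qed
      also have "\<dots> \<le> r ^ Suc K * \<bar>z\<bar> ^ Suc K" by (intro mult_right_mono Lr) auto
      finally show ?thesis by (simp only: power_mult_distrib)
    qed
    moreover have "(\<lambda>K. (r * \<bar>z\<bar>) ^ Suc K) \<longlonglongrightarrow> 0"
      using z(2) r by (intro LIMSEQ_Suc LIMSEQ_power_zero) simp
    moreover have "(\<lambda>K. \<bar>rect_M \<rho> z - (\<Sum>k\<le>K. fps_nth L k * z ^ k)\<bar>) \<longlonglongrightarrow> \<bar>rect_M \<rho> z - f z\<bar>"
      using fe(1)[OF z(2)] unfolding sums_def_le by (intro tendsto_intros)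
    ultimately have "\<bar>rect_M \<rho> z - f z\<bar> \<le> 0" by (intro LIMSEQ_le) auto
    then show ?thesis by simp
  qed
  have near: "eventually (\<lambda>z. z \<le> 0 \<and> c * \<bar>z\<bar> < 1) (at_left 0)" if "0 \<le> c" for c :: real
  proof (rule eventually_at_leftI[of "- 1 / (c + 1)"])
    show "- 1 / (c + 1) < 0" using that by (simp add: divide_neg_pos)
    fix z assume "z \<in> {- 1 / (c + 1)<..<0}"
    then have z: "z < 0" "\<bar>z\<bar> < 1 / (c + 1)" by auto
    then have "(c + 1) * \<bar>z\<bar> < 1" using that by (simp add: field_simps)
    moreover have "c * \<bar>z\<bar> \<le> (c + 1) * \<bar>z\<bar>" by (intro mult_right_mono) auto
    ultimately show "z \<le> 0 \<and> c * \<bar>z\<bar> < 1" using z by linarith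
  qed
  obtain B where B: "\<And>d. fps_nth (?M d) 1 \<le> B"
  proof -
    have "Bseq (\<lambda>d. fps_nth (?M d) 1)"
      using L(1) by (intro convergent_imp_Bseq) (auto simp: conv_to_def convergent_def)
    then obtain B where "\<And>d. norm (fps_nth (?M d) 1) \<le> B" by (auto simp: Bseq_def)
    then show ?thesis using that[of B] by (metis abs_le_D1 real_norm_def)
  qed
  have tight: "tight \<nu>"
    unfolding \<nu>_def by (rule tight_sym_root_measures[OF ne ys(1) B])
  obtain q \<mu> where q: "strict_mono q" "real_distribution \<mu>" "weak_conv_m (\<nu> \<circ> q) \<mu>"
    using tight_imp_convergent_subsubsequence[OF tight, of id] by (auto simp: strict_mono_def)
  have sym: "symmetric_distribution \<mu>"
    by (rule weak_limit_symmetric[OF _ q(2,3)]) (simp add: \<nu>)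
  have "weak_conv_m \<nu> \<mu>"
  proof (rule tight_subseq_weak_converge[OF \<nu>(2) q(2) tight])
    fix p \<rho> assume p: "strict_mono p" "real_distribution \<rho>" "weak_conv_m (\<nu> \<circ> p) \<rho>"
    have "\<rho> = \<mu>"
    proof (rule rect_M_determines_symmetric[OF _ sym])
      show "symmetric_distribution \<rho>"
        by (rule weak_limit_symmetric[OF _ p(2,3)]) (simp add: \<nu>)
      show "eventually (\<lambda>w. rect_M \<rho> w = rect_M \<mu> w) (at_left 0)"
        using near[OF less_imp_le[OF r]] by eventually_elim (metis limit_M[OF p] limit_M[OF q])
    qed
    then show "weak_conv_m (\<nu> \<circ> p) \<mu>" using p by simp
  qed
  moreover have "sqrt_measure (root_measure (P (Suc d))) = \<nu> d" for d
    unfolding ys(2) \<nu>_def by (rule sqrt_root_measure[OF ne])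
  ultimately have conv: "weak_conv_m (\<lambda>d. sqrt_measure (root_measure (P d))) \<mu>"
    unfolding weak_conv_m_def weak_conv_def by (subst filterlim_sequentially_Suc[symmetric]) simp
  interpret \<mu>: real_distribution \<mu> by fact
  define c where "c h = (\<Sum>j. fps_nth C' (Suc j) * h ^ Suc j)" for h
  have "eventually (\<lambda>z. rect_R lam \<mu> z = c z) (at_left 0)"
  proof (rule \<mu>.rect_R_of_functional_equation[OF lam])
    show "eventually (\<lambda>w. rect_M \<mu> w = c (rect_H lam \<mu> w)) (at_left 0)"
      using near[OF less_imp_le[OF r]]
    proof eventually_elim
      case (elim w)
      then have "rect_M \<mu> w = f w" by (intro limit_M[OF q]) auto
      moreover have "rect_H lam \<mu> w = w * (1 + f w) * (1 + lam * f w)"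
        unfolding rect_H_def calculation by (simp add: algebra_simps)
      ultimately show ?case using sums_unique[OF fe(2)[of w]] elim by (simp only: c_def)
    qed
  qed
  moreover have "eventually (\<lambda>z. c z = \<tau> * (z * (\<integral>t. (t\<^sup>2 + 1) / (1 - z * t\<^sup>2) \<partial>G_measure \<sigma> N \<alpha>))) (at_left 0)"
    using near[OF s]
  proof eventually_elim
    case (elim z)
    have "(\<lambda>k. \<tau> * (fps_nth ?C (Suc k) * z ^ Suc k)) sums
        (\<tau> * (z * (\<integral>t. (t\<^sup>2 + 1) / (1 - z * t\<^sup>2) \<partial>G_measure \<sigma> N \<alpha>)))"
      using elim by (intro sums_mult G_measure_integral \<alpha> summ) (auto simp: s_def)
    from sums_unique[OF this] show ?case unfolding c_def C'_def by (simp add: mult.assoc)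
  qed
  ultimately have "eventually (\<lambda>z. rect_R lam \<mu> z =
      \<tau> * (z * (\<integral>t. (t\<^sup>2 + 1) / (1 - z * t\<^sup>2) \<partial>G_measure \<sigma> N \<alpha>))) (at_left 0)"
    by eventually_elim simp
  then show ?thesis using sym conv by blast
qed

lemma tendsto_mult_div_ratio:
  assumes "k \<ge> 1"
  shows "(\<lambda>d. real (p * (d div k)) / real d) \<longlonglongrightarrow> real p / real k"
proof -
  have "(\<lambda>d. real (d div k) / real d) \<longlonglongrightarrow> 1 / real k"
  proof (rule real_tendsto_sandwich)
    show "\<forall>\<^sub>F d in sequentially. 1 / real k - 1 / real d \<le> real (d div k) / real d"
      using eventually_gt_at_top[of 0]
    proof eventually_elim
      case (elim d)
      have "d \<le> k * (d div k) + k"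
        using mult_div_mod_eq[of k d] mod_less_divisor[of k d] assms by linarith
      then have "real d \<le> real k * real (d div k) + real k" by (metis of_nat_add of_nat_mono of_nat_mult)
      then have "real d / real k - 1 \<le> real (d div k)" using assms by (simp add: field_simps)
      then have "(real d / real k - 1) / real d \<le> real (d div k) / real d" by (intro divide_right_mono) auto
      then show ?case using elim by (simp add: diff_divide_distrib)
    qed
    show "\<forall>\<^sub>F d in sequentially. real (d div k) / real d \<le> 1 / real k"
      using eventually_gt_at_top[of 0]
    proof eventually_elim
      case (elim d)
      have "real (d div k) / real d \<le> (real d / real k) / real d"
      proof (intro divide_right_mono)
        have "real (d div k) * real k \<le> real d"
          by (metis div_times_less_eq_dividend of_nat_mono of_nat_mult)
        then show "real (d div k) \<le> real d / real k" using assms by (simp add: field_simps)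
      qed simp
      then show ?case using elim by simp
    qed
    have "(\<lambda>d. 1 / real k - 1 / real d) \<longlonglongrightarrow> 1 / real k - 0"
      by (intro tendsto_intros lim_1_over_n)
    then show "(\<lambda>d. 1 / real k - 1 / real d) \<longlonglongrightarrow> 1 / real k" by simp
  qed simp
  from tendsto_mult_left[OF this, of "real p"] show ?thesis by simp
qed

text \<open>If all nonnegative rational multiples of \<open>\<Phi>\<close> are R-transforms, the measure with R-transform \<open>\<Phi>/k\<close> is a \<open>k\<close>-th
  root. The intermediate multiples are needed as well, since a convolution is known only once some
  measure with the sum of the R-transforms exists.\<close>

lemma rect_infinitely_divisibleI:
  assumes lam: "0 < lam" "lam \<le> 1"
    and ex: "\<And>p k. k \<ge> 1 \<Longrightarrow> \<exists>\<rho>. symmetric_distribution \<rho> \<and>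
       (\<forall>\<^sub>F z in at_left 0. rect_R lam \<rho> z = (real p / real k) * \<Phi> z)"
    and \<mu>: "symmetric_distribution \<mu>" "\<forall>\<^sub>F z in at_left 0. rect_R lam \<mu> z = \<Phi> z"
  shows "rect_infinitely_divisible lam \<mu>"
  unfolding rect_infinitely_divisible_def
proof (intro conjI allI impI)
  fix k :: nat assume k: "1 \<le> k"
  obtain \<rho> where \<rho>: "symmetric_distribution \<rho>"
    "\<forall>\<^sub>F z in at_left 0. rect_R lam \<rho> z = (real 1 / real k) * \<Phi> z" using ex[OF k, of 1] by blast
  have conv: "symmetric_distribution ((rect_conv lam \<rho> ^^ j) \<rho>) \<and>
    (\<forall>\<^sub>F z in at_left 0. rect_R lam ((rect_conv lam \<rho> ^^ j) \<rho>) z = (real (Suc j) / real k) * \<Phi> z)" for j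
  proof (induction j)
    case (Suc j)
    obtain \<kappa> where \<kappa>: "symmetric_distribution \<kappa>"
      "\<forall>\<^sub>F z in at_left 0. rect_R lam \<kappa> z = (real (Suc (Suc j)) / real k) * \<Phi> z" using ex[OF k] by blast
    have "rect_conv lam \<rho> ((rect_conv lam \<rho> ^^ j) \<rho>) = \<kappa>"
    proof (rule rect_conv_eqI[OF \<kappa>(1) lam])
      show "\<forall>\<^sub>F z in at_left 0. rect_R lam \<kappa> z = rect_R lam \<rho> z + rect_R lam ((rect_conv lam \<rho> ^^ j) \<rho>) z"
        using \<kappa>(2) \<rho>(2) Suc[THEN conjunct2]
        by eventually_elim (simp add: add_divide_distrib algebra_simps)
    qed
    then show ?case using \<kappa> by simp
  qed (use \<rho> in simp)
  have "(rect_conv lam \<rho> ^^ (k - 1)) \<rho> = \<mu>"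
  proof (rule rect_R_determines_symmetric[OF _ \<mu>(1) lam])
    show "\<forall>\<^sub>F z in at_left 0. rect_R lam ((rect_conv lam \<rho> ^^ (k - 1)) \<rho>) z = rect_R lam \<mu> z"
      using conv[of "k - 1", THEN conjunct2] \<mu>(2) by eventually_elim (use k in simp)
  qed (use conv in simp)
  then show "\<exists>\<rho>. symmetric_distribution \<rho> \<and> (rect_conv lam \<rho> ^^ (k - 1)) \<rho> = \<mu>" using \<rho>(1) by blast
qed fact

theorem theorem2p12:
  fixes \<sigma> lam :: real and N :: enat and \<alpha> :: "nat \<Rightarrow> real" and n :: "nat \<Rightarrow> real"
  assumes "\<sigma> \<ge> 0"
    and "\<And>j. j \<in> index_set N \<Longrightarrow> \<alpha> j \<noteq> 0"
    and "(\<lambda>j. 1 / (\<alpha> j)\<^sup>2) summable_on index_set N"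
    and "\<And>d. d \<ge> 1 \<Longrightarrow> n d > -1"
    and "(\<lambda>d. real d / (n d + real d)) \<longlonglongrightarrow> lam"
    and "0 < lam" "lam \<le> 1"
  shows "\<exists>\<mu>. (\<forall>\<nu>. rect_infinitely_divisible lam \<nu> \<and>
        (\<forall>\<^sub>F z in at_left 0. rect_R lam \<nu> z =
           z * (\<integral>t. (t\<^sup>2 + 1) / (1 - z * t\<^sup>2) \<partial>G_measure \<sigma> N \<alpha>)) \<longleftrightarrow> \<nu> = \<mu>) \<and>
      weak_conv_m (\<lambda>d. sqrt_measure (root_measure (L_hat (LP_fun \<sigma> N \<alpha>) (n d) d))) \<mu>"
proof -
  define \<Phi> where "\<Phi> z = z * (\<integral>t. (t\<^sup>2 + 1) / (1 - z * t\<^sup>2) \<partial>G_measure \<sigma> N \<alpha>)" for z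
  have summ: "summable (inv_sq N \<alpha>)" by (rule summable_inv_sq[OF assms(3)])
  have limit: "\<exists>\<mu>. symmetric_distribution \<mu> \<and>
     (\<forall>\<^sub>F z in at_left 0. rect_R lam \<mu> z = \<tau> * \<Phi> z) \<and>
     weak_conv_m (\<lambda>d. sqrt_measure (root_measure ((fps_op (taylor_fps (LP_fun \<sigma> N \<alpha>))
       (scaled_op (1 / (real d * (n d + real d))) (n d)) ^^ m d) (monom 1 d)))) \<mu>"
    if "(\<lambda>d. real (m d) / real d) \<longlonglongrightarrow> \<tau>" "0 \<le> \<tau>" for m \<tau>
    unfolding \<Phi>_def
    by (rule power_sequence_limit[OF _ summ _ assms(5-7) that]) (rule assms, assumption)+
  have "(\<lambda>d. real d / real d) \<longlonglongrightarrow> 1"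
    using tendsto_mult_div_ratio[of 1 1] by simp
  from limit[OF this] obtain \<mu> where \<mu>: "symmetric_distribution \<mu>"
    "\<forall>\<^sub>F z in at_left 0. rect_R lam \<mu> z = \<Phi> z"
    "weak_conv_m (\<lambda>d. sqrt_measure (root_measure (L_hat (LP_fun \<sigma> N \<alpha>) (n d) d))) \<mu>"
    unfolding L_hat_def by auto
  have "\<exists>\<rho>. symmetric_distribution \<rho> \<and>
       (\<forall>\<^sub>F z in at_left 0. rect_R lam \<rho> z = (real p / real k) * \<Phi> z)" if "k \<ge> 1" for p k
    using limit[OF tendsto_mult_div_ratio[OF that, of p]] by auto
  then have id: "rect_infinitely_divisible lam \<mu>"
    by (rule rect_infinitely_divisibleI[OF assms(6,7) _ \<mu>(1,2)])
  have "rect_infinitely_divisible lam \<nu> \<and> (\<forall>\<^sub>F z in at_left 0. rect_R lam \<nu> z = \<Phi> z) \<longleftrightarrow> \<nu> = \<mu>" for \<nu>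
  proof
    assume \<nu>: "rect_infinitely_divisible lam \<nu> \<and> (\<forall>\<^sub>F z in at_left 0. rect_R lam \<nu> z = \<Phi> z)"
    show "\<nu> = \<mu>"
    proof (rule rect_R_determines_symmetric[OF _ \<mu>(1) assms(6,7)])
      show "symmetric_distribution \<nu>" using \<nu> by (simp add: rect_infinitely_divisible_def)
      show "\<forall>\<^sub>F z in at_left 0. rect_R lam \<nu> z = rect_R lam \<mu> z"
        using \<nu>[THEN conjunct2] \<mu>(2) by eventually_elim simp
    qed
  qed (use id \<mu> in auto)
  then show ?thesis using \<mu>(3) unfolding \<Phi>_def by blast
qed

end
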